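(* Let $(A,\mathfrak{m})$ be a Cohen-Macaulay (Noetherian) local ring of dimension $d \geq 1$ with infinite residue field, and let $e$ denote the multiplicity of $A$ with respect to $\mathfrak{m}$. If $J$ is a minimal reduction of $\mathfrak{m}$, then $$\lambda(\mathfrak{m}^3/J\mathfrak{m}^2) = e + (d-1)\,\mu(\mathfrak{m}) - \mu(\mathfrak{m}^2) - \binom{d-1}{2}.$$
   Context: For an $A$-module $N$, $\lambda(N)$ denotes its length and $\mu(N)$ its minimal number of generators. A reduction of an ideal $I$ is an ideal $J \subseteq I$ such that $I^{n+1} = J I^n$ for some $n \geq 0$; a minimal reduction of $I$ is a reduction of $I$ that is minimal with respect to inclusion among the reductions of $I$. The multiplicity $e = e_0^{\mathfrak{m}}(A)$ of $A$ with respect to $\mathfrak{m}$ is the positive integer such that, for all large $n$, $\lambda(A/\mathfrak{m}^{n+1})$ agrees with a polynomial in $n$ of degree $d$ with leading coefficient $e/d!$. The binomial coefficient $\binom{d-1}{2}$ equals $(d-1)(d-2)/2$ (so it is $0$ for $d = 1, 2$). *)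

theory Defs
  imports
    "HOL-Library.Extended_Nat"
    "HOL-Computational_Algebra.Polynomial"
    "HOL-Algebra.Ring_Divisibility"
    "HOL-Algebra.Ideal_Product"
    "HOL-Algebra.Module"
begin

text \<open>Powers of an ideal are taken in the commutative monoid of ideals of \<open>R\<close>;
  in particular the power with exponent 0 is the unit ideal.\<close>

abbreviation ideal_pow :: "('a, 'b) ring_scheme \<Rightarrow> 'a set \<Rightarrow> nat \<Rightarrow> 'a set" where
  "ideal_pow R I n \<equiv> I [^]\<^bsub>ideals_set R\<^esub> n"


section \<open>Ideals and their quotients as modules\<close>

definition ideal_module :: "('a, 'b) ring_scheme \<Rightarrow> 'a set \<Rightarrow> ('a, 'a) module" where
  "ideal_module R I =
    \<lparr>carrier = I, mult = mult R, one = \<one>\<^bsub>R\<^esub>, zero = \<zero>\<^bsub>R\<^esub>, add = add R, smult = mult R\<rparr>"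

text \<open>The record type of modules extends that of rings; its fields \<open>mult\<close> and \<open>one\<close>
  play no role for modules and are left unspecified.\<close>

definition quot_module :: "('r, 'a, 'm) module_scheme \<Rightarrow> 'a set \<Rightarrow> ('r, 'a set) module" where
  "quot_module M N =
    \<lparr>carrier = a_rcosets\<^bsub>M\<^esub> N, mult = undefined, one = undefined, zero = N, add = set_add M,
     smult = (\<lambda>a X. \<Union>x\<in>X. N +>\<^bsub>M\<^esub> (a \<odot>\<^bsub>M\<^esub> x))\<rparr>"

lemma (in cring) ideal_module_is_module:
  assumes "ideal I R"
  shows "module R (ideal_module R I)"
proof -
  interpret I: ideal I R by fact
  show ?thesis
  proof (rule moduleI)
    show "cring R" by (rule is_cring)
    show "abelian_group (ideal_module R I)"
    proof (rule abelian_groupI)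
      fix x assume "x \<in> carrier (ideal_module R I)"
      then have "x \<in> I" by (simp add: ideal_module_def)
      then have "\<ominus> x \<in> I" "\<ominus> x \<oplus> x = \<zero>"
        by (auto simp: I.a_inv_closed I.Icarr l_neg)
      then show "\<exists>y\<in>carrier (ideal_module R I).
          y \<oplus>\<^bsub>ideal_module R I\<^esub> x = \<zero>\<^bsub>ideal_module R I\<^esub>"
        by (auto simp: ideal_module_def)
    qed (auto simp: ideal_module_def I.a_closed I.Icarr a_ac)
  qed (auto simp: ideal_module_def I.I_l_closed I.Icarr l_distr r_distr m_assoc)
qed

lemma (in module) quot_module_is_module:
  assumes "submodule N R M"
  shows "module R (quot_module M N)"
proof -
  interpret N: submodule N R M by fact
  interpret N: abelian_subgroup N M
    by (intro abelian_subgroupI3 additive_subgroup.intro N.subgroup_axioms M.abelian_group_axioms)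
  have smult: "a \<odot>\<^bsub>quot_module M N\<^esub> (N +>\<^bsub>M\<^esub> x) = N +>\<^bsub>M\<^esub> (a \<odot>\<^bsub>M\<^esub> x)"
    if a: "a \<in> carrier R" and x: "x \<in> carrier M" for a x
  proof -
    have "N +>\<^bsub>M\<^esub> (a \<odot>\<^bsub>M\<^esub> x') = N +>\<^bsub>M\<^esub> (a \<odot>\<^bsub>M\<^esub> x)" if x': "x' \<in> N +>\<^bsub>M\<^esub> x" for x'
    proof -
      obtain h where h: "h \<in> N" "x' = h \<oplus>\<^bsub>M\<^esub> x"
        using x' by (auto simp: a_r_coset_def r_coset_def)
      have "a \<odot>\<^bsub>M\<^esub> x' = a \<odot>\<^bsub>M\<^esub> h \<oplus>\<^bsub>M\<^esub> a \<odot>\<^bsub>M\<^esub> x"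
        using h a x by (simp add: smult_r_distr N.a_Hcarr)
      then have "a \<odot>\<^bsub>M\<^esub> x' \<in> N +>\<^bsub>M\<^esub> (a \<odot>\<^bsub>M\<^esub> x)"
        using h a by (auto simp: a_r_coset_def r_coset_def)
      then show ?thesis
        using N.a_repr_independence'[of "a \<odot>\<^bsub>M\<^esub> x'" "a \<odot>\<^bsub>M\<^esub> x"] a x by simp
    qed
    moreover have "x \<in> N +>\<^bsub>M\<^esub> x"
      using x by (rule N.a_rcos_self)
    ultimately have "(\<Union>x'\<in>N +>\<^bsub>M\<^esub> x. N +>\<^bsub>M\<^esub> (a \<odot>\<^bsub>M\<^esub> x')) = N +>\<^bsub>M\<^esub> (a \<odot>\<^bsub>M\<^esub> x)"
      by blast
    then show ?thesis by (simp add: quot_module_def)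
  qed
  interpret Q: comm_group "M A_Mod N"
    by (rule N.a_factorgroup_is_comm_group)
  note Q_simps = quot_module_def A_FactGroup_def'
  have grp: "abelian_group (quot_module M N)"
  proof (rule abelian_groupI)
    show "\<zero>\<^bsub>quot_module M N\<^esub> \<in> carrier (quot_module M N)"
      using Q.one_closed by (simp add: Q_simps)
  next
    fix X assume "X \<in> carrier (quot_module M N)"
    then show "\<exists>Y\<in>carrier (quot_module M N).
        Y \<oplus>\<^bsub>quot_module M N\<^esub> X = \<zero>\<^bsub>quot_module M N\<^esub>"
      using Q.l_inv_ex[of X] by (simp add: Q_simps)
  next
    fix X Y Z
    assume "X \<in> carrier (quot_module M N)" "Y \<in> carrier (quot_module M N)"
      "Z \<in> carrier (quot_module M N)"
    then show "X \<oplus>\<^bsub>quot_module M N\<^esub> Y \<oplus>\<^bsub>quot_module M N\<^esub> Z =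
        X \<oplus>\<^bsub>quot_module M N\<^esub> (Y \<oplus>\<^bsub>quot_module M N\<^esub> Z)"
      using Q.m_assoc[of X Y Z] by (simp add: Q_simps)
  next
    fix X Y
    assume XY: "X \<in> carrier (quot_module M N)" "Y \<in> carrier (quot_module M N)"
    show "X \<oplus>\<^bsub>quot_module M N\<^esub> Y \<in> carrier (quot_module M N)"
      using Q.m_closed[of X Y] XY by (simp add: Q_simps)
    show "X \<oplus>\<^bsub>quot_module M N\<^esub> Y = Y \<oplus>\<^bsub>quot_module M N\<^esub> X"
      using Q.m_comm[of X Y] XY by (simp add: Q_simps)
    show "\<zero>\<^bsub>quot_module M N\<^esub> \<oplus>\<^bsub>quot_module M N\<^esub> X = X"
      using Q.l_one[of X] XY by (simp add: Q_simps)
  qed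
  have add: "(N +>\<^bsub>M\<^esub> x) \<oplus>\<^bsub>quot_module M N\<^esub> (N +>\<^bsub>M\<^esub> y) = N +>\<^bsub>M\<^esub> (x \<oplus>\<^bsub>M\<^esub> y)"
    if "x \<in> carrier M" "y \<in> carrier M" for x y
    using that by (simp add: quot_module_def N.a_rcos_sum)
  have coset: "N +>\<^bsub>M\<^esub> x \<in> carrier (quot_module M N)" if "x \<in> carrier M" for x
    using that by (auto simp: quot_module_def A_RCOSETS_defs a_r_coset_def r_coset_def)
  have rep: "\<exists>x\<in>carrier M. X = N +>\<^bsub>M\<^esub> x" if "X \<in> carrier (quot_module M N)" for X
    using that by (auto simp: quot_module_def A_RCOSETS_defs a_r_coset_def r_coset_def)
  show ?thesis
  proof (rule moduleI)
    fix a b X Y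
    assume a: "a \<in> carrier R"
      and X: "X \<in> carrier (quot_module M N)" and Y: "Y \<in> carrier (quot_module M N)"
    obtain x y where xy: "x \<in> carrier M" "X = N +>\<^bsub>M\<^esub> x" "y \<in> carrier M" "Y = N +>\<^bsub>M\<^esub> y"
      using rep[OF X] rep[OF Y] by metis
    show "a \<odot>\<^bsub>quot_module M N\<^esub> (X \<oplus>\<^bsub>quot_module M N\<^esub> Y) =
        a \<odot>\<^bsub>quot_module M N\<^esub> X \<oplus>\<^bsub>quot_module M N\<^esub> a \<odot>\<^bsub>quot_module M N\<^esub> Y"
      using a xy by (simp add: smult add smult_r_distr)
  next
    fix a b X
    assume ab: "a \<in> carrier R" "b \<in> carrier R" and X: "X \<in> carrier (quot_module M N)"
    obtain x where x: "x \<in> carrier M" "X = N +>\<^bsub>M\<^esub> x"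
      using rep[OF X] by metis
    show "a \<odot>\<^bsub>quot_module M N\<^esub> X \<in> carrier (quot_module M N)"
      using ab x by (simp add: smult coset)
    show "(a \<oplus> b) \<odot>\<^bsub>quot_module M N\<^esub> X =
        a \<odot>\<^bsub>quot_module M N\<^esub> X \<oplus>\<^bsub>quot_module M N\<^esub> b \<odot>\<^bsub>quot_module M N\<^esub> X"
      using ab x by (simp add: smult add smult_l_distr)
    show "(a \<otimes> b) \<odot>\<^bsub>quot_module M N\<^esub> X =
        a \<odot>\<^bsub>quot_module M N\<^esub> (b \<odot>\<^bsub>quot_module M N\<^esub> X)"
      using ab x by (simp add: smult smult_assoc1)
  next
    fix X
    assume X: "X \<in> carrier (quot_module M N)"
    obtain x where x: "x \<in> carrier M" "X = N +>\<^bsub>M\<^esub> x"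
      using rep[OF X] by metis
    show "\<one> \<odot>\<^bsub>quot_module M N\<^esub> X = X"
      using x by (simp add: smult)
  qed (rule is_cring grp)+
qed


section \<open>Length and minimal number of generators\<close>

definition module_length :: "('r, 'c) ring_scheme \<Rightarrow> ('r, 'a, 'm) module_scheme \<Rightarrow> enat" where
  "module_length R M =
    Sup {enat n | n. \<exists>N. (\<forall>i\<le>n. submodule (N i) R M) \<and> (\<forall>i<n. N i \<subset> N (Suc i))}"

text \<open>Meaningful for finitely generated modules only.\<close>

definition min_num_gens :: "('r, 'c) ring_scheme \<Rightarrow> ('r, 'a, 'm) module_scheme \<Rightarrow> nat" where
  "min_num_gens R M =
    (LEAST n. \<exists>S\<subseteq>carrier M. finite S \<and> card S = n \<and>
      (\<lambda>N. submodule N R M) hull S = carrier M)"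


section \<open>Cohen-Macaulay local rings\<close>

definition krull_dim :: "('a, 'b) ring_scheme \<Rightarrow> enat" where
  "krull_dim R =
    Sup {enat n | n. \<exists>P. (\<forall>i\<le>n. primeideal (P i) R) \<and> (\<forall>i<n. P i \<subset> P (Suc i))}"

definition regular_sequence :: "('a, 'b) ring_scheme \<Rightarrow> 'a list \<Rightarrow> bool" where
  "regular_sequence R xs \<longleftrightarrow>
    set xs \<subseteq> carrier R \<and> Idl\<^bsub>R\<^esub> (set xs) \<noteq> carrier R \<and>
    (\<forall>i<length xs. \<forall>a\<in>carrier R.
      xs ! i \<otimes>\<^bsub>R\<^esub> a \<in> Idl\<^bsub>R\<^esub> (set (take i xs)) \<longrightarrow> a \<in> Idl\<^bsub>R\<^esub> (set (take i xs)))"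

definition ideal_depth :: "('a, 'b) ring_scheme \<Rightarrow> 'a set \<Rightarrow> enat" where
  "ideal_depth R I = Sup {enat (length xs) | xs. set xs \<subseteq> I \<and> regular_sequence R xs}"

locale noetherian_local_ring = cring R + noetherian_ring R + maximalideal m R
  for m and R (structure) +
  assumes maximal_unique: "maximalideal I R \<Longrightarrow> I = m"

locale cohen_macaulay_local_ring = noetherian_local_ring +
  assumes depth_eq_dim: "ideal_depth R m = krull_dim R"


section \<open>Multiplicity and reductions\<close>

definition local_multiplicity :: "('a, 'b) ring_scheme \<Rightarrow> 'a set \<Rightarrow> nat" where
  "local_multiplicity R m =
    (THE e. 0 < e \<and>
      (\<exists>p :: real poly. enat (Polynomial.degree p) = krull_dim R \<and>
        Polynomial.lead_coeff p = real e / fact (Polynomial.degree p) \<and>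
        (\<forall>\<^sub>F n in sequentially. \<exists>l.
          module_length R (quot_module (ideal_module R (carrier R)) (ideal_pow R m (n + 1))) = enat l \<and>
          real l = poly p (real n))))"

definition is_reduction :: "('a, 'b) ring_scheme \<Rightarrow> 'a set \<Rightarrow> 'a set \<Rightarrow> bool" where
  "is_reduction R J I \<longleftrightarrow>
    ideal J R \<and> J \<subseteq> I \<and> (\<exists>n. ideal_pow R I (n + 1) = J \<cdot>\<^bsub>R\<^esub> ideal_pow R I n)"

definition is_minimal_reduction :: "('a, 'b) ring_scheme \<Rightarrow> 'a set \<Rightarrow> 'a set \<Rightarrow> bool" where
  "is_minimal_reduction R J I \<longleftrightarrow>
    is_reduction R J I \<and> (\<forall>K. is_reduction R K I \<longrightarrow> K \<subseteq> J \<longrightarrow> K = J)"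

end

theory Submission
  imports Defs
begin

text \<open>
  Since the residue field is infinite, a minimal reduction \<open>J\<close> is generated by \<open>d\<close> elements: with more
  generators, growth of \<open>\<lambda>(A/\<mm>\<^sup>n)\<close> of order \<open>n\<^sup>d\<close> forces a homogeneous relation among them modulo \<open>\<mm>\<close>, and a
  linear change of variables makes one generator superfluous. As \<open>A\<close> is Cohen-Macaulay and \<open>J\<close> is
  \<open>\<mm>\<close>-primary, general generators \<open>z\<^sub>1, \<dots>, z\<^sub>d\<close> of \<open>J\<close> form a regular sequence. Hence
  \<open>\<lambda>(A/J\<^sup>n\<^sup>+\<^sup>1) = \<lambda>(A/J) \<cdot> binom(n + d, d)\<close>, and comparing \<open>J\<^sup>n\<close> with \<open>\<mm>\<^sup>n\<close> gives \<open>e = \<lambda>(A/J)\<close>.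
  The \<open>z\<^sub>i\<close> are independent modulo \<open>\<mm>\<^sup>2\<close>, so \<open>(J\<mm>\<^sup>2 + (z\<^sub>1, \<dots>, z\<^sub>i)) : z\<^sub>i\<^sub>+\<^sub>1 = \<mm>\<^sup>2 + (z\<^sub>1, \<dots>, z\<^sub>i)\<close>, which has
  colength \<open>1 + \<mu>(\<mm>) - i\<close>; summing, \<open>\<lambda>(J/J\<mm>\<^sup>2) = d (1 + \<mu>(\<mm>)) - binom(d, 2)\<close>. The formula
  follows by comparing the two filtrations \<open>J\<mm>\<^sup>2 \<subseteq> J \<subseteq> A\<close> and \<open>J\<mm>\<^sup>2 \<subseteq> \<mm>\<^sup>3 \<subseteq> \<mm>\<^sup>2 \<subseteq> \<mm> \<subseteq> A\<close>.
\<close>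

section \<open>Ideals of a commutative ring\<close>

text \<open>Every length in the formula is that of a module I/K for ideals K \<le> I, so length is
  treated as a function of intervals in the lattice of ideals: the modular law makes it additive,
  and one identity for colon ideals plays the part of exact sequences. Working modulo an ideal means
  working above it. Depth and dimension are linked by hand. Depth supplies a regular sequence of
  length d in m; each regular term yields one strict step in a chain of primes, so dimension d makes
  the sequence generate an m-primary ideal. That ideal bounds the growth of \<lambda>(A/m^n) before
  anything is known about J. That J has d regular generators is then a question of socles:
  exchanging regular elements shows that a regular sequence in m with fewer than d terms leaves no
  socle, and general elements of J can extend it. The multiplicity is specified through a
  polynomial, so a limit of \<lambda>(A/m^n)/n^d would not suffice: the polynomial itself must be
  produced. Filtering by powers of one variable, as in Hilbert's basis theorem, does this for graded
  systems of ideals.\<close>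

typedef (overloaded) ('a :: comm_ring_1) idl =
  "{I :: 'a set. 0 \<in> I \<and> (\<forall>x\<in>I. \<forall>y\<in>I. x + y \<in> I) \<and> (\<forall>r. \<forall>x\<in>I. r * x \<in> I)}"
  morphisms elts Abs_idl
  by (rule exI[of _ UNIV]) auto


lemma idl_zero [simp]: "0 \<in> elts I"
  using elts[of I] by auto

lemma idl_add: "x \<in> elts I \<Longrightarrow> y \<in> elts I \<Longrightarrow> x + y \<in> elts I"
  using elts[of I] by auto

lemma idl_mult: "x \<in> elts I \<Longrightarrow> r * x \<in> elts I"
  using elts[of I] by auto

lemma idl_mult': "x \<in> elts I \<Longrightarrow> x * r \<in> elts I"
  by (metis idl_mult mult.commute)

lemma idl_uminus: "x \<in> elts I \<Longrightarrow> - x \<in> elts I"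
  using idl_mult[of x I "-1"] by simp

lemma idl_diff: "x \<in> elts I \<Longrightarrow> y \<in> elts I \<Longrightarrow> x - y \<in> elts I"
  using idl_add[of x I "- y"] idl_uminus[of y I] by simp

lemma idl_diff_cancel: "x - y \<in> elts I \<Longrightarrow> y \<in> elts I \<Longrightarrow> x \<in> elts I"
  using idl_add[of "x - y" I y] by simp

lemma elts_Abs:
  assumes "0 \<in> I" "\<And>x y. x \<in> I \<Longrightarrow> y \<in> I \<Longrightarrow> x + y \<in> I" "\<And>r x. x \<in> I \<Longrightarrow> r * x \<in> I"
  shows "elts (Abs_idl I) = I"
  using assms by (intro Abs_idl_inverse) auto

instantiation idl :: (comm_ring_1) "{comm_semiring_1, semilattice_inf}"
begin

definition less_eq_idl :: "'a idl \<Rightarrow> 'a idl \<Rightarrow> bool" where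
  "I \<le> J \<longleftrightarrow> elts I \<subseteq> elts J"

definition less_idl :: "'a idl \<Rightarrow> 'a idl \<Rightarrow> bool" where
  "I < J \<longleftrightarrow> elts I \<subset> elts J"

definition zero_idl :: "'a idl" where "0 = Abs_idl {0}"

definition one_idl :: "'a idl" where "1 = Abs_idl UNIV"

definition inf_idl :: "'a idl \<Rightarrow> 'a idl \<Rightarrow> 'a idl" where
  "inf I J = Abs_idl (elts I \<inter> elts J)"

definition plus_idl :: "'a idl \<Rightarrow> 'a idl \<Rightarrow> 'a idl" where
  "I + J = Abs_idl {x + y | x y. x \<in> elts I \<and> y \<in> elts J}"

definition times_idl :: "'a idl \<Rightarrow> 'a idl \<Rightarrow> 'a idl" where
  "I * J = Abs_idl (\<Inter>{elts K | K. \<forall>x\<in>elts I. \<forall>y\<in>elts J. x * y \<in> elts K})"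

lemma elts_0 [simp]: "elts 0 = {0}"
  unfolding zero_idl_def by (rule elts_Abs) auto

lemma elts_1 [simp]: "elts 1 = UNIV"
  unfolding one_idl_def by (rule elts_Abs) auto

lemma elts_inf [simp]: "elts (inf I J) = elts I \<inter> elts J"
  unfolding inf_idl_def by (rule elts_Abs) (auto intro: idl_add idl_mult)

lemma elts_plus: "elts (I + J) = {x + y | x y. x \<in> elts I \<and> y \<in> elts J}"
  unfolding plus_idl_def
proof (rule elts_Abs)
  show "0 \<in> {x + y | x y. x \<in> elts I \<and> y \<in> elts J}"
    by (auto intro!: exI[of _ 0])
next
  fix u v assume "u \<in> {x + y | x y. x \<in> elts I \<and> y \<in> elts J}"
    "v \<in> {x + y | x y. x \<in> elts I \<and> y \<in> elts J}"
  then obtain a b c d where "u = a + b" "v = c + d" "a \<in> elts I" "c \<in> elts I" "b \<in> elts J" "d \<in> elts J"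
    by auto
  then have "u + v = (a + c) + (b + d)" "a + c \<in> elts I" "b + d \<in> elts J"
    by (auto intro: idl_add)
  then show "u + v \<in> {x + y | x y. x \<in> elts I \<and> y \<in> elts J}" by blast
next
  fix r u assume "u \<in> {x + y | x y. x \<in> elts I \<and> y \<in> elts J}"
  then show "r * u \<in> {x + y | x y. x \<in> elts I \<and> y \<in> elts J}"
    by (auto simp: distrib_left) (metis idl_mult)
qed

lemma elts_times: "elts (I * J) = \<Inter>{elts K | K. \<forall>x\<in>elts I. \<forall>y\<in>elts J. x * y \<in> elts K}"
  unfolding times_idl_def by (rule elts_Abs) (auto intro: idl_add idl_mult)

lemma idl_eqI: "elts I = elts J \<Longrightarrow> I = J" for I J :: "'a idl"
  by (simp add: elts_inject)

lemma times_le_iff: "I * J \<le> K \<longleftrightarrow> (\<forall>x\<in>elts I. \<forall>y\<in>elts J. x * y \<in> elts K)"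
  unfolding less_eq_idl_def elts_times by blast

lemma times_mem: "x \<in> elts I \<Longrightarrow> y \<in> elts J \<Longrightarrow> x * y \<in> elts (I * J)"
  unfolding elts_times by auto

lemma plus_le_iff: "I + J \<le> K \<longleftrightarrow> I \<le> K \<and> J \<le> K" for I J K :: "'a idl"
proof
  assume *: "I + J \<le> K"
  have "x \<in> elts (I + J)" if "x \<in> elts I \<or> x \<in> elts J" for x
    unfolding elts_plus using that
    by (auto intro: exI[of _ 0] exI[of _ x])
  with * show "I \<le> K \<and> J \<le> K" unfolding less_eq_idl_def by blast
next
  assume "I \<le> K \<and> J \<le> K"
  then show "I + J \<le> K" unfolding less_eq_idl_def elts_plus by (auto intro: idl_add)
qed

text \<open>The ideal quotient (L : K), right adjoint to multiplication by \<open>K\<close>. Through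
  it, associativity and distributivity of the product reduce to checks on single products x * y
  instead of finite sums of them.\<close>

definition residual :: "'a idl \<Rightarrow> 'a idl \<Rightarrow> 'a idl" where
  "residual L K = Abs_idl {x. \<forall>k\<in>elts K. x * k \<in> elts L}"

lemma elts_residual: "elts (residual L K) = {x. \<forall>k\<in>elts K. x * k \<in> elts L}"
  unfolding residual_def
  by (rule elts_Abs) (auto simp: distrib_right mult.assoc intro: idl_add idl_mult)

lemma times_le_residual: "I * K \<le> L \<longleftrightarrow> I \<le> residual L K"
  unfolding times_le_iff by (auto simp: less_eq_idl_def elts_residual)

instance
proof
  fix I J K :: "'a idl"
  have antisym: "I \<le> J \<Longrightarrow> J \<le> I \<Longrightarrow> I = J" for I J :: "'a idl"
    by (auto simp: less_eq_idl_def intro: idl_eqI)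
  have comm: "I * J = J * I" for I J :: "'a idl"
    by (rule antisym) (auto simp: times_le_iff, (metis times_mem mult.commute)+)
  have assoc_le: "I * J * K \<le> I * (J * K)" for I J K :: "'a idl"
    unfolding times_le_residual[of "I * J"] times_le_iff[of I J] elts_residual
    by (auto simp: mult.assoc intro: times_mem)
  have assoc_le': "I * (J * K) \<le> I * J * K" for I J K :: "'a idl"
    using assoc_le[of K J I] by (simp add: comm)
  show "(I < J) = (I \<le> J \<and> \<not> J \<le> I)" by (auto simp: less_idl_def less_eq_idl_def)
  show "I \<le> I" by (auto simp: less_eq_idl_def)
  show "I \<le> J \<Longrightarrow> J \<le> K \<Longrightarrow> I \<le> K" by (auto simp: less_eq_idl_def)
  show "I \<le> J \<Longrightarrow> J \<le> I \<Longrightarrow> I = J" by (rule antisym)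
  show "inf I J \<le> I" "inf I J \<le> J" by (auto simp: less_eq_idl_def)
  show "I \<le> J \<Longrightarrow> I \<le> K \<Longrightarrow> I \<le> inf J K" by (auto simp: less_eq_idl_def)
  have le_refl: "I \<le> I" for I :: "'a idl" by (auto simp: less_eq_idl_def)
  have le_plus: "I \<le> I + J \<and> J \<le> I + J" for I J :: "'a idl"
    using plus_le_iff[of I J "I + J"] le_refl by auto
  have trans: "I \<le> J \<Longrightarrow> J \<le> K \<Longrightarrow> I \<le> K" for I J K :: "'a idl" by (auto simp: less_eq_idl_def)
  show "I + J + K = I + (J + K)"
  proof (rule antisym)
    show "I + J + K \<le> I + (J + K)"
      unfolding plus_le_iff using le_plus trans by blast
    show "I + (J + K) \<le> I + J + K"
      unfolding plus_le_iff using le_plus trans by blast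
  qed
  show "I + J = J + I"
    by (rule antisym) (auto simp: plus_le_iff le_plus)
  show "0 + I = I"
  proof (rule antisym)
    show "0 + I \<le> I" unfolding plus_le_iff using le_refl by (auto simp: less_eq_idl_def)
    show "I \<le> 0 + I" using le_plus by auto
  qed
  show "I * J * K = I * (J * K)" by (rule antisym) (rule assoc_le assoc_le')+
  show "I * J = J * I" by (rule comm)
  show "1 * I = I"
  proof (rule antisym)
    show "1 * I \<le> I" unfolding times_le_iff by (auto intro: idl_mult)
    have "1 * x \<in> elts (1 * I)" if "x \<in> elts I" for x
      using that by (intro times_mem) auto
    then show "I \<le> 1 * I" by (auto simp: less_eq_idl_def)
  qed
  show "(I + J) * K = I * K + J * K"
  proof (rule antisym)
    have "I * K \<le> I * K + J * K" "J * K \<le> I * K + J * K" using le_plus by auto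
    then show "(I + J) * K \<le> I * K + J * K"
      unfolding times_le_residual by (simp add: plus_le_iff)
    have "I * K \<le> (I + J) * K" "J * K \<le> (I + J) * K"
      using le_plus unfolding times_le_iff by (auto simp: less_eq_idl_def intro!: times_mem)
    then show "I * K + J * K \<le> (I + J) * K" by (simp add: plus_le_iff)
  qed
  show zero: "0 * I = 0"
  proof (rule antisym)
    show "0 * I \<le> 0" unfolding times_le_iff by auto
    show "0 \<le> 0 * I" by (auto simp: less_eq_idl_def)
  qed
  show "I * 0 = 0" using zero by (simp add: comm)
  show "(0 :: 'a idl) \<noteq> 1"
  proof
    assume "(0 :: 'a idl) = 1"
    then have "elts (0 :: 'a idl) = elts 1" by (rule arg_cong)
    then have "(1 :: 'a) \<in> {0}" by simp
    then show False by simp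
  qed
qed

end

lemma idl_le_add1 [simp]: "I \<le> I + J" for I J :: "'a :: comm_ring_1 idl"
  using plus_le_iff[of I J "I + J"] by auto

lemma idl_le_add2 [simp]: "J \<le> I + J" for I J :: "'a :: comm_ring_1 idl"
  using plus_le_iff[of I J "I + J"] by auto

lemma idl_le_addI1: "K \<le> I \<Longrightarrow> K \<le> I + J" for I J :: "'a :: comm_ring_1 idl"
  by (meson idl_le_add1 order_trans)

lemma idl_le_addI2: "K \<le> J \<Longrightarrow> K \<le> I + J" for I J :: "'a :: comm_ring_1 idl"
  by (meson idl_le_add2 order_trans)

instance idl :: (comm_ring_1) canonically_ordered_monoid_add
proof
  fix I J :: "'a idl"
  show "I \<le> J \<longleftrightarrow> (\<exists>K. J = I + K)"
  proof
    assume "I \<le> J"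
    then have "J = I + J" by (intro antisym) (auto simp: plus_le_iff)
    then show "\<exists>K. J = I + K" ..
  qed auto
qed

instance idl :: (comm_ring_1) ordered_comm_semiring
proof
  fix I J K :: "'a idl"
  assume "I \<le> J"
  then show "K * I \<le> K * J"
    unfolding times_le_iff by (auto simp: less_eq_idl_def intro!: times_mem)
qed

lemma idl_add_absorb1: "I \<le> J \<Longrightarrow> I + J = J" for I :: "'a :: comm_ring_1 idl"
  by (intro antisym) (auto simp: plus_le_iff)

lemma idl_add_absorb2: "J \<le> I \<Longrightarrow> I + J = I" for I :: "'a :: comm_ring_1 idl"
  by (intro antisym) (auto simp: plus_le_iff)

lemma idl_le_1 [simp]: "I \<le> 1" for I :: "'a :: comm_ring_1 idl"
  by (simp add: less_eq_idl_def)

lemma idl_mult_le1 [simp]: "I * J \<le> I" for I :: "'a :: comm_ring_1 idl"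
  using mult_left_mono[of J 1 I] by simp

lemma idl_mult_le2 [simp]: "I * J \<le> J" for I :: "'a :: comm_ring_1 idl"
  using mult_right_mono[of I 1 J] by simp

lemma idl_mult_mono: "I \<le> J \<Longrightarrow> K \<le> L \<Longrightarrow> I * K \<le> J * L" for I :: "'a :: comm_ring_1 idl"
  by (intro mult_mono) auto

lemma idl_pow_mono: "I \<le> J \<Longrightarrow> I ^ n \<le> J ^ n" for I :: "'a :: comm_ring_1 idl"
  by (induction n) (auto intro: idl_mult_mono)

lemma idl_pow_antimono: "k \<le> n \<Longrightarrow> I ^ n \<le> I ^ k" for I :: "'a :: comm_ring_1 idl"
  using idl_mult_le1[of "I ^ k" "I ^ (n - k)"] by (simp flip: power_add)

lemma idl_leD: "I \<le> J \<Longrightarrow> x \<in> elts I \<Longrightarrow> x \<in> elts J"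
  by (auto simp: less_eq_idl_def)

lemma idl_leI: "(\<And>x. x \<in> elts I \<Longrightarrow> x \<in> elts J) \<Longrightarrow> I \<le> J"
  by (auto simp: less_eq_idl_def)

lemma idl_plusE:
  assumes "x \<in> elts (I + J)"
  obtains a b where "a \<in> elts I" "b \<in> elts J" "x = a + b"
  using assms by (auto simp: elts_plus)

lemma idl_plusI: "a \<in> elts I \<Longrightarrow> b \<in> elts J \<Longrightarrow> a + b \<in> elts (I + J)"
  by (auto simp: elts_plus)

lemma idl_plusI1: "a \<in> elts I \<Longrightarrow> a \<in> elts (I + J)"
  using idl_leD idl_le_add1 by blast

lemma idl_plusI2: "a \<in> elts J \<Longrightarrow> a \<in> elts (I + J)"
  using idl_leD idl_le_add2 by blast

lemma idl_plus_iff: "x \<in> elts (I + J) \<longleftrightarrow> (\<exists>y\<in>elts J. x - y \<in> elts I)"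
proof
  assume "x \<in> elts (I + J)"
  then obtain a b where "a \<in> elts I" "b \<in> elts J" "x = a + b" by (rule idl_plusE)
  then show "\<exists>y\<in>elts J. x - y \<in> elts I" by (intro bexI[of _ b]) auto
next
  assume "\<exists>y\<in>elts J. x - y \<in> elts I"
  then obtain y where "y \<in> elts J" "x - y \<in> elts I" by auto
  from idl_plusI[OF this(2,1)] show "x \<in> elts (I + J)" by simp
qed

lemma idl_modular:
  fixes I J K :: "'a :: comm_ring_1 idl"
  assumes "I \<le> K"
  shows "inf (I + J) K = I + inf J K"
proof (rule antisym)
  show "inf (I + J) K \<le> I + inf J K"
  proof (rule idl_leI)
    fix x assume "x \<in> elts (inf (I + J) K)"
    then obtain a b where *: "a \<in> elts I" "b \<in> elts J" "x = a + b" "x \<in> elts K" by (auto elim: idl_plusE)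
    then have "b \<in> elts K" using idl_diff[of x K a] assms idl_leD by fastforce
    with * show "x \<in> elts (I + inf J K)" by (auto intro: idl_plusI)
  qed
  show "I + inf J K \<le> inf (I + J) K"
    using assms by (auto simp: plus_le_iff intro: idl_le_addI2)
qed

section \<open>Principal ideals, colon ideals and ideals generated by lists\<close>

definition prin :: "'a :: comm_ring_1 \<Rightarrow> 'a idl" where
  "prin x = Abs_idl (range (\<lambda>r. r * x))"

lemma elts_prin: "elts (prin x) = range (\<lambda>r. r * x)"
  unfolding prin_def
proof (rule elts_Abs)
  show "0 \<in> range (\<lambda>r. r * x)" by (auto intro: image_eqI[of _ _ 0])
  show "u + v \<in> range (\<lambda>r. r * x)" if "u \<in> range (\<lambda>r. r * x)" "v \<in> range (\<lambda>r. r * x)" for u v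
    using that by (auto simp flip: distrib_right)
  show "r * u \<in> range (\<lambda>r. r * x)" if "u \<in> range (\<lambda>r. r * x)" for r u
    using that by (auto simp flip: mult.assoc)
qed

lemma prin_self [simp]: "x \<in> elts (prin x)"
  by (auto simp: elts_prin intro: image_eqI[of _ _ 1])

lemma prin_le_iff: "prin x \<le> I \<longleftrightarrow> x \<in> elts I"
  using prin_self[of x] by (auto simp: less_eq_idl_def elts_prin intro: idl_mult)

lemma prin_1 [simp]: "prin 1 = 1"
  by (rule idl_eqI) (auto simp: elts_prin image_iff)

text \<open>In a product with a principal ideal every element is a single multiple x * a, because
  sums can be collected in the second factor. The element computations with colon ideals rest on
  this.\<close>

lemma elts_prin_times: "elts (prin x * I) = (\<lambda>a. x * a) ` elts I"
proof -
  have e: "elts (Abs_idl ((\<lambda>a. x * a) ` elts I)) = (\<lambda>a. x * a) ` elts I"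
  proof (rule elts_Abs)
    show "0 \<in> (\<lambda>a. x * a) ` elts I" by (auto intro: image_eqI[of _ _ 0])
    show "u + v \<in> (\<lambda>a. x * a) ` elts I" if "u \<in> (\<lambda>a. x * a) ` elts I" "v \<in> (\<lambda>a. x * a) ` elts I" for u v
      using that by (auto intro!: imageI idl_add simp flip: distrib_left)
    show "r * u \<in> (\<lambda>a. x * a) ` elts I" if "u \<in> (\<lambda>a. x * a) ` elts I" for r u
      using that by (auto intro!: imageI idl_mult simp: mult.left_commute[of r])
  qed
  have "prin x * I = Abs_idl ((\<lambda>a. x * a) ` elts I)"
  proof (rule antisym)
    show "prin x * I \<le> Abs_idl ((\<lambda>a. x * a) ` elts I)"
      unfolding times_le_iff e elts_prin
    proof safe
      fix r y assume "y \<in> elts I"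
      then have "r * y \<in> elts I" "r * x * y = x * (r * y)" by (auto intro: idl_mult simp: ac_simps)
      then show "r * x * y \<in> (\<lambda>a. x * a) ` elts I" by blast
    qed
    show "Abs_idl ((\<lambda>a. x * a) ` elts I) \<le> prin x * I"
      unfolding less_eq_idl_def e by (auto intro: times_mem)
  qed
  then show ?thesis by (simp add: e)
qed

lemma prin_mult: "prin (x * y) = prin x * prin y"
  by (rule idl_eqI) (auto simp: elts_prin_times elts_prin image_image mult.left_commute)

lemma prin_power: "prin (x ^ n) = prin x ^ n"
  by (induction n) (simp_all add: prin_mult)

lemma mem_plus_prin_iff: "a \<in> elts (K + prin x) \<longleftrightarrow> (\<exists>c. a - c * x \<in> elts K)"
  by (auto simp: idl_plus_iff elts_prin)

lemma prin_times_le_iff: "prin x * I \<le> K \<longleftrightarrow> (\<forall>a\<in>elts I. x * a \<in> elts K)"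
  by (auto simp: less_eq_idl_def elts_prin_times)

definition colon :: "'a :: comm_ring_1 idl \<Rightarrow> 'a \<Rightarrow> 'a idl" where
  "colon K x = Abs_idl {a. x * a \<in> elts K}"

lemma elts_colon [simp]: "elts (colon K x) = {a. x * a \<in> elts K}"
  unfolding colon_def
  by (rule elts_Abs) (auto simp: distrib_left mult.left_commute intro: idl_add idl_mult)

lemma colon_ge: "K \<le> colon K x"
  by (auto simp: less_eq_idl_def intro: idl_mult)

definition lgen :: "'a :: comm_ring_1 list \<Rightarrow> 'a idl" where
  "lgen xs = sum_list (map prin xs)"

lemma lgen_Nil [simp]: "lgen [] = 0"
  and lgen_Cons [simp]: "lgen (x # xs) = prin x + lgen xs"
  and lgen_append [simp]: "lgen (xs @ ys) = lgen xs + lgen ys"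
  by (auto simp: lgen_def)

lemma lgen_le_iff: "lgen xs \<le> I \<longleftrightarrow> set xs \<subseteq> elts I"
  by (induction xs) (auto simp: plus_le_iff prin_le_iff)

lemma lgen_mem: "x \<in> set xs \<Longrightarrow> x \<in> elts (lgen xs)"
  using lgen_le_iff[of xs "lgen xs"] by auto

lemma lgen_mono: "set xs \<subseteq> set ys \<Longrightarrow> lgen xs \<le> lgen ys"
  by (auto simp: lgen_le_iff intro: lgen_mem)

section \<open>Length of intervals of ideals and local rings\<close>

text \<open>The lowest member only has to lie above \<open>K\<close>, so a chain in a smaller
  interval is literally a chain in a larger one and endpoints never need adjusting.\<close>

primrec chain_from :: "nat \<Rightarrow> 'a :: order \<Rightarrow> 'a \<Rightarrow> bool" where
  "chain_from 0 K I \<longleftrightarrow> K \<le> I"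
| "chain_from (Suc n) K I \<longleftrightarrow> (\<exists>M. chain_from n K M \<and> M < I)"

lemma chain_from_le: "chain_from n K I \<Longrightarrow> K \<le> I"
  by (induction n arbitrary: I) (auto intro: order.trans less_imp_le)

lemma chain_from_mono: "chain_from n K M \<Longrightarrow> M \<le> I \<Longrightarrow> chain_from n K I"
  by (cases n) (auto intro: order.trans less_le_trans)

lemma chain_from_Suc: "chain_from (Suc n) K I \<Longrightarrow> chain_from n K I"
  by (auto intro: chain_from_mono less_imp_le)

lemma chain_from_anti: "chain_from n K I \<Longrightarrow> k \<le> n \<Longrightarrow> chain_from k K I"
  by (induction n) (auto simp: le_Suc_eq dest: chain_from_Suc simp del: chain_from.simps(2))

lemma chain_from_append: "chain_from q J I \<Longrightarrow> chain_from p K J \<Longrightarrow> chain_from (p + q) K I"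
  by (induction q arbitrary: I) (auto intro: chain_from_mono)

lemma chain_from_image:
  assumes "chain_from n K I" "\<And>M N. K \<le> M \<Longrightarrow> M < N \<Longrightarrow> N \<le> I \<Longrightarrow> f M < f N"
  shows "chain_from n (f K) (f I)"
  using assms
proof (induction n arbitrary: I)
  case 0
  then show ?case by (cases "K = I") (auto intro: less_imp_le)
next
  case (Suc n)
  then obtain M where M: "chain_from n K M" "M < I" by auto
  have "chain_from n (f K) (f M)"
    by (rule Suc.IH[OF M(1)]) (meson M(2) Suc.prems(2) less_imp_le order.trans)
  moreover have "f M < f I" using Suc.prems(2)[of M I] M chain_from_le by auto
  ultimately show ?case by auto
qed

lemma chain_from_iff_fun:
  "chain_from n K I \<longleftrightarrow> (\<exists>f. K \<le> f 0 \<and> (\<forall>i<n. f i < f (Suc i)) \<and> f n \<le> I)"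
proof
  show "chain_from n K I \<Longrightarrow> \<exists>f. K \<le> f 0 \<and> (\<forall>i<n. f i < f (Suc i)) \<and> f n \<le> I"
  proof (induction n arbitrary: I)
    case 0
    then show ?case by auto
  next
    case (Suc n)
    then obtain M where M: "chain_from n K M" "M < I" by auto
    with Suc.IH obtain f where f: "K \<le> f 0" "\<forall>i<n. f i < f (Suc i)" "f n \<le> M" by blast
    define g where "g = f(Suc n := I)"
    have "K \<le> g 0" "\<forall>i<Suc n. g i < g (Suc i)" "g (Suc n) \<le> I"
      using f M by (auto simp: g_def less_Suc_eq)
    then show ?case by blast
  qed
  show "\<exists>f. K \<le> f 0 \<and> (\<forall>i<n. f i < f (Suc i)) \<and> f n \<le> I \<Longrightarrow> chain_from n K I"
  proof (induction n arbitrary: I)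
    case 0
    then show ?case by (auto intro: order.trans)
  next
    case (Suc n)
    then obtain f where f: "K \<le> f 0" "\<forall>i<Suc n. f i < f (Suc i)" "f (Suc n) \<le> I" by auto
    then have "chain_from n K (f n)" by (intro Suc.IH exI[of _ f]) auto
    moreover have "f n < I" using f by (meson lessI less_le_trans)
    ultimately show ?case by auto
  qed
qed

definition len :: "'a :: order \<Rightarrow> 'a \<Rightarrow> enat" where
  "len K I = Sup (enat ` {n. chain_from n K I})"

lemma chain_from_le_len: "chain_from n K I \<Longrightarrow> enat n \<le> len K I"
  unfolding len_def by (intro Sup_upper) auto

lemma len_le: "(\<And>n. chain_from n K I \<Longrightarrow> enat n \<le> c) \<Longrightarrow> len K I \<le> c"
  unfolding len_def by (intro Sup_least) auto

text \<open>A finite supremum of natural numbers is a maximum. For l = 0 the chain comes from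
  \<open>K \<le> I\<close>, since the supremum of the empty set is 0 as well.\<close>

lemma len_attained:
  assumes "len K I = enat l" "K \<le> I"
  shows "chain_from l K I"
proof (cases l)
  case 0
  with assms show ?thesis by simp
next
  case (Suc k)
  show ?thesis
  proof (rule ccontr)
    assume "\<not> chain_from l K I"
    then have "n \<le> k" if "chain_from n K I" for n
      using that chain_from_anti[of n K I l] Suc by (meson not_less_eq_eq)
    then have "len K I \<le> enat k" by (intro len_le) auto
    with assms Suc show False by simp
  qed
qed

lemma len_infinite:
  assumes "len K I = \<infinity>"
  shows "chain_from l K I"
proof (rule ccontr)
  assume "\<not> chain_from l K I"
  then have "n \<le> l" if "chain_from n K I" for n
    using that chain_from_anti[of n K I l] by (meson linear)
  then have "len K I \<le> enat l" by (intro len_le) auto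
  with assms show False by simp
qed

lemma len_self [simp]: "len K K = 0"
proof -
  have "n = 0" if "chain_from n K K" for n
    using that by (cases n) (auto dest: chain_from_le)
  then have "len K K \<le> enat 0" by (intro len_le) auto
  then show ?thesis by (simp flip: zero_enat_def)
qed

lemma less_add_idl: "\<not> J \<le> K \<Longrightarrow> K < K + J" for J K :: "'a :: comm_ring_1 idl"
  by (rule le_neq_trans) (auto simp: plus_le_iff, metis idl_le_add2)

lemma len_eq_0: "len K I = 0 \<Longrightarrow> K \<le> I \<Longrightarrow> K = I"
proof (rule ccontr)
  assume *: "len K I = 0" "K \<le> I" "K \<noteq> I"
  then have "chain_from 1 K I" by (auto intro: exI[of _ K])
  then have "enat 1 \<le> len K I" by (rule chain_from_le_len)
  with * show False by (simp add: zero_enat_def)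
qed

text \<open>Intersect the chain with \<open>J\<close> and add \<open>J\<close> to it. By the modular
  law a strict step cannot become an equality in both images, so the n steps distribute over the two
  intervals.\<close>

lemma chain_from_split:
  fixes K I :: "'a :: comm_ring_1 idl"
  assumes "chain_from n K I" "K \<le> J"
  shows "\<exists>p q. p + q = n \<and> chain_from p K (inf I J) \<and> chain_from q J (I + J)"
  using assms(1)
proof (induction n arbitrary: I)
  case 0
  with assms(2) show ?case by auto
next
  case (Suc n)
  then obtain M where M: "chain_from n K M" "M < I" by auto
  with Suc.IH obtain p q where pq: "p + q = n" "chain_from p K (inf M J)" "chain_from q J (M + J)"
    by blast
  have le: "inf M J \<le> inf I J" "M + J \<le> I + J"
    using M by (auto simp: plus_le_iff intro: le_infI1 idl_le_addI1 less_imp_le)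
  show ?case
  proof (cases "inf M J = inf I J")
    case True
    have "M + J \<noteq> I + J"
    proof
      assume eq: "M + J = I + J"
      have "M = M + inf I J" using True by (metis inf_le1 idl_add_absorb2)
      also have "\<dots> = inf (M + J) I" using idl_modular[of M I J] M by (simp add: inf_commute less_imp_le)
      also have "\<dots> = I" by (simp add: eq inf_absorb2)
      finally show False using M by simp
    qed
    then have "M + J < I + J" using le by auto
    then have "chain_from (Suc q) J (I + J)" using pq by auto
    then show ?thesis using pq True by (intro exI[of _ p] exI[of _ "Suc q"]) auto
  next
    case False
    then have "inf M J < inf I J" by (rule le_neq_trans[OF le(1)])
    then have "chain_from (Suc p) K (inf I J)" using pq by auto
    then show ?thesis using pq le
      by (intro exI[of _ "Suc p"] exI[of _ q]) (auto intro: chain_from_mono)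
  qed
qed

lemma len_add:
  fixes K J I :: "'a :: comm_ring_1 idl"
  assumes "K \<le> J" "J \<le> I"
  shows "len K I = len K J + len J I"
proof (rule antisym)
  show "len K I \<le> len K J + len J I"
  proof (rule len_le)
    fix n assume "chain_from n K I"
    from chain_from_split[OF this assms(1)] obtain p q where
      "p + q = n" "chain_from p K J" "chain_from q J I"
      using assms(2) by (auto simp: inf_absorb2 idl_add_absorb2)
    then show "enat n \<le> len K J + len J I"
      using chain_from_le_len add_mono by (metis plus_enat_simps(1))
  qed
  have app: "enat (p + q) \<le> len K I" if "chain_from p K J" "chain_from q J I" for p q
    using chain_from_append[OF that(2,1)] by (rule chain_from_le_len)
  show "len K J + len J I \<le> len K I"
  proof (cases "len K I")
    case (enat l)
    have "len K J \<noteq> \<infinity>"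
      using app[OF len_infinite[of K J "Suc l"], of 0] assms enat by auto
    moreover have "len J I \<noteq> \<infinity>"
      using app[OF _ len_infinite[of J I "Suc l"], of 0] assms enat by auto
    ultimately obtain p q where pq: "len K J = enat p" "len J I = enat q" by auto
    show ?thesis
      using app[OF len_attained len_attained, OF pq(1) _ pq(2)] assms pq by simp
  qed auto
qed

lemma len_mono_right:
  fixes K J I :: "'a :: comm_ring_1 idl"
  shows "K \<le> J \<Longrightarrow> J \<le> I \<Longrightarrow> len K J \<le> len K I"
  using len_add[of K J I] by simp

lemma len_anti_left:
  fixes K J I :: "'a :: comm_ring_1 idl"
  shows "K \<le> J \<Longrightarrow> J \<le> I \<Longrightarrow> len J I \<le> len K I"
  using len_add[of K J I] by simp

text \<open>Multiplication by \<open>x\<close> induces an isomorphism of \<open>E / (E \<inter> (K : x))\<close> onto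
  \<open>(K + x E) / K\<close>; it is expressed here through the lattices of intermediate ideals.\<close>

lemma len_colon: "len (inf E (colon K x)) E = len K (K + prin x * E)"
proof (rule antisym)
  define K' where "K' = inf E (colon K x)"
  define f where "f L = K + prin x * L" for L
  define g where "g M = inf E (colon M x)" for M
  have gf: "g (f L) = L" if "K' \<le> L" "L \<le> E" for L
  proof (rule antisym)
    show "g (f L) \<le> L"
    proof (rule idl_leI)
      fix a assume "a \<in> elts (g (f L))"
      then have a: "a \<in> elts E" "x * a \<in> elts (K + prin x * L)" by (auto simp: g_def f_def)
      then obtain k l where kl: "k \<in> elts K" "l \<in> elts L" "x * a = k + x * l"
        by (auto simp: elts_prin_times elim!: idl_plusE)
      then have "x * (a - l) \<in> elts K" by (simp add: right_diff_distrib)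
      moreover have "a - l \<in> elts E" by (rule idl_diff[OF a(1) idl_leD[OF that(2) kl(2)]])
      ultimately have "a - l \<in> elts K'" by (simp add: K'_def)
      then show "a \<in> elts L" using idl_leD[OF that(1)] kl idl_diff_cancel by blast
    qed
    show "L \<le> g (f L)"
    proof (rule idl_leI)
      fix a assume a: "a \<in> elts L"
      then have "x * a \<in> elts (prin x * L)" by (simp add: elts_prin_times)
      then show "a \<in> elts (g (f L))"
        using idl_leD[OF that(2) a] by (simp add: g_def f_def idl_plusI2)
    qed
  qed
  have finitely_generated: "f (g M) = M" if "K \<le> M" "M \<le> K + prin x * E" for M
  proof (rule antisym)
    show "f (g M) \<le> M" using that by (auto simp: f_def g_def plus_le_iff prin_times_le_iff)
    show "M \<le> f (g M)"
    proof (rule idl_leI)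
      fix b assume b: "b \<in> elts M"
      from idl_leD[OF that(2) b] obtain k e where ke: "k \<in> elts K" "e \<in> elts E" "b = k + x * e"
        by (auto simp: elts_prin_times elim!: idl_plusE)
      have "x * e \<in> elts M" using ke idl_diff[OF b idl_leD[OF that(1) ke(1)]] by simp
      then have "x * e \<in> elts (prin x * g M)" using ke by (simp add: g_def elts_prin_times)
      then show "b \<in> elts (f (g M))"
        using ke by (simp add: f_def idl_plusI)
    qed
  qed
  have mf: "L \<le> L' \<Longrightarrow> f L \<le> f L'" for L L'
    by (auto simp: f_def plus_le_iff intro: idl_le_addI2 idl_mult_mono)
  have mg: "L \<le> L' \<Longrightarrow> g L \<le> g L'" for L L'
    by (auto simp: g_def intro!: idl_leI dest: idl_leD)
  have fK: "f K' = K" by (intro antisym) (auto simp: f_def K'_def plus_le_iff prin_times_le_iff)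
  have gK: "g K = K'" by (simp add: g_def K'_def)
  have "enat n \<le> len K (f E)" if "chain_from n K' E" for n
  proof -
    have "chain_from n (f K') (f E)"
      using that
    proof (rule chain_from_image)
      fix M N assume MN: "K' \<le> M" "M < N" "N \<le> E"
      then have "g (f M) = M" "g (f N) = N" by (auto intro!: gf)
      then have "f M \<noteq> f N" using MN(2) by (metis less_irrefl)
      then show "f M < f N" using mf[of M N] MN by (intro le_neq_trans) auto
    qed
    then show ?thesis by (simp add: fK chain_from_le_len)
  qed
  then show "len (inf E (colon K x)) E \<le> len K (K + prin x * E)"
    by (intro len_le) (auto simp: K'_def f_def)
  have gE: "g (f E) = E" by (rule gf) (auto simp: K'_def)
  have "enat n \<le> len K' E" if "chain_from n K (f E)" for n
  proof -
    have "chain_from n (g K) (g (f E))"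
      using that
    proof (rule chain_from_image)
      fix M N assume MN: "K \<le> M" "M < N" "N \<le> f E"
      then have "f (g M) = M" "f (g N) = N" by (auto intro!: finitely_generated simp del: f_def simp: f_def[of E])
      then have "g M \<noteq> g N" using MN(2) by (metis less_irrefl)
      then show "g M < g N" using mg[of M N] MN by (intro le_neq_trans) auto
    qed
    then show ?thesis by (simp add: gK gE chain_from_le_len)
  qed
  then show "len K (K + prin x * E) \<le> len (inf E (colon K x)) E"
    by (intro len_le) (auto simp: K'_def f_def)
qed

lemma len_prin: "len K (K + prin x) = len (colon K x) 1"
  using len_colon[of 1 K x] by (simp add: inf_absorb2)

text \<open>The ring under study is the quotient by \<open>K0\<close>; its ideals are the ideals above \<open>K0\<close>. The ambient
  ring need not be Noetherian or local.\<close>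

locale noetherian_above =
  fixes K0 :: "'a :: comm_ring_1 idl"
  assumes noeth: "\<And>f :: nat \<Rightarrow> 'a idl. (\<And>n. K0 \<le> f n) \<Longrightarrow> (\<And>n. f n \<le> f (Suc n)) \<Longrightarrow>
      \<exists>n. \<forall>k\<ge>n. f k = f n"
begin

lemma maximal_exists:
  assumes "P I" "K0 \<le> I"
  shows "\<exists>M\<ge>I. P M \<and> (\<forall>N>M. \<not> P N)"
proof (rule ccontr)
  assume neg: "\<not> ?thesis"
  define nxt where "nxt M = (SOME N. N > M \<and> P N)" for M
  have nxt: "nxt M > M \<and> P (nxt M)" if "M \<ge> I" "P M" for M
    unfolding nxt_def by (rule someI_ex) (use neg that in auto)
  define f where "f n = (nxt ^^ n) I" for n
  have f: "f n \<ge> I \<and> P (f n)" for n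
  proof (induction n)
    case 0
    then show ?case using assms by (simp add: f_def)
  next
    case (Suc n)
    then show ?case using nxt[of "f n"] by (auto simp: f_def)
  qed
  have less: "f n < f (Suc n)" for n using nxt[of "f n"] f[of n] by (simp add: f_def)
  obtain n where "\<forall>k\<ge>n. f k = f n"
    using noeth[of f] f less assms(2) by (meson less_imp_le order.trans)
  then show False using less[of n] by (metis le_SucI le_refl less_irrefl)
qed

end

section \<open>Local rings seen as the ideals above \<open>K0\<close>: Nakayama and numbers of
  generators\<close>

locale local_base = noetherian_above K0 for K0 :: "'a :: comm_ring_1 idl" +
  fixes m :: "'a idl"
  assumes m_proper: "m \<noteq> 1"
    and K0_le_m: "K0 \<le> m"
    and le_m: "\<And>I. K0 \<le> I \<Longrightarrow> I \<noteq> 1 \<Longrightarrow> I \<le> m"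
begin

lemma unit_mod:
  assumes "K0 \<le> K" "x \<notin> elts m"
  shows "K + prin x = 1"
proof (rule ccontr)
  assume "K + prin x \<noteq> 1"
  then have "K + prin x \<le> m" using le_m[of "K + prin x"] assms by (auto intro: idl_le_addI1)
  then show False using assms by (auto simp: plus_le_iff prin_le_iff)
qed

lemma unit_cancel:
  assumes "K0 \<le> K" "x \<notin> elts m" "x * a \<in> elts K"
  shows "a \<in> elts K"
proof -
  have "1 \<in> elts (K + prin x)" using unit_mod[OF assms(1,2)] by simp
  then obtain c where c: "1 - c * x \<in> elts K" by (auto simp: mem_plus_prin_iff)
  have "a = (1 - c * x) * a + c * (x * a)" by (simp add: algebra_simps)
  also have "\<dots> \<in> elts K" by (intro idl_add idl_mult' c idl_mult assms)
  finally show ?thesis .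
qed

lemma one_minus_notin_m: "x \<in> elts m \<Longrightarrow> 1 - x \<notin> elts m"
proof
  assume "x \<in> elts m" "1 - x \<in> elts m"
  then have "1 \<in> elts m" using idl_add[of x m "1 - x"] by simp
  then have "prin 1 \<le> m" by (simp only: prin_le_iff)
  then show False using m_proper by (auto simp: order_antisym)
qed

lemma one_notin_m: "1 \<notin> elts m"
  using one_minus_notin_m[of 0] by simp

text \<open>If I is not below K, take Q maximal with K \<le> Q < K + I. Then (K + I)/Q is simple and
  hence killed by m, so m * I \<le> Q, and the hypothesis pushes I into Q.\<close>

lemma nakayama:
  assumes "K0 \<le> K" "I \<le> K + m * I"
  shows "I \<le> K"
proof (rule ccontr)
  assume nle: "\<not> I \<le> K"
  then have "K < K + I" by (rule less_add_idl)
  then obtain Q where Q: "K \<le> Q" "Q < K + I" and max: "\<And>N. N > Q \<Longrightarrow> \<not> N < K + I"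
    using maximal_exists[of "\<lambda>Q. Q < K + I" K] assms by auto
  then obtain a where a: "a \<in> elts (K + I)" "a \<notin> elts Q" by (auto simp: less_idl_def)
  have le: "Q + prin a \<le> K + I" using Q a by (auto simp: plus_le_iff[of Q] prin_le_iff)
  have "Q < Q + prin a" using a by (auto intro: less_add_idl simp: prin_le_iff)
  then have eq: "Q + prin a = K + I" using max[of "Q + prin a"] le by (auto simp: order.order_iff_strict)
  \<comment> \<open>Otherwise a = c a modulo Q for some c in m, and 1 - c is a unit.\<close>
  have "m * prin a \<le> Q"
  proof (rule ccontr)
    assume "\<not> m * prin a \<le> Q"
    then have "Q < Q + m * prin a" by (rule less_add_idl)
    moreover have "Q + m * prin a \<le> K + I" using le by (meson idl_mult_le2 order.trans plus_le_iff)
    ultimately have "Q + m * prin a = K + I" using max by (auto simp: order.order_iff_strict)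
    then have "a \<in> elts (Q + prin a * m)" using a by (simp add: mult.commute)
    then obtain c where "c \<in> elts m" "a - a * c \<in> elts Q" by (auto simp: idl_plus_iff elts_prin_times)
    moreover have "a - a * c = (1 - c) * a" by (simp add: algebra_simps)
    ultimately show False using unit_cancel[of Q "1 - c" a] one_minus_notin_m a Q assms(1)
      by (auto intro: order.trans)
  qed
  then have "m * (K + I) \<le> Q" by (simp add: distrib_left plus_le_iff flip: eq)
  then have "m * I \<le> Q" by (simp add: distrib_left plus_le_iff)
  then have "I \<le> Q" using assms(2) Q(1) by (meson order.trans plus_le_iff)
  then have "K + I \<le> Q" using Q by (auto simp: plus_le_iff)
  then show False using Q by auto
qed

lemma mem_nakayama:
  assumes "K0 \<le> K" "K \<le> I" "I \<le> K + m * I"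
  shows "I = K"
  using nakayama[OF assms(1,3)] assms(2) by auto

lemma finitely_generated:
  assumes "K0 \<le> I"
  shows "\<exists>xs. I = K0 + lgen xs"
proof -
  obtain M where M: "K0 \<le> M" "M \<le> I" "\<exists>xs. M = K0 + lgen xs"
    and max: "\<And>N. N > M \<Longrightarrow> \<not> (N \<le> I \<and> (\<exists>xs. N = K0 + lgen xs))"
    using maximal_exists[of "\<lambda>M. M \<le> I \<and> (\<exists>xs. M = K0 + lgen xs)" K0] assms
    by (metis add_0_right lgen_Nil order_refl)
  have "I \<le> M"
  proof (rule idl_leI, rule ccontr)
    fix x assume x: "x \<in> elts I" "x \<notin> elts M"
    obtain xs where xs: "M = K0 + lgen xs" using M by auto
    have "M < M + prin x" using x by (auto intro: less_add_idl simp: prin_le_iff)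
    moreover have "M + prin x \<le> I" using x M by (auto simp: plus_le_iff[of M] prin_le_iff)
    moreover have "M + prin x = K0 + lgen (x # xs)" by (simp add: xs ac_simps)
    ultimately show False using max by blast
  qed
  with M show ?thesis by auto
qed

lemma len_le_1:
  assumes "K0 \<le> K" "m * prin a \<le> K"
  shows "len K (K + prin a) \<le> 1"
proof (cases "a \<in> elts K")
  case True
  then have "K + prin a = K" by (simp add: idl_add_absorb2 prin_le_iff)
  then show ?thesis by simp
next
  case False
  have "n \<le> 1" if "chain_from n K (K + prin a)" for n
  proof (rule ccontr)
    assume "\<not> n \<le> 1"
    then have "chain_from (Suc (Suc 0)) K (K + prin a)" by (intro chain_from_anti[OF that]) simp
    then obtain M N where MN: "K \<le> M" "M < N" "N < K + prin a" by auto
    then obtain b where b: "b \<in> elts N" "b \<notin> elts M" by (auto simp: less_idl_def)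
    have "b \<in> elts (K + prin a)" using MN b idl_leD less_imp_le by blast
    then obtain c where c: "b - c * a \<in> elts K" by (auto simp: mem_plus_prin_iff)
    have KN: "K \<le> N" using MN by auto
    have "c * a \<in> elts N" using idl_diff[OF b(1) idl_leD[OF KN c]] by simp
    have "c \<notin> elts m"
    proof
      assume "c \<in> elts m"
      then have "c * a \<in> elts K" using assms(2) by (simp add: times_le_iff)
      then have "b \<in> elts K" using c idl_diff_cancel by blast
      then show False using b MN idl_leD by blast
    qed
    then have "a \<in> elts N" using unit_cancel[of N c a] \<open>c * a \<in> elts N\<close> assms(1) KN by auto
    then have "K + prin a \<le> N" using KN by (auto simp: plus_le_iff prin_le_iff)
    then show False using MN by auto
  qed
  then show ?thesis by (intro len_le) (auto simp: one_enat_def)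
qed

lemma len_eq_1:
  assumes "K0 \<le> K" "m * prin a \<le> K" "a \<notin> elts K"
  shows "len K (K + prin a) = 1"
proof -
  have "K + prin a \<noteq> K" using assms(3) by (metis idl_le_add2 prin_le_iff)
  then have "len K (K + prin a) \<noteq> 0" using len_eq_0[of K "K + prin a"] by auto
  with len_le_1[OF assms(1,2)] show ?thesis
    by (cases "len K (K + prin a)") (auto simp: one_enat_def zero_enat_def)
qed

lemma len_lgen_le:
  assumes "K0 \<le> K" "m * lgen xs \<le> K"
  shows "len K (K + lgen xs) \<le> enat (length xs)"
  using assms
proof (induction xs arbitrary: K)
  case Nil
  then show ?case by simp
next
  case (Cons x xs)
  have m: "m * prin x \<le> K" "m * lgen xs \<le> K" using Cons.prems by (auto simp: distrib_left plus_le_iff)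
  have "len K (K + lgen (x # xs)) = len K (K + prin x) + len (K + prin x) (K + prin x + lgen xs)"
    by (subst len_add[of K "K + prin x"]) (auto simp: ac_simps plus_le_iff intro: idl_le_addI1 idl_le_addI2)
  also have "\<dots> \<le> 1 + enat (length xs)"
    using m Cons.prems by (intro add_mono len_le_1 Cons.IH) (auto intro: idl_le_addI1)
  finally show ?case by (simp add: one_enat_def)
qed

lemma len_quot_m_finite:
  assumes "K0 \<le> K" "K0 \<le> I" "m * I \<le> K" "K \<le> I"
  shows "len K I \<noteq> \<infinity>"
proof -
  obtain xs where xs: "I = K0 + lgen xs" using finitely_generated[OF assms(2)] by auto
  have "I = K + lgen xs" using assms xs by (intro antisym) (auto simp: plus_le_iff intro: idl_le_addI1)
  moreover have "m * lgen xs \<le> K" using assms(3) by (simp add: xs distrib_left plus_le_iff)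
  ultimately have "len K I \<le> enat (length xs)" using len_lgen_le[OF assms(1)] by metis
  then show ?thesis by (cases "len K I") auto
qed

text \<open>Elements are added to m * I one at a time, each raising the length by exactly one, until
  I is reached; Nakayama then discards m * I. With \<open>len_le_gens\<close> this identifies the
  length of I / m I with the minimal number of generators.\<close>

lemma min_gens:
  assumes "K0 \<le> I" "len (K0 + m * I) I = enat l"
  shows "\<exists>xs. length xs = l \<and> I = K0 + lgen xs"
proof -
  have le: "K0 + m * I \<le> I" using assms by (auto simp: plus_le_iff)
  have "\<exists>xs. length xs = l \<and> I = K + lgen xs"
    if "K0 + m * I \<le> K" "K \<le> I" "len K I = enat l" for K l
    using that
  proof (induction l arbitrary: K)
    case 0
    then have "K = I" using len_eq_0 by (simp add: zero_enat_def)
    then show ?case by (intro exI[of _ "[]"]) simp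
  next
    case (Suc l)
    then have "K \<noteq> I" by (auto simp: zero_enat_def)
    then have "K < I" using Suc.prems by (intro le_neq_trans)
    then obtain a where a: "a \<in> elts I" "a \<notin> elts K" by (auto simp: less_idl_def)
    have le: "K + prin a \<le> I" using a Suc.prems by (auto simp: plus_le_iff[of K] prin_le_iff)
    have "m * prin a \<le> K"
      using Suc.prems(1) a idl_mult_mono[of m m "prin a" I] by (auto simp: plus_le_iff prin_le_iff intro: order.trans)
    then have "len K (K + prin a) = 1" using a Suc.prems by (intro len_eq_1) (auto simp: plus_le_iff)
    then have "len (K + prin a) I = enat l" using Suc.prems(3) len_add[of K "K + prin a" I] le
      by (cases "len (K + prin a) I") (auto simp: one_enat_def)
    then obtain xs where "length xs = l" "I = K + prin a + lgen xs"
      using Suc.IH[of "K + prin a"] Suc.prems le by (meson idl_le_addI1)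
    then show ?case by (intro exI[of _ "a # xs"]) (auto simp: ac_simps)
  qed
  from this[OF _ le assms(2)] obtain xs where xs: "length xs = l" "I = K0 + m * I + lgen xs" by auto
  have "I = K0 + lgen xs"
  proof (rule mem_nakayama)
    show "K0 + lgen xs \<le> I" using xs(2) by (metis add.assoc add.commute idl_le_add2 plus_le_iff)
    show "I \<le> K0 + lgen xs + m * I" using xs(2) by (metis add.assoc add.commute order_refl)
  qed auto
  with xs show ?thesis by auto
qed

lemma len_le_gens:
  assumes "K0 \<le> I" "I = K0 + lgen xs"
  shows "len (K0 + m * I) I \<le> enat (length xs)"
proof -
  have "I = K0 + m * I + lgen xs"
    using assms by (intro antisym) (auto simp: plus_le_iff intro: idl_le_addI1)
  moreover have "m * lgen xs \<le> K0 + m * I"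
    using assms(2) by (intro idl_le_addI2 idl_mult_mono) auto
  then have "len (K0 + m * I) (K0 + m * I + lgen xs) \<le> enat (length xs)"
    by (intro len_lgen_le) auto
  ultimately show ?thesis by simp
qed

end

section \<open>Regular sequences\<close>

declare power_Suc [simp del]

lemma enat_Suc_0: "enat (Suc 0) = 1"
  by (simp add: one_enat_def)

lemma idl_add_1 [simp]: "I + 1 = (1 :: 'a :: comm_ring_1 idl)" "1 + I = (1 :: 'a idl)"
  by (simp_all add: idl_add_absorb1 idl_add_absorb2)

text \<open>Weak regularity: properness of the generated ideal is not recorded. It holds whenever
  \<open>K\<close> and the terms lie in m.\<close>

primrec reg :: "'a :: comm_ring_1 idl \<Rightarrow> 'a list \<Rightarrow> bool" where
  "reg K [] \<longleftrightarrow> True"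
| "reg K (x # xs) \<longleftrightarrow> colon K x \<le> K \<and> reg (K + prin x) xs"

lemma reg_append: "reg K (xs @ ys) \<longleftrightarrow> reg K xs \<and> reg (K + lgen xs) ys"
  by (induction xs arbitrary: K) (auto simp: add.assoc)

lemma colon_leD: "colon K x \<le> K \<Longrightarrow> x * a \<in> elts K \<Longrightarrow> a \<in> elts K"
  by (auto simp: less_eq_idl_def)

lemma colon_leI: "(\<And>a. x * a \<in> elts K \<Longrightarrow> a \<in> elts L) \<Longrightarrow> colon K x \<le> L"
  by (auto simp: less_eq_idl_def)

text \<open>Separates the products containing a factor from P from those that do not; for principal
  P this is the induction step on the number of generators.\<close>

lemma idl_power_add_Suc: "(P + Q) ^ Suc n = P * (P + Q) ^ n + Q ^ Suc n"
  for P Q :: "'a :: comm_ring_1 idl"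
proof (induction n)
  case 0
  then show ?case by simp
next
  case (Suc n)
  have "Q * (P * (P + Q) ^ n) \<le> P * (P + Q) ^ Suc n"
    by (simp add: algebra_simps power_Suc)
  moreover have "(P + Q) ^ Suc (Suc n) = P * (P + Q) ^ Suc n + Q * (P + Q) ^ Suc n"
    by (simp add: algebra_simps power_Suc[of _ "Suc n"])
  then have "(P + Q) ^ Suc (Suc n) = P * (P + Q) ^ Suc n + (Q * (P * (P + Q) ^ n) + Q ^ Suc (Suc n))"
    unfolding Suc.IH by (simp add: distrib_left power_Suc[of Q "Suc n"])
  ultimately show ?case by (simp add: idl_add_absorb2 flip: add.assoc)
qed

lemma colon_power_ge: "K + (prin w + Q) ^ n \<le> colon (K + (prin w + Q) ^ Suc n) w"
proof (unfold plus_le_iff[of K], rule conjI)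
  show "K \<le> colon (K + (prin w + Q) ^ Suc n) w"
    by (rule order_trans[OF idl_le_add1 colon_ge])
  show "(prin w + Q) ^ n \<le> colon (K + (prin w + Q) ^ Suc n) w"
  proof (rule idl_leI)
    fix a assume "a \<in> elts ((prin w + Q) ^ n)"
    then have "w * a \<in> elts ((prin w + Q) * (prin w + Q) ^ n)"
      by (intro times_mem idl_plusI1) auto
    then show "a \<in> elts (colon (K + (prin w + Q) ^ Suc n) w)" by (simp add: power_Suc idl_plusI2)
  qed
qed

text \<open>Divide by w: the part of the power that involves w is w b with b in the n-th power, and
  the rest lies in K + Q^(n+1), modulo which w is regular.\<close>

lemma colon_power:
  fixes K Q :: "'a :: comm_ring_1 idl"
  assumes "colon (K + Q ^ Suc n) w \<le> K + Q ^ Suc n"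
  shows "colon (K + (prin w + Q) ^ Suc n) w = K + (prin w + Q) ^ n"
proof (rule antisym)
  show "colon (K + (prin w + Q) ^ Suc n) w \<le> K + (prin w + Q) ^ n"
  proof (rule colon_leI)
    fix a assume "w * a \<in> elts (K + (prin w + Q) ^ Suc n)"
    then have "w * a \<in> elts ((K + Q ^ Suc n) + prin w * (prin w + Q) ^ n)"
      unfolding idl_power_add_Suc by (simp only: ac_simps)
    then obtain b where b: "b \<in> elts ((prin w + Q) ^ n)" "w * a - w * b \<in> elts (K + Q ^ Suc n)"
      unfolding idl_plus_iff[of _ "K + Q ^ Suc n"] elts_prin_times by blast
    then have "w * (a - b) \<in> elts (K + Q ^ Suc n)" by (simp add: right_diff_distrib)
    then have ab: "a - b \<in> elts (K + Q ^ Suc n)" by (rule colon_leD[OF assms])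
    have "Q ^ Suc n \<le> (prin w + Q) ^ Suc n" by (rule idl_pow_mono) simp
    also have "\<dots> \<le> (prin w + Q) ^ n" by (rule idl_pow_antimono) simp
    finally have "K + Q ^ Suc n \<le> K + (prin w + Q) ^ n" by (rule add_left_mono)
    from idl_leD[OF this ab] show "a \<in> elts (K + (prin w + Q) ^ n)"
      by (rule idl_diff_cancel) (rule idl_plusI2[OF b(1)])
  qed
  show "K + (prin w + Q) ^ n \<le> colon (K + (prin w + Q) ^ Suc n) w"
    by (rule colon_power_ge)
qed

text \<open>The colon by x lowers the exponent and reduction modulo x lowers the number of
  generators. This is Pascal's rule, the source of the binomial coefficients in
  \<open>len_power_le\<close> and \<open>len_power_reg\<close>.\<close>

lemma len_power_Cons:
  "len (K + lgen (x # xs) ^ Suc n) 1 =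
    len (colon (K + lgen (x # xs) ^ Suc n) x) 1 + len ((K + prin x) + lgen xs ^ Suc n) 1"
proof -
  let ?L = "K + lgen (x # xs) ^ Suc n"
  have "prin x * (prin x + lgen xs) ^ n \<le> prin x" by simp
  then have "?L + prin x = (K + prin x) + lgen xs ^ Suc n"
    unfolding lgen_Cons idl_power_add_Suc
    by (intro antisym) (auto simp del: power_Suc idl_mult_le1 simp: plus_le_iff intro: idl_le_addI1 idl_le_addI2)
  then show ?thesis
    using len_add[OF idl_le_add1 idl_le_1, of ?L "prin x"] len_prin[of ?L x] by (simp del: lgen_Cons)
qed

lemma len_power_le:
  "len (K + lgen xs ^ Suc n) 1 \<le> enat ((n + length xs) choose length xs) * len (K + lgen xs) 1"
proof (induction xs arbitrary: K n)
  case Nil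
  then show ?case by (simp add: enat_Suc_0)
next
  case (Cons x xs)
  show ?case
  proof (induction n)
    case 0
    then show ?case by (simp add: enat_Suc_0)
  next
    case (Suc n)
    have C: "enat ((Suc n + length (x # xs)) choose length (x # xs))
        = enat ((n + length (x # xs)) choose length (x # xs)) + enat ((Suc n + length xs) choose length xs)"
      by simp
    have "len (colon (K + lgen (x # xs) ^ Suc (Suc n)) x) 1 \<le> len (K + lgen (x # xs) ^ Suc n) 1"
      using colon_power_ge[of K x "lgen xs" "Suc n"] by (intro len_anti_left) auto
    then have 1: "len (colon (K + lgen (x # xs) ^ Suc (Suc n)) x) 1
        \<le> enat ((n + length (x # xs)) choose length (x # xs)) * len (K + lgen (x # xs)) 1"
      using Suc.IH by (rule order_trans)
    have 2: "len (K + prin x + lgen xs ^ Suc (Suc n)) 1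
        \<le> enat ((Suc n + length xs) choose length xs) * len (K + lgen (x # xs)) 1"
      using Cons.IH[of "K + prin x" "Suc n"] by (simp add: add.assoc)
    show ?case
      unfolding len_power_Cons[of K x xs "Suc n"] C distrib_right by (rule add_mono[OF 1 2])
  qed
qed

context local_base
begin

text \<open>The local ring enters in showing y regular modulo K: if y a lies in K, then a = c x
  modulo K with c again in \<open>colon K y\<close>. As x is in m, this gives
  \<open>colon K y \<le> K + m * colon K y\<close>, and Nakayama applies.\<close>

lemma reg_swap:
  assumes "K0 \<le> K" "x \<in> elts m" "reg K (x # y # zs)"
  shows "reg K (y # x # zs)"
proof -
  have x: "colon K x \<le> K" and y: "colon (K + prin x) y \<le> K + prin x" and zs: "reg (K + prin x + prin y) zs"
    using assms by auto
  have "colon K y \<le> K + m * colon K y"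
  proof (rule idl_leI)
    fix a assume "a \<in> elts (colon K y)"
    then have a: "y * a \<in> elts K" by simp
    then have "a \<in> elts (K + prin x)" by (rule colon_leD[OF y idl_plusI1])
    then obtain c where c: "a - c * x \<in> elts K" by (auto simp: mem_plus_prin_iff)
    have "x * (y * c) = y * a - y * (a - c * x)" by (simp add: algebra_simps)
    also have "\<dots> \<in> elts K" by (rule idl_diff[OF a idl_mult[OF c]])
    finally have "y * c \<in> elts K" by (rule colon_leD[OF x])
    then have "x * c \<in> elts (m * colon K y)" using assms by (intro times_mem) auto
    then have "c * x \<in> elts (m * colon K y)" by (simp add: mult.commute)
    with c show "a \<in> elts (K + m * colon K y)" unfolding idl_plus_iff by blast
  qed
  then have y': "colon K y \<le> K" by (rule nakayama[OF assms(1)])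
  have "colon (K + prin y) x \<le> K + prin y"
  proof (rule colon_leI)
    fix a assume "x * a \<in> elts (K + prin y)"
    then obtain b where b: "x * a - b * y \<in> elts K" by (auto simp: mem_plus_prin_iff)
    have "y * b - a * x = - (x * a - b * y)" by (simp add: algebra_simps)
    then have "y * b - a * x \<in> elts K" using idl_uminus[OF b] by (simp add: mult.commute)
    then have "y * b \<in> elts (K + prin x)" by (auto simp: mem_plus_prin_iff)
    then have "b \<in> elts (K + prin x)" by (rule colon_leD[OF y])
    then obtain c where c: "b - c * x \<in> elts K" by (auto simp: mem_plus_prin_iff)
    have "x * (a - c * y) = (x * a - b * y) + y * (b - c * x)" by (simp add: algebra_simps)
    also have "\<dots> \<in> elts K" by (rule idl_add[OF b idl_mult[OF c]])
    finally have "a - c * y \<in> elts K" by (rule colon_leD[OF x])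
    then show "a \<in> elts (K + prin y)" by (auto simp: mem_plus_prin_iff)
  qed
  moreover have "K + prin y + prin x = K + prin x + prin y" by (simp add: ac_simps)
  ultimately show ?thesis using y' zs by simp
qed

lemma reg_to_front:
  assumes "K0 \<le> K" "set xs \<subseteq> elts m" "reg K (xs @ [w])"
  shows "reg K (w # xs)"
  using assms
proof (induction xs arbitrary: K)
  case Nil
  then show ?case by simp
next
  case (Cons x xs)
  have "reg (K + prin x) (w # xs)"
    using Cons.prems by (intro Cons.IH) (auto intro: idl_le_addI1)
  then have "reg K (x # w # xs)" using Cons.prems by simp
  then show ?case using Cons.prems(1,2) \<open>reg K (x # w # xs)\<close> by (rule_tac reg_swap) auto
qed

lemma reg_to_back:
  assumes "K0 \<le> K" "w \<in> elts m" "reg K (w # xs)"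
  shows "reg K (xs @ [w])"
  using assms
proof (induction xs arbitrary: K)
  case Nil
  then show ?case by simp
next
  case (Cons x xs)
  have sw: "reg K (x # w # xs)" using Cons.prems by (rule reg_swap)
  then have "reg (K + prin x) (xs @ [w])"
    using Cons.prems(1,2) by (intro Cons.IH) (auto intro: idl_le_addI1)
  then show ?case using sw by simp
qed

text \<open>The trace, in terms of colon ideals, of the fact that I^n / I^(n+1) is free over A/I for
  I generated by a regular sequence. The induction runs over \<open>ws\<close> and, inside, over
  n.\<close>

lemma reg_power:
  assumes "K0 \<le> K" "set ws \<subseteq> elts m" "x \<in> elts m" "reg K (ws @ [x])"
  shows "colon (K + lgen ws ^ n) x \<le> K + lgen ws ^ n"
  using assms
proof (induction ws arbitrary: K x n)
  case Nil
  then show ?case by (cases n) auto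
next
  case (Cons w ws)
  \<comment> \<open>With w moved behind ws, the outer induction hypothesis applies to w in the place
    of x.\<close>
  have w: "colon (K + lgen ws ^ k) w \<le> K + lgen ws ^ k" for k
    using Cons.prems by (intro Cons.IH reg_to_back) (auto simp: reg_append)
  show ?case
  proof (induction n)
    case 0
    then show ?case by (simp add: idl_add_absorb1)
  next
    case (Suc n)
    let ?J = "prin w + lgen ws"
    have IHx: "colon (K + prin w + lgen ws ^ Suc n) x \<le> K + prin w + lgen ws ^ Suc n"
      using Cons.prems by (intro Cons.IH) (auto intro: idl_le_addI1)
    show ?case
    proof (rule colon_leI)
      fix a assume a: "x * a \<in> elts (K + lgen (w # ws) ^ Suc n)"
      have "prin w * ?J ^ n \<le> prin w" by simp
      then have "K + ?J ^ Suc n \<le> K + prin w + lgen ws ^ Suc n"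
        unfolding idl_power_add_Suc plus_le_iff by (auto simp del: idl_mult_le1 power_Suc intro: idl_le_addI1 idl_le_addI2)
      then have "x * a \<in> elts (K + prin w + lgen ws ^ Suc n)"
        using a by (auto dest: idl_leD)
      then have "a \<in> elts (K + prin w + lgen ws ^ Suc n)" by (rule colon_leD[OF IHx])
      then have "a \<in> elts (K + lgen ws ^ Suc n + prin w)" by (simp only: ac_simps)
      then obtain b where b: "a - b * w \<in> elts (K + lgen ws ^ Suc n)" by (auto simp: mem_plus_prin_iff)
      have le: "K + lgen ws ^ Suc n \<le> K + ?J ^ Suc n"
        by (intro add_left_mono idl_pow_mono) simp
      have ab: "a - b * w \<in> elts (K + ?J ^ Suc n)" using idl_leD[OF le b] .
      \<comment> \<open>Here the exponent drops: w (x b) lies in the (n+1)-st power, so x b lies in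
        the n-th, modulo which x is regular by the inner induction.\<close>
      have "w * (x * b) = x * a - x * (a - b * w)" by (simp add: algebra_simps)
      also have "\<dots> \<in> elts (K + ?J ^ Suc n)" by (rule idl_diff[OF a[unfolded lgen_Cons] idl_mult[OF ab]])
      finally have "x * b \<in> elts (colon (K + ?J ^ Suc n) w)" by simp
      then have "x * b \<in> elts (K + ?J ^ n)" by (simp only: colon_power[OF w])
      then have "b \<in> elts (K + ?J ^ n)" using colon_leD[OF Suc.IH] by simp
      then have "b \<in> elts (colon (K + ?J ^ Suc n) w)" by (simp only: colon_power[OF w])
      then have "b * w \<in> elts (K + ?J ^ Suc n)" by (simp add: mult.commute)
      with ab show "a \<in> elts (K + lgen (w # ws) ^ Suc n)" using idl_diff_cancel by auto
    qed
  qed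
qed

lemma len_power_reg:
  assumes "K0 \<le> K" "set xs \<subseteq> elts m" "reg K xs"
  shows "len (K + lgen xs ^ Suc n) 1 = enat ((n + length xs) choose length xs) * len (K + lgen xs) 1"
  using assms
proof (induction xs arbitrary: K n)
  case Nil
  then show ?case by (simp add: enat_Suc_0)
next
  case (Cons x xs)
  show ?case
  proof (induction n)
    case 0
    then show ?case by (simp add: enat_Suc_0)
  next
    case (Suc n)
    \<comment> \<open>As the last term, x is regular modulo powers of the others. The colon ideal is
      then known exactly, which turns the inequality of \<open>len_power_le\<close> into an
      equality.\<close>
    have "reg K (xs @ [x])" using Cons.prems by (intro reg_to_back) auto
    then have "colon (K + lgen xs ^ Suc (Suc n)) x \<le> K + lgen xs ^ Suc (Suc n)"
      using Cons.prems by (intro reg_power) auto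
    then have c: "colon (K + lgen (x # xs) ^ Suc (Suc n)) x = K + lgen (x # xs) ^ Suc n"
      using colon_power by simp
    have C: "enat ((Suc n + length (x # xs)) choose length (x # xs))
        = enat ((n + length (x # xs)) choose length (x # xs)) + enat ((Suc n + length xs) choose length xs)"
      by simp
    have "len (K + prin x + lgen xs ^ Suc (Suc n)) 1
        = enat ((Suc n + length xs) choose length xs) * len (K + prin x + lgen xs) 1"
      using Cons.prems by (intro Cons.IH) (auto intro: idl_le_addI1)
    then have "len (K + prin x + lgen xs ^ Suc (Suc n)) 1
        = enat ((Suc n + length xs) choose length xs) * len (K + lgen (x # xs)) 1"
      by (simp add: add.assoc)
    then show ?case
      unfolding len_power_Cons[of K x xs "Suc n"] c C distrib_right Suc.IH by (rule arg_cong)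
  qed
qed

text \<open>More zeros modulo P than the degree, at points whose differences are units: dividing by
  X - s, one zero at a time, forces all coefficients into P.\<close>

lemma poly_coeffs_mem:
  assumes "K0 \<le> P" "finite S" "Polynomial.degree p < card S"
    and diff: "\<And>s t. s \<in> S \<Longrightarrow> t \<in> S \<Longrightarrow> s \<noteq> t \<Longrightarrow> s - t \<notin> elts m"
    and mem: "\<And>t. t \<in> S \<Longrightarrow> poly p t \<in> elts P"
  shows "Polynomial.coeff p i \<in> elts P"
  using assms(2-)
proof (induction "Polynomial.degree p" arbitrary: p S i)
  case 0
  then obtain c where "p = [:c:]" by (metis degree_0_id)
  moreover obtain t where "t \<in> S" using 0 by fastforce
  ultimately show ?case using 0 by (auto simp: coeff_pCons split: nat.split dest: 0(5))
next
  case (Suc n)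
  obtain s where s: "s \<in> S" using Suc by fastforce
  define q where "q = synthetic_div p s"
  have p: "p + Polynomial.smult s q = pCons (poly p s) q" unfolding q_def by (rule synthetic_div_correct)
  have q: "Polynomial.coeff q j \<in> elts P" for j
  proof (rule Suc(1)[of q "S - {s}"])
    show "n = Polynomial.degree q" using Suc(2) by (simp add: q_def degree_synthetic_div)
    then show "Polynomial.degree q < card (S - {s})" using Suc s by simp
    fix t assume t: "t \<in> S - {s}"
    have "poly p t + s * poly q t = poly p s + t * poly q t"
      using arg_cong[OF p, of "\<lambda>r. poly r t"] by simp
    then have "(t - s) * poly q t = poly p t - poly p s" by (simp add: algebra_simps)
    also have "\<dots> \<in> elts P" using Suc.prems s t by (intro idl_diff) auto
    finally have "(t - s) * poly q t \<in> elts P" .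
    moreover have "t - s \<notin> elts m" using t s by (intro Suc.prems) auto
    ultimately show "poly q t \<in> elts P" using unit_cancel[OF assms(1)] by blast
  qed (use Suc.prems in auto)
  have "Polynomial.coeff p i = Polynomial.coeff (pCons (poly p s) q) i - s * Polynomial.coeff q i"
    by (simp flip: p)
  also have "\<dots> \<in> elts P"
    using q Suc.prems s by (intro idl_diff idl_mult) (auto simp: coeff_pCons split: nat.split)
  finally show ?case .
qed

text \<open>The maximal annihilators of nonzero elements of A/K, that is, the maximal associated
  primes. They are finitely many and cover the zero divisors modulo K, as prime avoidance
  requires.\<close>

definition max_ann :: "'a idl \<Rightarrow> 'a idl set" where
  "max_ann K = {colon K a | a. a \<notin> elts K \<and> (\<forall>b. b \<notin> elts K \<longrightarrow> \<not> colon K a < colon K b)}"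

lemma max_ann_exists:
  assumes "K0 \<le> K" "a \<notin> elts K"
  shows "\<exists>P\<in>max_ann K. colon K a \<le> P"
proof -
  have "K0 \<le> colon K a" using assms colon_ge order_trans by blast
  then obtain M where M: "M \<ge> colon K a" "\<exists>b. b \<notin> elts K \<and> M = colon K b"
    and max: "\<forall>N>M. \<not> (\<exists>b. b \<notin> elts K \<and> N = colon K b)"
    using maximal_exists[of "\<lambda>M. \<exists>b. b \<notin> elts K \<and> M = colon K b" "colon K a"] assms by blast
  then have "M \<in> max_ann K" unfolding max_ann_def by blast
  with M show ?thesis by blast
qed

text \<open>If x y kills a but x does not, then a x is still nonzero modulo K. Its annihilator
  contains that of a, so equals it by maximality, and it contains y.\<close>

lemma max_ann_prime:
  assumes "P \<in> max_ann K" "x * y \<in> elts P"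
  shows "x \<in> elts P \<or> y \<in> elts P"
proof (rule ccontr)
  assume neg: "\<not> ?thesis"
  obtain a where a: "P = colon K a" "a \<notin> elts K"
    and max: "\<And>b. b \<notin> elts K \<Longrightarrow> \<not> colon K a < colon K b"
    using assms unfolding max_ann_def by auto
  have "a * x \<notin> elts K" using neg a by simp
  moreover have "colon K a \<le> colon K (a * x)"
  proof (rule colon_leI)
    fix u assume "a * u \<in> elts K"
    then have "x * (a * u) \<in> elts K" by (rule idl_mult)
    then show "u \<in> elts (colon K (a * x))" by (simp add: ac_simps)
  qed
  ultimately have "colon K a = colon K (a * x)" using max by (metis order.not_eq_order_implies_strict)
  moreover have "y \<in> elts (colon K (a * x))" using assms a by (simp add: ac_simps)
  ultimately show False using neg a by simp
qed

lemma max_ann_prime_prod: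
  assumes "P \<in> max_ann K" "finite S" "(\<Prod>i\<in>S. b i) \<in> elts P"
  shows "\<exists>i\<in>S. b i \<in> elts P"
  using assms(2,3)
proof (induction S rule: finite_induct)
  case empty
  then show ?case using assms(1) by (auto simp: max_ann_def)
next
  case (insert i S)
  then show ?case using max_ann_prime[OF assms(1), of "b i" "\<Prod>i\<in>S. b i"] by auto
qed

text \<open>Suppose there are infinitely many P_i = (K : a_i). The ideals K + (a_0, ..., a_(n-1))
  become stationary, so some a_n lies in the one before it. A product of elements b_i of P_i outside
  P_n kills all earlier a_i, hence a_n, and so lies in the prime P_n.\<close>

lemma finite_max_ann:
  assumes "K0 \<le> K"
  shows "finite (max_ann K)"
proof (rule ccontr)
  assume "infinite (max_ann K)"
  then obtain P :: "nat \<Rightarrow> 'a idl" where P: "inj P" "range P \<subseteq> max_ann K"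
    using infinite_countable_subset by blast
  have "\<exists>a. P n = colon K a \<and> a \<notin> elts K \<and> (\<forall>b. b \<notin> elts K \<longrightarrow> \<not> colon K a < colon K b)" for n
    using P(2) unfolding max_ann_def by blast
  then obtain a where a: "\<And>n. P n = colon K (a n)" "\<And>n. a n \<notin> elts K"
    "\<And>n b. b \<notin> elts K \<Longrightarrow> \<not> colon K (a n) < colon K b" by metis
  define I where "I n = K + lgen (map a [0..<n])" for n
  have "\<exists>n. \<forall>k\<ge>n. I k = I n"
  proof (rule noeth)
    show "K0 \<le> I n" for n using assms by (simp add: I_def idl_le_addI1)
    show "I n \<le> I (Suc n)" for n
      unfolding I_def by (intro add_left_mono lgen_mono) auto
  qed
  then obtain n where n: "\<forall>k\<ge>n. I k = I n" by blast
  have "a n \<in> elts (I (Suc n))" unfolding I_def by (rule idl_plusI2, rule lgen_mem) auto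
  then have an: "a n \<in> elts (I n)" using n[THEN spec, of "Suc n"] by simp
  have "\<exists>b. b \<in> elts (P i) \<and> b \<notin> elts (P n)" if "i < n" for i
  proof (rule ccontr)
    assume "\<not> ?thesis"
    then have "P i \<le> P n" by (auto simp: less_eq_idl_def)
    moreover have "P i \<noteq> P n" using P(1) that by (auto dest: injD)
    ultimately have "colon K (a i) < colon K (a n)" using a(1) by (metis le_neq_trans)
    then show False using a(2,3) by blast
  qed
  then obtain b where b: "\<And>i. i < n \<Longrightarrow> b i \<in> elts (P i) \<and> b i \<notin> elts (P n)" by metis
  define B where "B = (\<Prod>i\<in>{..<n}. b i)"
  have "I n \<le> colon K B"
    unfolding I_def plus_le_iff lgen_le_iff
  proof (intro conjI subsetI)
    show "K \<le> colon K B" by (rule colon_ge)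
    fix u assume "u \<in> set (map a [0..<n])"
    then obtain i where i: "i < n" "u = a i" by auto
    have "B = b i * (\<Prod>j\<in>{..<n} - {i}. b j)"
      unfolding B_def using i by (intro prod.remove) auto
    moreover have "u * b i \<in> elts K" using b[OF i(1)] i a(1) by simp
    then have "(u * b i) * (\<Prod>j\<in>{..<n} - {i}. b j) \<in> elts K" by (rule idl_mult')
    ultimately show "u \<in> elts (colon K B)" by (simp add: ac_simps)
  qed
  then have "a n \<in> elts (colon K B)" using an by (rule idl_leD)
  then have "B \<in> elts (P n)" using a(1) by (simp add: ac_simps)
  then obtain i where "i < n" "b i \<in> elts (P n)"
    using max_ann_prime_prod[of "P n" K "{..<n}" b] P(2) by (auto simp: B_def)
  then show False using b by blast
qed

lemma socle_free_power:
  assumes "\<And>u. prin u * m \<le> K \<Longrightarrow> u \<in> elts K" "prin u * m ^ N \<le> K"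
  shows "u \<in> elts K"
  using assms(2)
proof (induction N arbitrary: u)
  case 0
  then show ?case by (simp add: prin_le_iff)
next
  case (Suc N)
  have "prin u * m \<le> K"
    unfolding prin_times_le_iff
  proof
    fix v assume "v \<in> elts m"
    then have "prin u * (prin v * m ^ N) \<le> prin u * m ^ Suc N"
      by (auto simp: prin_le_iff power_Suc intro!: idl_mult_mono)
    then have "prin (u * v) * m ^ N \<le> K" using Suc.prems by (simp add: prin_mult mult.assoc)
    then show "u * v \<in> elts K" by (rule Suc.IH)
  qed
  then show ?case by (rule assms(1))
qed

section \<open>From regular sequences to chains of primes\<close>

definition prime_above :: "'a idl \<Rightarrow> bool" where
  "prime_above P \<longleftrightarrow> K0 \<le> P \<and> 1 \<notin> elts P \<and> (\<forall>x y. x * y \<in> elts P \<longrightarrow> x \<in> elts P \<or> y \<in> elts P)"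

lemma prime_above_m: "prime_above m"
  unfolding prime_above_def using unit_cancel[of m] one_notin_m K0_le_m by blast

text \<open>M is chosen maximal among the ideals above I that avoid all s y^n with s outside P.
  Regularity of y keeps this multiplicative set away from I, and avoiding it makes M a prime inside
  P that does not contain y.\<close>

lemma reg_prime_drop:
  assumes "K0 \<le> I" "colon I y \<le> I" "I + prin y \<le> P" "prime_above P"
  shows "\<exists>M. I \<le> M \<and> prime_above M \<and> M < P"
proof -
  define Q where "Q M \<longleftrightarrow> (\<forall>s n. s \<notin> elts P \<longrightarrow> s * y ^ n \<notin> elts M)" for M
  have P: "1 \<notin> elts P" "\<And>x y. x * y \<in> elts P \<Longrightarrow> x \<in> elts P \<or> y \<in> elts P"
    using assms(4) by (auto simp: prime_above_def)
  have IP: "I \<le> P" "y \<in> elts P" using assms(3) by (auto simp: plus_le_iff prin_le_iff)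
  have drop: "y ^ n * s \<in> elts I \<Longrightarrow> s \<in> elts I" for s n
  proof (induction n)
    case (Suc n)
    then show ?case using colon_leD[OF assms(2), of "y ^ n * s"] by (simp add: mult.assoc power_Suc)
  qed simp
  have "Q I" unfolding Q_def using drop idl_leD[OF IP(1)] by (metis mult.commute)
  then obtain M where M: "M \<ge> I" "Q M" and max: "\<forall>N>M. \<not> Q N"
    using maximal_exists[of Q I] assms(1) by blast
  have ex: "\<exists>s n c. s \<notin> elts P \<and> s * y ^ n - c * x \<in> elts M" if "x \<notin> elts M" for x
  proof -
    have "M < M + prin x" using that by (intro less_add_idl) (simp add: prin_le_iff)
    then have "\<not> Q (M + prin x)" using max by blast
    then show ?thesis unfolding Q_def mem_plus_prin_iff by blast
  qed
  have "prime_above M"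
    unfolding prime_above_def
  proof (intro conjI allI impI)
    show "K0 \<le> M" using assms(1) M(1) by (rule order_trans)
    show "1 \<notin> elts M" using M(2)[unfolded Q_def, rule_format, of 1 0] P by simp
    fix x w assume xw: "x * w \<in> elts M"
    show "x \<in> elts M \<or> w \<in> elts M"
    proof (rule ccontr)
      assume "\<not> ?thesis"
      then obtain s n c s' n' c' where
        1: "s \<notin> elts P" "s * y ^ n - c * x \<in> elts M" and
        2: "s' \<notin> elts P" "s' * y ^ n' - c' * w \<in> elts M" using ex by metis
      have "(s * s') * y ^ (n + n') = (s' * y ^ n') * (s * y ^ n - c * x)
          + (c * x) * (s' * y ^ n' - c' * w) + (c * c') * (x * w)"
        by (simp add: algebra_simps power_add)
      also have "\<dots> \<in> elts M" by (rule idl_add[OF idl_add[OF idl_mult[OF 1(2)] idl_mult[OF 2(2)]] idl_mult[OF xw]])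
      finally show False using M(2) P(2)[of s s'] 1 2 unfolding Q_def by blast
    qed
  qed
  moreover have "M < P"
  proof -
    have "M \<le> P" using M(2)[unfolded Q_def, rule_format, of _ 0] by (auto simp: less_eq_idl_def)
    moreover have "y \<notin> elts M" using M(2)[unfolded Q_def, rule_format, of 1 1] P by simp
    ultimately show ?thesis using IP by (auto simp: less_idl_def less_eq_idl_def)
  qed
  ultimately show ?thesis using M by blast
qed

lemma reg_prime_chain:
  assumes "K0 \<le> K" "reg K ys" "K + lgen ys \<le> P" "prime_above P"
  shows "\<exists>Q. (\<forall>i\<le>length ys. prime_above (Q i)) \<and> (\<forall>i<length ys. Q i < Q (Suc i)) \<and> Q (length ys) = P"
  using assms
proof (induction ys arbitrary: P rule: rev_induct)
  case Nil
  then show ?case by (intro exI[of _ "\<lambda>_. P"]) auto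
next
  case (snoc y ys)
  have "colon (K + lgen ys) y \<le> K + lgen ys" using snoc.prems by (simp add: reg_append)
  moreover have "K + lgen ys + prin y \<le> P" using snoc.prems by (simp add: add.assoc)
  ultimately obtain M where M: "K + lgen ys \<le> M" "prime_above M" "M < P"
    using reg_prime_drop[of "K + lgen ys" y P] snoc.prems by (auto intro: idl_le_addI1)
  then obtain Q where Q: "\<forall>i\<le>length ys. prime_above (Q i)" "\<forall>i<length ys. Q i < Q (Suc i)" "Q (length ys) = M"
    using snoc.IH[of M] snoc.prems by (auto simp: reg_append)
  have "(\<forall>i\<le>length (ys @ [y]). prime_above ((Q(Suc (length ys) := P)) i)) \<and>
    (\<forall>i<length (ys @ [y]). (Q(Suc (length ys) := P)) i < (Q(Suc (length ys) := P)) (Suc i))"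
    using Q M snoc.prems by (auto simp: less_Suc_eq le_Suc_eq)
  then show ?case by (intro exI[of _ "Q(Suc (length ys) := P)"]) auto
qed

text \<open>An ideal above \<open>ys\<close> that is maximal among those containing no power of m is
  prime and strictly below m. It is the top of a chain with one step per regular term; appending m
  would exceed the dimension bound.\<close>

lemma reg_primary:
  assumes "reg K0 ys" "set ys \<subseteq> elts m"
    and dim: "\<not> (\<exists>Q. (\<forall>i\<le>Suc (length ys). prime_above (Q i)) \<and> (\<forall>i<Suc (length ys). Q i < Q (Suc i)))"
  shows "\<exists>c. m ^ c \<le> K0 + lgen ys"
proof (rule ccontr)
  assume neg: "\<not> ?thesis"
  then obtain P where P: "P \<ge> K0 + lgen ys" "\<not> (\<exists>c. m ^ c \<le> P)" and max: "\<forall>N>P. \<exists>c. m ^ c \<le> N"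
    using maximal_exists[of "\<lambda>P. \<not> (\<exists>c. m ^ c \<le> P)" "K0 + lgen ys"] by auto
  have K0P: "K0 \<le> P" using P(1) by (simp add: plus_le_iff)
  have "prime_above P"
    unfolding prime_above_def
  proof (intro conjI allI impI)
    show "1 \<notin> elts P"
    proof
      assume "1 \<in> elts P"
      then have "prin 1 \<le> P" by (simp only: prin_le_iff)
      then have "m ^ 0 \<le> P" by simp
      with P(2) show False by blast
    qed
    fix x w assume xw: "x * w \<in> elts P"
    show "x \<in> elts P \<or> w \<in> elts P"
    proof (rule ccontr)
      assume "\<not> ?thesis"
      then have "P < P + prin x" "P < P + prin w" by (auto intro!: less_add_idl simp: prin_le_iff)
      then obtain c c' where c: "m ^ c \<le> P + prin x" "m ^ c' \<le> P + prin w" using max by blast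
      have "m ^ (c + c') \<le> (P + prin x) * (P + prin w)"
        unfolding power_add using c by (rule idl_mult_mono)
      also have "\<dots> \<le> P"
        using xw by (simp add: algebra_simps plus_le_iff prin_le_iff flip: prin_mult)
      finally show False using P(2) by blast
    qed
  qed (rule K0P)
  moreover have "P < m"
  proof (rule le_neq_trans)
    show "P \<le> m" using \<open>prime_above P\<close> by (intro le_m[OF K0P]) (auto simp: prime_above_def)
    show "P \<noteq> m" using P(2) by (metis order_refl power_one_right)
  qed
  moreover obtain Q where Q: "\<forall>i\<le>length ys. prime_above (Q i)" "\<forall>i<length ys. Q i < Q (Suc i)" "Q (length ys) = P"
    using reg_prime_chain[OF order_refl assms(1) P(1) \<open>prime_above P\<close>] by blast
  ultimately have "(\<forall>i\<le>Suc (length ys). prime_above ((Q(Suc (length ys) := m)) i)) \<and>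
    (\<forall>i<Suc (length ys). (Q(Suc (length ys) := m)) i < (Q(Suc (length ys) := m)) (Suc i))"
    using prime_above_m by (auto simp: less_Suc_eq le_Suc_eq)
  then show False using dim by blast
qed

end

section \<open>General elements over an infinite residue field\<close>

locale local_inf = local_base +
  fixes T :: "'a set"
  assumes infinite_T: "infinite T"
    and T_diff: "s \<in> T \<Longrightarrow> t \<in> T \<Longrightarrow> s \<noteq> t \<Longrightarrow> s - t \<notin> elts m"
begin

lemma poly_coeffs_mem_inf:
  assumes "K0 \<le> P" "infinite {t \<in> T. poly p t \<in> elts P}"
  shows "Polynomial.coeff p i \<in> elts P"
proof -
  obtain S where S: "S \<subseteq> {t \<in> T. poly p t \<in> elts P}" "finite S" "card S = Suc (Polynomial.degree p)"
    using infinite_arbitrarily_large[OF assms(2)] by blast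
  show ?thesis
    by (rule poly_coeffs_mem[OF assms(1) S(2)]) (use S T_diff in auto)
qed

text \<open>Prime avoidance along the curve \<open>t \<mapsto> g\<^sub>0 + g\<^sub>1 t + g\<^sub>2 t\<^sup>2 + \<dots>\<close>: an ideal that does not contain
  all \<open>g\<^sub>i\<close> contains only finitely many of its points.\<close>

lemma generic_regular:
  assumes "K0 \<le> K" "\<And>u. (\<And>g. g \<in> set gs \<Longrightarrow> u * g \<in> elts K) \<Longrightarrow> u \<in> elts K"
  shows "finite {t \<in> T. \<not> colon K (poly (Poly gs) t) \<le> K}"
proof -
  have "{t \<in> T. \<not> colon K (poly (Poly gs) t) \<le> K} \<subseteq>
      (\<Union>P\<in>max_ann K. {t \<in> T. poly (Poly gs) t \<in> elts P})"
  proof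
    fix t assume t: "t \<in> {t \<in> T. \<not> colon K (poly (Poly gs) t) \<le> K}"
    then obtain a where a: "a * poly (Poly gs) t \<in> elts K" "a \<notin> elts K"
      by (auto simp: less_eq_idl_def mult.commute)
    obtain P where "P \<in> max_ann K" "colon K a \<le> P" using max_ann_exists[OF assms(1) a(2)] by blast
    then show "t \<in> (\<Union>P\<in>max_ann K. {t \<in> T. poly (Poly gs) t \<in> elts P})"
      using a t by (auto simp: less_eq_idl_def)
  qed
  moreover have "finite {t \<in> T. poly (Poly gs) t \<in> elts P}" if P: "P \<in> max_ann K" for P
  proof (rule ccontr)
    assume inf: "infinite {t \<in> T. poly (Poly gs) t \<in> elts P}"
    obtain a where a: "P = colon K a" "a \<notin> elts K" using P by (auto simp: max_ann_def)
    have "K0 \<le> P" using a assms(1) colon_ge order_trans by blast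
    then have "Polynomial.coeff (Poly gs) i \<in> elts P" for i using inf by (rule poly_coeffs_mem_inf)
    then have "nth_default 0 gs i \<in> elts P" for i by (simp add: coeff_Poly_eq)
    then have "gs ! i \<in> elts P" if "i < length gs" for i using that by (metis nth_default_nth)
    then have "g \<in> elts P" if "g \<in> set gs" for g using that by (metis in_set_conv_nth)
    then have "a \<in> elts K" using a(1) by (intro assms(2)[of a]) simp
    then show False using a by simp
  qed
  ultimately show ?thesis using finite_max_ann[OF assms(1)] by (meson finite_UN_I finite_subset)
qed

lemma poly_Poly_mem: "poly (Poly gs) t \<in> elts (lgen gs)"
proof (induction gs)
  case (Cons g gs)
  then show ?case by (auto intro!: idl_plusI idl_mult)
qed simp

text \<open>For z in m both socles are isomorphic to Ext^1(k, A/K), with k the residue field. The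
  isomorphism is made explicit: it sends u to the v with u w = v z modulo K.\<close>

lemma socle_swap:
  assumes "colon K z \<le> K" "colon K w \<le> K" "w \<in> elts m"
    and "u \<notin> elts (K + prin z)" "prin u * m \<le> K + prin z"
  shows "\<exists>v. v \<notin> elts (K + prin w) \<and> prin v * m \<le> K + prin w"
proof -
  have "u * w \<in> elts (K + prin z)" using assms(3,5) by (simp add: prin_times_le_iff)
  then obtain v where v: "u * w - v * z \<in> elts K" by (auto simp: mem_plus_prin_iff)
  have "prin v * m \<le> K + prin w"
    unfolding prin_times_le_iff
  proof
    fix \<mu> assume "\<mu> \<in> elts m"
    then have "u * \<mu> \<in> elts (K + prin z)" using assms(5) by (simp add: prin_times_le_iff)
    then obtain b where b: "u * \<mu> - b * z \<in> elts K" by (auto simp: mem_plus_prin_iff)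
    have "z * (v * \<mu> - b * w) = w * (u * \<mu> - b * z) - \<mu> * (u * w - v * z)" by (simp add: algebra_simps)
    also have "\<dots> \<in> elts K" by (rule idl_diff[OF idl_mult[OF b] idl_mult[OF v]])
    finally have "v * \<mu> - b * w \<in> elts K" by (rule colon_leD[OF assms(1)])
    then show "v * \<mu> \<in> elts (K + prin w)" by (auto simp: mem_plus_prin_iff)
  qed
  moreover have "v \<notin> elts (K + prin w)"
  proof
    assume "v \<in> elts (K + prin w)"
    then obtain c where c: "v - c * w \<in> elts K" by (auto simp: mem_plus_prin_iff)
    have "w * (u - c * z) = (u * w - v * z) + z * (v - c * w)" by (simp add: algebra_simps)
    also have "\<dots> \<in> elts K" by (rule idl_add[OF v idl_mult[OF c]])
    finally have "u - c * z \<in> elts K" by (rule colon_leD[OF assms(2)])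
    then show False using assms(4) by (auto simp: mem_plus_prin_iff)
  qed
  ultimately show ?thesis by blast
qed

text \<open>Replace the last terms of both sequences by a common general element \<open>w\<close>, which moves the socle
  element along, bring \<open>w\<close> to the front of both sequences and continue modulo \<open>w\<close>.\<close>

lemma reg_socle_free:
  assumes "K0 \<le> K" "reg K zs" "reg K ys" "set zs \<subseteq> elts m" "set ys \<subseteq> elts m"
    "length zs < length ys" "prin u * m \<le> K + lgen zs"
  shows "u \<in> elts (K + lgen zs)"
  using assms
proof (induction "length zs" arbitrary: K zs ys u)
  case 0
  then obtain y ys' where y: "ys = y # ys'" by (cases ys) auto
  have "u * y \<in> elts K" using 0 y by (simp add: prin_times_le_iff)
  then have "y * u \<in> elts K" by (simp add: mult.commute)
  then have "u \<in> elts K" using 0 y colon_leD[of K y u] by simp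
  then show ?case using 0 by simp
next
  case (Suc n)
  obtain zs' z where z: "zs = zs' @ [z]" using Suc(2) by (cases zs rule: rev_cases) auto
  obtain ys' y where y: "ys = ys' @ [y]" using Suc by (cases ys rule: rev_cases) auto
  obtain ms where ms: "m = K0 + lgen ms" using finitely_generated[OF K0_le_m] by blast
  \<comment> \<open>One regular element v of m is enough: whatever kills all generators of m kills
    v, so general combinations of the generators are regular too.\<close>
  have fin: "finite {t \<in> T. \<not> colon L (poly (Poly ms) t) \<le> L}"
    if L: "K0 \<le> L" "colon L v \<le> L" "v \<in> elts m" for L v
  proof (rule generic_regular[OF L(1)])
    fix u assume u: "\<And>g. g \<in> set ms \<Longrightarrow> u * g \<in> elts L"
    have "lgen ms \<le> colon L u" unfolding lgen_le_iff using u by auto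
    moreover have "K0 \<le> colon L u" using L(1) colon_ge order_trans by blast
    ultimately have "m \<le> colon L u" unfolding ms plus_le_iff by simp
    then have "v \<in> elts (colon L u)" using L(3) by (rule idl_leD)
    then have "v * u \<in> elts L" by (simp add: mult.commute)
    then show "u \<in> elts L" by (rule colon_leD[OF L(2)])
  qed
  let ?L1 = "K + lgen zs'" and ?L2 = "K + lgen ys'"
  have r1: "colon ?L1 z \<le> ?L1" "reg K zs'" and r2: "colon ?L2 y \<le> ?L2" "reg K ys'"
    using Suc.prems z y by (auto simp: reg_append)
  have "finite ({t \<in> T. \<not> colon ?L1 (poly (Poly ms) t) \<le> ?L1} \<union> {t \<in> T. \<not> colon ?L2 (poly (Poly ms) t) \<le> ?L2})"
    using Suc.prems z y r1 r2 by (intro finite_UnI fin[of _ z] fin[of _ y]) (auto intro: idl_le_addI1)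
  from Diff_infinite_finite[OF this infinite_T]
  obtain t where t: "t \<in> T" "colon ?L1 (poly (Poly ms) t) \<le> ?L1" "colon ?L2 (poly (Poly ms) t) \<le> ?L2"
    using infinite_imp_nonempty by blast
  define w where "w = poly (Poly ms) t"
  have w: "w \<in> elts m" unfolding w_def ms by (intro idl_plusI2 poly_Poly_mem)
  have "reg K (zs' @ [w])" "reg K (ys' @ [w])"
    using t r1 r2 by (auto simp: reg_append w_def)
  then have rw: "reg K (w # zs')" "reg K (w # ys')"
    using Suc.prems z y by (auto intro!: reg_to_front simp del: reg.simps)
  show ?case
  proof (rule ccontr)
    assume "u \<notin> elts (K + lgen zs)"
    then obtain v where v: "v \<notin> elts (?L1 + prin w)" "prin v * m \<le> ?L1 + prin w"
      using socle_swap[OF r1(1) t(2)[folded w_def] w, of u] Suc.prems(7) by (auto simp: z add.assoc)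
    have "v \<in> elts (K + prin w + lgen zs')"
    proof (rule Suc(1))
      show "K0 \<le> K + prin w" using Suc.prems by (auto intro: idl_le_addI1)
      show "prin v * m \<le> K + prin w + lgen zs'" using v by (simp add: ac_simps)
    qed (use Suc.prems Suc(2) z y rw in auto)
    then show False using v by (simp add: ac_simps)
  qed
qed

text \<open>Generators are exchanged one by one. While fewer than \<open>length ys\<close> are
  chosen, the quotient by them has no socle; as J contains a power of m, nothing nonzero there is
  killed by all remaining generators, and a general combination of these is regular.\<close>

lemma exists_regular_generators:
  assumes J: "J = K0 + lgen xs" "m ^ N \<le> J" "J \<le> m"
    and ys: "reg K0 ys" "set ys \<subseteq> elts m" "length xs \<le> length ys"
  shows "\<exists>zs. length zs = length xs \<and> reg K0 zs \<and> J = K0 + lgen zs"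
proof -
  have "\<exists>zs xs'. length zs = i \<and> length xs' = length xs - i \<and> reg K0 zs \<and> J = K0 + lgen zs + lgen xs'"
    if "i \<le> length xs" for i
    using that
  proof (induction i)
    case 0
    then show ?case using J by (intro exI[of _ "[]"] exI[of _ xs]) simp
  next
    case (Suc i)
    then obtain zs xs' where zs: "length zs = i" "length xs' = length xs - i" "reg K0 zs"
      "J = K0 + lgen zs + lgen xs'" by auto
    then obtain x r where x: "xs' = x # r" using Suc.prems by (cases xs') auto
    let ?K = "K0 + lgen zs"
    have "lgen zs \<le> m" using J(3) zs(4) by (simp add: plus_le_iff)
    then have zm: "set zs \<subseteq> elts m" by (simp only: lgen_le_iff)
    have nos: "u \<in> elts ?K" if "prin u * m \<le> ?K" for u
      using reg_socle_free[OF order_refl zs(3) ys(1) zm ys(2) _ that] Suc.prems zs ys by simp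
    have "finite {t \<in> T. \<not> colon ?K (poly (Poly xs') t) \<le> ?K}"
    proof (rule generic_regular)
      fix u assume u: "\<And>g. g \<in> set xs' \<Longrightarrow> u * g \<in> elts ?K"
      have "lgen xs' \<le> colon ?K u" unfolding lgen_le_iff using u by auto
      then have "J \<le> colon ?K u" unfolding zs(4) using colon_ge[of ?K u] by (simp add: plus_le_iff)
      then have "m ^ N \<le> colon ?K u" using J(2) by (rule order_trans[rotated])
      then have "prin u * m ^ N \<le> ?K" unfolding prin_times_le_iff by (auto simp: less_eq_idl_def)
      from nos this show "u \<in> elts ?K" by (rule socle_free_power)
    qed simp
    from Diff_infinite_finite[OF this infinite_T]
    obtain t where t: "t \<in> T" "colon ?K (poly (Poly xs') t) \<le> ?K"
      using infinite_imp_nonempty by blast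
    define z where "z = poly (Poly xs') t"
    \<comment> \<open>The curve has constant term x, so z differs from x by an element generated by
      r and can replace it.\<close>
    have zx: "z = x + t * poly (Poly r) t" by (simp add: z_def x)
    have "t * poly (Poly r) t \<in> elts (lgen r)" by (intro idl_mult poly_Poly_mem)
    then have "z \<in> elts (prin x + lgen r)" "x \<in> elts (prin z + lgen r)"
      by (auto simp: zx idl_plusI) (metis add_diff_cancel_right' idl_diff idl_plusI1 idl_plusI2 prin_self)
    then have "prin z + lgen r = prin x + lgen r"
      by (intro antisym) (auto simp: plus_le_iff prin_le_iff)
    then have "J = K0 + lgen (zs @ [z]) + lgen r" by (simp add: zs(4) x add.assoc)
    moreover have "reg K0 (zs @ [z])" using zs t by (simp add: reg_append z_def)
    ultimately show ?case using zs x by (intro exI[of _ "zs @ [z]"] exI[of _ r]) auto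
  qed
  from this[of "length xs"] show ?thesis by auto
qed

end

section \<open>Hilbert functions\<close>

definition eventually_poly :: "(nat \<Rightarrow> real) \<Rightarrow> bool" where
  "eventually_poly f \<longleftrightarrow> (\<exists>p. \<forall>\<^sub>F n in sequentially. f n = poly p (real n))"

lemma eventually_polyI: "(\<And>n. n \<ge> N \<Longrightarrow> f n = poly p (real n)) \<Longrightarrow> eventually_poly f"
  unfolding eventually_poly_def eventually_sequentially by blast

lemma eventually_polyE:
  assumes "eventually_poly f"
  obtains N p where "\<And>n. n \<ge> N \<Longrightarrow> f n = poly p (real n)"
  using assms unfolding eventually_poly_def eventually_sequentially by blast

lemma eventually_poly_cong:
  assumes "eventually_poly f" "\<And>n. n \<ge> M \<Longrightarrow> g n = f n"
  shows "eventually_poly g"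
proof -
  obtain p N where "\<And>n. n \<ge> N \<Longrightarrow> f n = poly p (real n)" using assms(1) by (rule eventually_polyE) blast
  then show ?thesis using assms(2) by (intro eventually_polyI[of "max M N" _ p]) auto
qed

lemma eventually_poly_add:
  assumes "eventually_poly f" "eventually_poly g"
  shows "eventually_poly (\<lambda>n. f n + g n)"
proof -
  obtain p N where p: "\<And>n. n \<ge> N \<Longrightarrow> f n = poly p (real n)" using assms(1) by (rule eventually_polyE) blast
  obtain q M where q: "\<And>n. n \<ge> M \<Longrightarrow> g n = poly q (real n)" using assms(2) by (rule eventually_polyE) blast
  show ?thesis using p q by (intro eventually_polyI[of "max M N" _ "p + q"]) auto
qed

lemma eventually_poly_sum:
  assumes "finite A" "\<And>i. i \<in> A \<Longrightarrow> eventually_poly (f i)"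
  shows "eventually_poly (\<lambda>n. \<Sum>i\<in>A. f i n)"
  using assms
proof (induction A rule: finite_induct)
  case empty
  then show ?case by (intro eventually_polyI[of 0 _ 0]) simp
next
  case (insert i A)
  then show ?case by (simp add: eventually_poly_add)
qed

lemma eventually_poly_shift:
  assumes "eventually_poly f"
  shows "eventually_poly (\<lambda>n. f (n - t))"
proof -
  obtain p N where p: "\<And>n. n \<ge> N \<Longrightarrow> f n = poly p (real n)" using assms by (rule eventually_polyE) blast
  show ?thesis
    by (rule eventually_polyI[of "N + t" _ "pcompose p [:- real t, 1:]"])
      (simp add: p poly_pcompose of_nat_diff add.commute)
qed

text \<open>Expand (x + 1)^(n+1) - x^(n+1): the top term is (n + 1) x^n, and antidifferences of the
  lower powers are known by induction.\<close>

lemma antidifference_power: "\<exists>Q :: real poly. \<forall>x. poly Q (x + 1) - poly Q x = x ^ n"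
proof (induction n rule: less_induct)
  case (less n)
  then obtain Q :: "nat \<Rightarrow> real poly"
    where Q: "\<And>k x. k < n \<Longrightarrow> poly (Q k) (x + 1) - poly (Q k) x = x ^ k" by metis
  define R where "R = Polynomial.smult (1 / real (Suc n))
    (Polynomial.monom 1 (Suc n) - (\<Sum>k<n. Polynomial.smult (real (Suc n choose k)) (Q k)))"
  have "poly R (x + 1) - poly R x = x ^ n" for x
  proof -
    have "(x + 1) ^ Suc n = (\<Sum>k\<le>Suc n. real (Suc n choose k) * x ^ k)"
      by (simp only: binomial_ring) simp
    also have "\<dots> = (\<Sum>k<n. real (Suc n choose k) * x ^ k) + real (Suc n) * x ^ n + x ^ Suc n"
      by (simp only: lessThan_Suc_atMost[symmetric] sum.lessThan_Suc) simp
    finally have 1: "(x + 1) ^ Suc n - x ^ Suc n - (\<Sum>k<n. real (Suc n choose k) * x ^ k) = real (Suc n) * x ^ n"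
      by simp
    have "(\<Sum>k<n. real (Suc n choose k) * x ^ k)
        = (\<Sum>k<n. real (Suc n choose k) * poly (Q k) (x + 1)) - (\<Sum>k<n. real (Suc n choose k) * poly (Q k) x)"
      by (simp add: Q flip: sum_subtractf right_diff_distrib)
    moreover have R: "poly R y = (y ^ Suc n - (\<Sum>k<n. real (Suc n choose k) * poly (Q k) y)) / real (Suc n)" for y
      by (simp add: R_def poly_monom poly_sum del: of_nat_Suc binomial_Suc_Suc)
    ultimately have "poly R (x + 1) - poly R x
        = ((x + 1) ^ Suc n - x ^ Suc n - (\<Sum>k<n. real (Suc n choose k) * x ^ k)) / real (Suc n)"
      unfolding R diff_divide_distrib[symmetric] by (intro arg_cong[of _ _ "\<lambda>u. u / real (Suc n)"]) linarith
    then show ?thesis unfolding 1 by simp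
  qed
  then show ?case by blast
qed

lemma antidifference: "\<exists>Q :: real poly. \<forall>x. poly Q (x + 1) - poly Q x = poly p x"
proof -
  obtain Q :: "nat \<Rightarrow> real poly" where Q: "\<And>k x. poly (Q k) (x + 1) - poly (Q k) x = x ^ k"
    using antidifference_power by metis
  have "poly (\<Sum>k\<le>Polynomial.degree p. Polynomial.smult (Polynomial.coeff p k) (Q k)) (x + 1)
      - poly (\<Sum>k\<le>Polynomial.degree p. Polynomial.smult (Polynomial.coeff p k) (Q k)) x = poly p x" for x
    by (simp add: poly_sum poly_altdef[of p] Q flip: sum_subtractf right_diff_distrib)
  then show ?thesis by blast
qed

lemma eventually_poly_partial_sums:
  assumes "eventually_poly f"
  shows "eventually_poly (\<lambda>n. \<Sum>s\<le>n. f s)"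
proof -
  obtain p N where p: "\<And>n. n \<ge> N \<Longrightarrow> f n = poly p (real n)" using assms by (rule eventually_polyE) blast
  obtain Q :: "real poly" where Q: "\<And>x. poly Q (x + 1) - poly Q x = poly (pcompose p [:1, 1:]) x"
    using antidifference by metis
  define c where "c = (\<Sum>s\<le>N. f s) - poly Q (real N)"
  have "(\<Sum>s\<le>n. f s) = poly (Q + [:c:]) (real n)" if "n \<ge> N" for n
    using that
  proof (induction n rule: dec_induct)
    case base
    then show ?case by (simp add: c_def)
  next
    case (step n)
    have "f (Suc n) = poly Q (real n + 1) - poly Q (real n)"
      using step p[of "Suc n"] Q[of "real n"] by (simp add: poly_pcompose add.commute)
    then show ?case using step by (simp add: add.commute)
  qed
  then show ?thesis by (rule eventually_polyI)
qed

text \<open>From T on the functions coincide, so the tail of the convolution is a partial sum of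
  \<open>g T\<close>; the finitely many other functions contribute shifts.\<close>

lemma eventually_poly_convolution:
  fixes g :: "nat \<Rightarrow> nat \<Rightarrow> real"
  assumes "\<And>t. eventually_poly (g t)" "\<And>t. t \<ge> T \<Longrightarrow> g t = g T"
  shows "eventually_poly (\<lambda>n. \<Sum>t\<le>n. g t (n - t))"
proof (rule eventually_poly_cong)
  show "eventually_poly (\<lambda>n. (\<Sum>t<T. g t (n - t)) + (\<Sum>s\<le>n - T. g T s))"
  proof (rule eventually_poly_add)
    show "eventually_poly (\<lambda>n. \<Sum>t<T. g t (n - t))"
      by (rule eventually_poly_sum) (auto intro: eventually_poly_shift assms(1))
    show "eventually_poly (\<lambda>n. \<Sum>s\<le>n - T. g T s)"
      by (rule eventually_poly_shift[OF eventually_poly_partial_sums[OF assms(1)]])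
  qed
  fix n assume n: "n \<ge> T"
  have "{..n} = {..<T} \<union> {T..n}" "{..<T} \<inter> {T..n} = {}" using n by auto
  then have "(\<Sum>t\<le>n. g t (n - t)) = (\<Sum>t<T. g t (n - t)) + (\<Sum>t\<in>{T..n}. g t (n - t))"
    by (simp add: sum.union_disjoint)
  also have "(\<Sum>t\<in>{T..n}. g t (n - t)) = (\<Sum>t\<in>{T..n}. g T (n - t))"
  proof (rule sum.cong[OF refl])
    fix t assume "t \<in> {T..n}"
    then have "g t = g T" by (intro assms(2)) simp
    then show "g t (n - t) = g T (n - t)" by (rule fun_cong)
  qed
  also have "\<dots> = (\<Sum>s\<le>n - T. g T s)"
    by (rule sum.reindex_bij_witness[of _ "\<lambda>s. n - s" "\<lambda>t. n - t"]) (use n in auto)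
  finally show "(\<Sum>t\<le>n. g t (n - t)) = (\<Sum>t<T. g t (n - t)) + (\<Sum>s\<le>n - T. g T s)" .
qed

section \<open>Graded systems of ideals and slicing by one variable\<close>

definition prev :: "(nat \<Rightarrow> 'a :: zero) \<Rightarrow> nat \<Rightarrow> 'a" where
  "prev E n = (case n of 0 \<Rightarrow> 0 | Suc k \<Rightarrow> E k)"

lemma prev_simps [simp]: "prev E 0 = 0" "prev E (Suc n) = E n"
  by (simp_all add: prev_def)

definition var_stable :: "'a :: comm_ring_1 list \<Rightarrow> (nat \<Rightarrow> 'a idl) \<Rightarrow> bool" where
  "var_stable xs L \<longleftrightarrow> (\<forall>x\<in>set xs. \<forall>n. prin x * L n \<le> L (Suc n))"

text \<open>For stable F and E these are the graded submodules of the direct sum of all E n / F n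
  over a polynomial ring whose variables act as multiplication by the entries of
  \<open>xs\<close>.\<close>

definition subsystem :: "'a :: comm_ring_1 list \<Rightarrow> (nat \<Rightarrow> 'a idl) \<Rightarrow> (nat \<Rightarrow> 'a idl) \<Rightarrow> (nat \<Rightarrow> 'a idl) \<Rightarrow> bool" where
  "subsystem xs F E L \<longleftrightarrow> (\<forall>n. F n \<le> L n \<and> L n \<le> E n) \<and> var_stable xs L"

text \<open>The coefficients of \<open>x\<^sup>t\<close> in degree \<open>s\<close> of the elements of \<open>L\<close>, modulo higher powers of \<open>x\<close>.
  The function \<open>prev\<close> makes \<open>E\<close> vanish in degree \<open>-1\<close>.\<close>

definition slice :: "'a :: comm_ring_1 \<Rightarrow> (nat \<Rightarrow> 'a idl) \<Rightarrow> (nat \<Rightarrow> 'a idl) \<Rightarrow> nat \<Rightarrow> nat \<Rightarrow> 'a idl" where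
  "slice x E L t s = inf (E s) (colon (L (s + t) + prin (x ^ Suc t) * prev E s) (x ^ t))"

text \<open>The multiples of x^t in degree n of E. Vanishing for t > n makes the filtration by t end
  in F n after n + 1 steps.\<close>

definition gr_shift :: "'a :: comm_ring_1 \<Rightarrow> (nat \<Rightarrow> 'a idl) \<Rightarrow> nat \<Rightarrow> nat \<Rightarrow> 'a idl" where
  "gr_shift x E t n = (if t \<le> n then prin (x ^ t) * E (n - t) else 0)"

lemma stableD: "var_stable xs L \<Longrightarrow> x \<in> set xs \<Longrightarrow> a \<in> elts (L n) \<Longrightarrow> x * a \<in> elts (L (Suc n))"
  unfolding var_stable_def prin_times_le_iff by blast

lemma stable_power: "var_stable xs L \<Longrightarrow> x \<in> set xs \<Longrightarrow> a \<in> elts (L n) \<Longrightarrow> x ^ t * a \<in> elts (L (n + t))"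
proof (induction t)
  case (Suc t)
  then show ?case using stableD[of xs L x "x ^ t * a"] by (simp add: power_Suc mult.assoc)
qed simp

lemma stable_prev: "var_stable xs E \<Longrightarrow> x \<in> set xs \<Longrightarrow> a \<in> elts (prev E n) \<Longrightarrow> x * a \<in> elts (E n)"
  by (cases n) (auto intro: stableD)

lemma stable_Cons: "var_stable (x # xs) L \<Longrightarrow> var_stable xs L"
  by (simp add: var_stable_def)

text \<open>Adding x E to the lower bound makes x act as zero on a slice, so slices are systems in
  one variable fewer. All inductions on the number of variables use this.\<close>

lemma slice_subsystem:
  assumes E: "var_stable (x # xs) E" and L: "subsystem (x # xs) F E L"
  shows "subsystem xs (\<lambda>s. F s + prin x * prev E s) E (slice x E L t)"
  unfolding subsystem_def var_stable_def plus_le_iff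
proof (intro conjI allI ballI)
  have FL: "F n \<le> L n" "L n \<le> E n" "var_stable (x # xs) L" for n using L by (auto simp: subsystem_def)
  fix s
  show "slice x E L t s \<le> E s" by (simp add: slice_def)
  show "F s \<le> slice x E L t s"
  proof (rule idl_leI)
    fix a assume "a \<in> elts (F s)"
    then have a: "a \<in> elts (L s)" using FL(1) idl_leD by blast
    then have "x ^ t * a \<in> elts (L (s + t))" by (rule stable_power[OF FL(3), rotated]) simp
    then show "a \<in> elts (slice x E L t s)" using idl_leD[OF FL(2) a] by (simp add: slice_def idl_plusI1)
  qed
  show "prin x * prev E s \<le> slice x E L t s"
    unfolding prin_times_le_iff
  proof
    fix a assume a: "a \<in> elts (prev E s)"
    then have "x ^ Suc t * a \<in> elts (prin (x ^ Suc t) * prev E s)" by (simp add: elts_prin_times)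
    then have "x ^ t * (x * a) \<in> elts (L (s + t) + prin (x ^ Suc t) * prev E s)"
      by (intro idl_plusI2) (simp add: power_Suc ac_simps)
    moreover have "x * a \<in> elts (E s)" using E a by (intro stable_prev) auto
    ultimately show "x * a \<in> elts (slice x E L t s)" by (simp add: slice_def)
  qed
  fix y assume y: "y \<in> set xs"
  show "prin y * slice x E L t s \<le> slice x E L t (Suc s)"
    unfolding prin_times_le_iff
  proof
    fix a assume "a \<in> elts (slice x E L t s)"
    then have a: "a \<in> elts (E s)" "x ^ t * a \<in> elts (L (s + t) + prin (x ^ Suc t) * prev E s)"
      by (auto simp: slice_def)
    then obtain l b where lb: "l \<in> elts (L (s + t))" "b \<in> elts (prev E s)" "x ^ t * a = l + x ^ Suc t * b"
      by (auto simp: elts_prin_times elim!: idl_plusE)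
    have "x ^ t * (y * a) = y * l + x ^ Suc t * (y * b)"
      using arg_cong[OF lb(3), of "\<lambda>u. y * u"] by (simp add: algebra_simps)
    moreover have "y * l \<in> elts (L (Suc s + t))" using stableD[OF FL(3) _ lb(1), of y] y by simp
    moreover have "y * b \<in> elts (E s)" using stable_prev[OF E _ lb(2), of y] y by simp
    then have "x ^ Suc t * (y * b) \<in> elts (prin (x ^ Suc t) * prev E (Suc s))" by (simp add: elts_prin_times)
    ultimately have "x ^ t * (y * a) \<in> elts (L (Suc s + t) + prin (x ^ Suc t) * prev E (Suc s))"
      using idl_plusI by metis
    moreover have "y * a \<in> elts (E (Suc s))" using stableD[OF E _ a(1), of y] y by simp
    ultimately show "y * a \<in> elts (slice x E L t (Suc s))" by (simp add: slice_def)
  qed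
qed

lemma slice_mono_L: "L (s + t) \<le> L' (s + t) \<Longrightarrow> slice x E L t s \<le> slice x E L' t s"
proof (rule idl_leI)
  fix a assume "L (s + t) \<le> L' (s + t)" and a: "a \<in> elts (slice x E L t s)"
  then have "L (s + t) + prin (x ^ Suc t) * prev E s \<le> L' (s + t) + prin (x ^ Suc t) * prev E s"
    by (intro add_right_mono)
  then show "a \<in> elts (slice x E L' t s)" using a idl_leD by (auto simp: slice_def)
qed

lemma slice_mono_t:
  assumes "var_stable (x # xs) L"
  shows "slice x E L t s \<le> slice x E L (Suc t) s"
proof (rule idl_leI)
  fix a assume "a \<in> elts (slice x E L t s)"
  then have a: "a \<in> elts (E s)" "x ^ t * a \<in> elts (L (s + t) + prin (x ^ Suc t) * prev E s)"
    by (auto simp: slice_def)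
  then obtain l b where lb: "l \<in> elts (L (s + t))" "b \<in> elts (prev E s)" "x ^ t * a = l + x ^ Suc t * b"
    by (auto simp: elts_prin_times elim!: idl_plusE)
  have "x ^ Suc t * a = x * l + x ^ Suc (Suc t) * b"
    using arg_cong[OF lb(3), of "\<lambda>u. x * u"] by (simp add: algebra_simps power_Suc)
  moreover have "x * l \<in> elts (L (s + Suc t))" using stableD[OF assms _ lb(1), of x] by simp
  moreover have "x ^ Suc (Suc t) * b \<in> elts (prin (x ^ Suc (Suc t)) * prev E s)"
    using lb by (simp add: elts_prin_times)
  ultimately have "x ^ Suc t * a \<in> elts (L (s + Suc t) + prin (x ^ Suc (Suc t)) * prev E s)"
    using idl_plusI by metis
  then show "a \<in> elts (slice x E L (Suc t) s)" using a by (simp add: slice_def)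
qed

lemma gr_shift_Suc_eq: "t \<le> n \<Longrightarrow> gr_shift x E (Suc t) n = prin (x ^ Suc t) * prev E (n - t)"
proof (cases "Suc t \<le> n")
  case True
  then have "n - t = Suc (n - Suc t)" by simp
  then show ?thesis using True by (simp only: prev_simps gr_shift_def if_True)
next
  case False
  assume "t \<le> n"
  with False have "n - t = 0" by simp
  with False show ?thesis by (simp add: gr_shift_def)
qed

lemma slice_at: "t \<le> n \<Longrightarrow> slice x E L t (n - t) = inf (E (n - t)) (colon (L n + gr_shift x E (Suc t) n) (x ^ t))"
  by (simp add: slice_def gr_shift_Suc_eq)

text \<open>The leading-coefficient argument of Hilbert's basis theorem, with lowest coefficients:
  an element of L' n is corrected by elements of L n until the remainder is a multiple of x^(n+1) in
  degree n, which is 0.\<close>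

lemma slices_determine:
  assumes L: "subsystem xs F E L" "subsystem xs F E L'" and le: "\<And>n. L n \<le> L' n"
    and eq: "\<And>t. slice x E L t = slice x E L' t"
  shows "L = L'"
proof
  fix n
  have *: "L' n \<le> L n + gr_shift x E t n" for t
  proof (induction t)
    case 0
    then show ?case using L(2) by (auto simp: subsystem_def gr_shift_def intro: idl_le_addI2)
  next
    case (Suc t)
    show ?case
    proof (cases "t \<le> n")
      case True
      show ?thesis
      proof (rule idl_leI)
        fix a assume a: "a \<in> elts (L' n)"
        from idl_leD[OF Suc a] obtain l b where lb: "l \<in> elts (L n)" "b \<in> elts (E (n - t))" "a = l + x ^ t * b"
          using True by (auto simp: elts_prin_times gr_shift_def elim!: idl_plusE)
        have "x ^ t * b \<in> elts (L' n)" using lb(3) idl_diff[OF a idl_leD[OF le lb(1)]] by simp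
        then have "b \<in> elts (slice x E L' t (n - t))" using lb True by (simp add: slice_at idl_plusI1)
        then have "b \<in> elts (slice x E L t (n - t))" by (simp add: eq)
        then have "x ^ t * b \<in> elts (L n + gr_shift x E (Suc t) n)" using True by (simp add: slice_at)
        then show "a \<in> elts (L n + gr_shift x E (Suc t) n)" unfolding lb(3) using idl_plusI1[OF lb(1)] by (rule idl_add[rotated])
      qed
    next
      case False
      then show ?thesis using Suc by (simp add: gr_shift_def)
    qed
  qed
  have "L' n \<le> L n" using *[of "Suc n"] by (simp add: gr_shift_def)
  then show "L n = L' n" using le by (rule antisym[rotated])
qed

text \<open>Modulo F, the system E is generated over the variables by its degrees up to N.\<close>

definition generated_from :: "nat \<Rightarrow> 'a :: comm_ring_1 list \<Rightarrow> (nat \<Rightarrow> 'a idl) \<Rightarrow> (nat \<Rightarrow> 'a idl) \<Rightarrow> bool" where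
  "generated_from N xs F E \<longleftrightarrow> (\<forall>n\<ge>N. E (Suc n) \<le> F (Suc n) + lgen xs * E n)"

lemma generated_from_Cons:
  "generated_from N (x # xs) F E \<Longrightarrow> generated_from N xs (\<lambda>s. F s + prin x * prev E s) E"
  by (simp add: generated_from_def distrib_right add.assoc)

lemma generated_from_mono:
  "generated_from N xs F E \<Longrightarrow> (\<And>n. F n \<le> F' n) \<Longrightarrow> generated_from N xs F' E"
  unfolding generated_from_def by (meson add_right_mono order_trans)

lemma sum_enat: "(\<Sum>t\<in>A. enat (f t)) = enat (\<Sum>t\<in>A. f t)"
  by (induction A rule: infinite_finite_induct) (auto simp: zero_enat_def)

lemma idl_mono_le:
  fixes f :: "nat \<Rightarrow> 'b :: order"
  assumes "\<And>n. f n \<le> f (Suc n)" "i \<le> j"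
  shows "f i \<le> f j"
  using assms(1) assms(2) by (rule lift_Suc_mono_le)

context local_base
begin

text \<open>Hilbert's basis theorem for graded systems. The slices S j t grow in both indices; once
  the diagonal is stationary from j1 on, all slices with j and t at least j1 agree, and the finitely
  many columns t < j1 become stationary one by one.\<close>

lemma subsystems_acc:
  assumes "\<And>n. K0 \<le> F n" "var_stable xs E" "generated_from N xs F E"
    and "\<And>j. subsystem xs F E (L j)" "\<And>j n. L j n \<le> L (Suc j) n"
  shows "\<exists>j0. \<forall>j\<ge>j0. L j = L j0"
  using assms
proof (induction xs arbitrary: F L)
  case Nil
  have FL: "F n \<le> L j n" "L j n \<le> E n" for j n using Nil(4) by (auto simp: subsystem_def)
  have "\<exists>j0. \<forall>j\<ge>j0. L j n = L j0 n" for n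
  proof (rule noeth)
    show "K0 \<le> L j n" for j using Nil(1) FL(1) by (rule order_trans)
  qed (rule Nil(5))
  then obtain j0 where j0: "\<And>n j. j \<ge> j0 n \<Longrightarrow> L j n = L (j0 n) n" by metis
  \<comment> \<open>Without variables F and E coincide in degrees above N, so only finitely many
    degrees can move.\<close>
  define M where "M = Max (j0 ` {..N})"
  have M: "j0 n \<le> M" if "n \<le> N" for n using that by (simp add: M_def)
  have "L j = L M" if "j \<ge> M" for j
  proof
    fix n
    show "L j n = L M n"
    proof (cases "n \<le> N")
      case True
      then show ?thesis using j0[of n j] j0[of n M] M[OF True] that by (simp only: order_trans)
    next
      case False
      then obtain k where "n = Suc k" "k \<ge> N" by (metis Suc_leD Suc_le_D not_less_eq_eq)
      then have "E n \<le> F n" using Nil(3) by (simp add: generated_from_def)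
      then have "L i n = F n" for i using FL(1)[of n i] FL(2)[of i n] by (auto intro: order_antisym order_trans)
      then show ?thesis by simp
    qed
  qed
  then show ?case by blast
next
  case (Cons x xs)
  define F' where "F' s = F s + prin x * prev E s" for s
  define S where "S j t = slice x E (L j) t" for j t
  have st: "var_stable (x # xs) (L j)" for j using Cons.prems(4)[of j] by (simp add: subsystem_def)
  have sub: "subsystem xs F' E (S j t)" for j t
    unfolding F'_def S_def by (rule slice_subsystem[OF Cons.prems(2) Cons.prems(4)])
  have mono1: "S j t n \<le> S (Suc j) t n" for j t n
    unfolding S_def by (rule slice_mono_L[OF Cons.prems(5)])
  have mono2: "S j t n \<le> S j (Suc t) n" for j t n
    unfolding S_def by (rule slice_mono_t[OF st])
  have mono: "S j t n \<le> S j' t' n" if "j \<le> j'" "t \<le> t'" for j t j' t' n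
  proof -
    have "S j t n \<le> S j' t n" by (rule idl_mono_le[of "\<lambda>j. S j t n", OF mono1 that(1)])
    also have "\<dots> \<le> S j' t' n" by (rule idl_mono_le[of "\<lambda>t. S j' t n", OF mono2 that(2)])
    finally show ?thesis .
  qed
  have acc: "\<exists>j0. \<forall>j\<ge>j0. G j = G j0"
    if "\<And>j. subsystem xs F' E (G j)" "\<And>j n. G j n \<le> G (Suc j) n" for G
  proof (rule Cons.IH[of F' G])
    show "K0 \<le> F' n" for n using Cons.prems(1) by (simp add: F'_def idl_le_addI1)
    show "var_stable xs E" using Cons.prems(2) by (rule stable_Cons)
    show "generated_from N xs F' E" unfolding F'_def using Cons.prems(3) by (rule generated_from_Cons)
  qed (rule that)+
  obtain j1 where j1: "\<And>j. j \<ge> j1 \<Longrightarrow> S j j = S j1 j1"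
    using acc[of "\<lambda>j. S j j"] sub mono by (metis le_SucI order_refl)
  have big: "S j t = S j1 j1" if "j \<ge> j1" "t \<ge> j1" for j t
  proof
    fix n
    have "S j1 j1 n \<le> S j t n" using that by (rule mono)
    moreover have "S j t n \<le> S (max j t) (max j t) n" by (rule mono) auto
    moreover have "S (max j t) (max j t) = S j1 j1" using that by (intro j1) auto
    ultimately show "S j t n = S j1 j1 n" by (simp add: order_antisym)
  qed
  have "\<exists>j0. \<forall>j\<ge>j0. S j t = S j0 t" for t
    using acc[of "\<lambda>j. S j t"] sub mono1 by blast
  then obtain j2 where j2: "\<And>t j. j \<ge> j2 t \<Longrightarrow> S j t = S (j2 t) t" by metis
  define M where "M = Max (insert j1 (j2 ` {..<j1}))"
  have M: "j1 \<le> M" "\<And>t. t < j1 \<Longrightarrow> j2 t \<le> M" by (auto simp: M_def)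
  have "L j = L M" if j: "j \<ge> M" for j
  proof (rule sym, rule slices_determine[OF Cons.prems(4) Cons.prems(4)])
    show "L M n \<le> L j n" for n by (rule idl_mono_le[of "\<lambda>j. L j n", OF Cons.prems(5) j])
    fix t
    have "S M t = S j t"
    proof (cases "t < j1")
      case True
      then show ?thesis using j2[of t M] j2[of t j] M(2)[OF True] j by (metis order_trans)
    next
      case False
      then show ?thesis using big[of M t] big[of j t] M(1) j by simp
    qed
    then show "slice x E (L M) t = slice x E (L j) t" by (simp add: S_def)
  qed
  then show ?case by blast
qed

text \<open>Filter E n by the multiples of x^t; by \<open>len_colon\<close> each step of the
  filtration has the length of one slice quotient.\<close>

lemma len_slices:
  assumes "var_stable (x # xs) E" "\<And>n. F n \<le> E n"
  shows "len (F n) (E n) = (\<Sum>t\<le>n. len (slice x E F t (n - t)) (E (n - t)))"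
proof -
  define D where "D t = F n + gr_shift x E t n" for t
  have step: "D (Suc t) \<le> D t \<and> len (D (Suc t)) (D t) = len (slice x E F t (n - t)) (E (n - t))" if "t \<le> n" for t
  proof -
    have "gr_shift x E (Suc t) n \<le> gr_shift x E t n"
      unfolding gr_shift_Suc_eq[OF that] prin_times_le_iff
    proof
      fix a assume "a \<in> elts (prev E (n - t))"
      then have "x * a \<in> elts (E (n - t))" using assms(1) by (intro stable_prev) auto
      then have "x ^ t * (x * a) \<in> elts (prin (x ^ t) * E (n - t))" by (simp add: elts_prin_times)
      then show "x ^ Suc t * a \<in> elts (gr_shift x E t n)"
        using that by (simp add: gr_shift_def power_Suc ac_simps)
    qed
    then have "D (Suc t) + prin (x ^ t) * E (n - t) = D t" "D (Suc t) \<le> D t"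
      using that by (simp_all add: D_def gr_shift_def[of x E t] add.assoc idl_add_absorb1 add_left_mono)
    moreover have "slice x E F t (n - t) = inf (E (n - t)) (colon (D (Suc t)) (x ^ t))"
      using that by (simp add: slice_at D_def)
    ultimately show ?thesis using len_colon[of "E (n - t)" "D (Suc t)" "x ^ t"] by simp
  qed
  have "len (D k) (D 0) = (\<Sum>t<k. len (slice x E F t (n - t)) (E (n - t))) \<and> D k \<le> D 0" if "k \<le> Suc n" for k
    using that
  proof (induction k)
    case (Suc k)
    then have k: "D (Suc k) \<le> D k" "len (D (Suc k)) (D k) = len (slice x E F k (n - k)) (E (n - k))"
      using step[of k] by auto
    have IH: "len (D k) (D 0) = (\<Sum>t<k. len (slice x E F t (n - t)) (E (n - t)))" "D k \<le> D 0" using Suc by auto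
    show ?case using len_add[OF k(1) IH(2)] k IH order_trans[OF k(1) IH(2)] by (simp add: add.commute)
  qed simp
  from this[of "Suc n"] have "len (D (Suc n)) (D 0) = (\<Sum>t\<le>n. len (slice x E F t (n - t)) (E (n - t)))"
    by (simp add: lessThan_Suc_atMost)
  moreover have "D (Suc n) = F n" "D 0 = E n"
    using assms(2) by (simp_all add: D_def gr_shift_def idl_add_absorb1)
  ultimately show ?thesis by simp
qed

text \<open>Slicing by powers of the variable \<open>x\<close> writes the Hilbert function as a convolution of Hilbert
  functions in fewer variables, of which only finitely many differ.\<close>

lemma hilbert_function:
  assumes "\<And>n. K0 \<le> F n" "var_stable xs E" "generated_from N xs F E" "subsystem xs F E F"
    and "\<And>n. len (F n) (E n) \<noteq> \<infinity>"
  shows "eventually_poly (\<lambda>n. real (the_enat (len (F n) (E n))))"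
  using assms
proof (induction xs arbitrary: F)
  case Nil
  have "the_enat (len (F n) (E n)) = 0" if "n \<ge> Suc N" for n
  proof -
    obtain k where "n = Suc k" "k \<ge> N" using \<open>n \<ge> Suc N\<close> by (metis Suc_le_D Suc_le_mono)
    then have "E n \<le> F n" using Nil(3) by (simp add: generated_from_def)
    moreover have "F n \<le> E n" using Nil(4) by (auto simp: subsystem_def)
    ultimately have "F n = E n" by simp
    then show ?thesis by (simp add: zero_enat_def)
  qed
  then show ?case by (intro eventually_polyI[of "Suc N" _ 0]) simp
next
  case (Cons x xs)
  define F' where "F' s = F s + prin x * prev E s" for s
  define S where "S t = slice x E F t" for t
  have st: "var_stable (x # xs) F" using Cons.prems(4) by (simp add: subsystem_def)
  have sub: "subsystem xs F' E (S t)" for t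
    unfolding F'_def S_def by (rule slice_subsystem[OF Cons.prems(2) Cons.prems(4)])
  have FE: "F n \<le> E n" for n using Cons.prems(4) by (auto simp: subsystem_def)
  have FS: "F n \<le> S t n" "S t n \<le> E n" for t n
    using sub[of t] by (auto simp: subsystem_def F'_def plus_le_iff)
  have gen: "generated_from N xs F' E" unfolding F'_def using Cons.prems(3) by (rule generated_from_Cons)
  have sE: "var_stable xs E" using Cons.prems(2) by (rule stable_Cons)
  have "\<exists>T. \<forall>t\<ge>T. S t = S T"
  proof (rule subsystems_acc[OF _ sE gen sub])
    show "K0 \<le> F' n" for n using Cons.prems(1) by (simp add: F'_def idl_le_addI1)
    show "S t n \<le> S (Suc t) n" for t n unfolding S_def by (rule slice_mono_t[OF st])
  qed
  then obtain T where T: "\<And>t. t \<ge> T \<Longrightarrow> S t = S T" by blast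
  have fin: "len (S t n) (E n) \<noteq> \<infinity>" for t n
    using len_anti_left[OF FS] Cons.prems(5)[of n] by (metis enat_ord_simps(5))
  define g where "g t s = real (the_enat (len (S t s) (E s)))" for t s
  have "eventually_poly (g t)" for t
    unfolding g_def
  proof (rule Cons.IH[OF _ sE _ _ fin])
    show "K0 \<le> S t n" for n using Cons.prems(1) FS(1) by (rule order_trans)
    show "generated_from N xs (S t) E"
      using gen sub[of t] by (auto simp: subsystem_def intro: generated_from_mono)
    show "subsystem xs (S t) E (S t)" using sub[of t] by (simp add: subsystem_def)
  qed
  then have "eventually_poly (\<lambda>n. \<Sum>t\<le>n. g t (n - t))"
  proof (rule eventually_poly_convolution)
    show "g t = g T" if "t \<ge> T" for t by (intro ext) (simp add: g_def T[OF that])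
  qed
  moreover have "real (the_enat (len (F n) (E n))) = (\<Sum>t\<le>n. g t (n - t))" for n
  proof -
    have "len (S t (n - t)) (E (n - t)) = enat (the_enat (len (S t (n - t)) (E (n - t))))" for t
      using fin[of t "n - t"] by (cases "len (S t (n - t)) (E (n - t))") auto
    then have "len (F n) (E n) = (\<Sum>t\<le>n. enat (the_enat (len (S t (n - t)) (E (n - t)))))"
      unfolding len_slices[OF Cons.prems(2) FE] S_def by metis
    also have "\<dots> = enat (\<Sum>t\<le>n. the_enat (len (S t (n - t)) (E (n - t))))"
      by (rule sum_enat)
    finally show ?thesis by (simp add: g_def)
  qed
  ultimately show ?case by simp
qed

end

section \<open>Generators of minimal reductions\<close>

text \<open>The base B digits of k are the exponents, so the numbers k < B^r run through the
  monomials in r letters with all exponents below B.\<close>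

primrec mon_code :: "nat \<Rightarrow> 'a :: comm_ring_1 list \<Rightarrow> nat \<Rightarrow> 'a" where
  "mon_code B [] k = 1"
| "mon_code B (x # xs) k = x ^ (k mod B) * mon_code B xs (k div B)"

primrec deg_code :: "nat \<Rightarrow> 'a list \<Rightarrow> nat \<Rightarrow> nat" where
  "deg_code B [] k = 0"
| "deg_code B (x # xs) k = k mod B + deg_code B xs (k div B)"

text \<open>Passing t^B to the tail shifts the i-th entry, counted from 0, by t^(B^i) w: a Kronecker
  substitution fitted to the digits of \<open>mon_code\<close>.\<close>

primrec line_shift :: "nat \<Rightarrow> 'a :: comm_ring_1 \<Rightarrow> 'a list \<Rightarrow> 'a \<Rightarrow> 'a list" where
  "line_shift B w [] t = []"
| "line_shift B w (x # xs) t = (x - t * w) # line_shift B w xs (t ^ B)"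

lemma deg_code_le: "B > 0 \<Longrightarrow> deg_code B xs k \<le> length xs * (B - 1)"
proof (induction xs arbitrary: k)
  case (Cons x xs)
  have "k mod B < B" using Cons.prems by simp
  then have "k mod B \<le> B - 1" by linarith
  then show ?case using Cons.IH[of "k div B"] Cons.prems by simp
qed simp

lemma length_line_shift [simp]: "length (line_shift B w xs t) = length xs"
  by (induction xs arbitrary: t) auto

lemma power_mem: "x \<in> elts I \<Longrightarrow> x ^ n \<in> elts (I ^ n)"
  by (induction n) (auto simp: power_Suc intro: times_mem)

lemma mon_code_mem: "set xs \<subseteq> elts I \<Longrightarrow> mon_code B xs k \<in> elts (I ^ deg_code B xs k)"
  by (induction xs arbitrary: k) (auto simp: power_add intro: times_mem power_mem)

lemma line_shift_lgen_le: "lgen (line_shift B w xs t) \<le> prin w + lgen xs"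
proof (induction xs arbitrary: t)
  case (Cons x xs)
  have "x - t * w \<in> elts (prin w + lgen (x # xs))"
    by (intro idl_diff idl_plusI1 idl_mult idl_plusI2 lgen_mem) auto
  moreover have "lgen (line_shift B w xs (t ^ B)) \<le> prin w + lgen (x # xs)"
    by (rule order_trans[OF Cons.IH]) (simp add: add_left_mono)
  ultimately show ?case by (simp add: plus_le_iff[of "prin (x - t * w)"] prin_le_iff)
qed simp

lemma lgen_le_line_shift: "lgen xs \<le> lgen (line_shift B w xs t) + prin w"
proof (induction xs arbitrary: t)
  case (Cons x xs)
  have "(x - t * w) + t * w \<in> elts (lgen (line_shift B w (x # xs) t) + prin w)"
    by (rule idl_plusI) (auto intro: idl_plusI1 idl_mult)
  then have "x \<in> elts (lgen (line_shift B w (x # xs) t) + prin w)" by simp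
  moreover have "lgen xs \<le> lgen (line_shift B w (x # xs) t) + prin w"
    by (rule order_trans[OF Cons.IH[of "t ^ B"]]) (simp add: add_right_mono)
  ultimately show ?case by (simp only: lgen_Cons plus_le_iff[of "prin x"] prin_le_iff simp_thms)
qed simp

text \<open>\<open>prev (\<lambda>e. Y * G ^ e) d\<close> is Y G^(d-1), and 0 for d = 0: the
  products of d factors from G of which one lies in Y. It is the error term of the
  substitution.\<close>

lemma prev_mult_mem:
  fixes G Y :: "'a :: comm_ring_1 idl"
  assumes "v \<in> elts (prev (\<lambda>e. Y * G ^ e) d)" "u \<in> elts (G ^ a)"
  shows "u * v \<in> elts (prev (\<lambda>e. Y * G ^ e) (a + d))"
proof (cases d)
  case 0
  then show ?thesis using assms by simp
next
  case (Suc e)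
  have "v * u \<in> elts (Y * G ^ e * G ^ a)" using assms Suc by (intro times_mem) auto
  then show ?thesis by (simp add: Suc mult.assoc mult.commute[of u] add.commute flip: power_add)
qed

lemma power_diff_mem:
  fixes G Y :: "'a :: comm_ring_1 idl"
  assumes "x - y \<in> elts Y" "x \<in> elts G" "y \<in> elts G"
  shows "x ^ a - y ^ a \<in> elts (prev (\<lambda>e. Y * G ^ e) a)"
proof (induction a)
  case (Suc a)
  have "x * (x ^ a - y ^ a) \<in> elts (prev (\<lambda>e. Y * G ^ e) (1 + a))"
    using assms Suc by (intro prev_mult_mem) auto
  moreover have "(x - y) * y ^ a \<in> elts (Y * G ^ a)" using assms by (intro times_mem power_mem)
  ultimately have "x * (x ^ a - y ^ a) + (x - y) * y ^ a \<in> elts (prev (\<lambda>e. Y * G ^ e) (Suc a))"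
    by (simp add: idl_add)
  then show ?case by (simp add: algebra_simps power_Suc)
qed simp

text \<open>The substitution \<open>x\<^sub>i \<mapsto> t\<^bsup>B\<^sup>i\<^esup> w\<close> sends the monomial with code \<open>k\<close> to
  \<open>t\<^sup>k\<close> times a power of \<open>w\<close>, so distinct monomials can be separated by their powers of \<open>t\<close>.\<close>

lemma mon_code_line_shift:
  fixes G Y :: "'a :: comm_ring_1 idl"
  assumes "k < B ^ length xs" "set (line_shift B w xs t) \<subseteq> elts Y" "set xs \<subseteq> elts G" "w \<in> elts G" "B > 0"
  shows "mon_code B xs k - t ^ k * w ^ deg_code B xs k \<in> elts (prev (\<lambda>e. Y * G ^ e) (deg_code B xs k))"
  using assms
proof (induction xs arbitrary: k t)
  case Nil
  then show ?case by simp
next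
  case (Cons x xs)
  let ?V = "\<lambda>d. elts (prev (\<lambda>e. Y * G ^ e) d)"
  define a k' d' M where defs: "a = k mod B" "k' = k div B" "d' = deg_code B xs k'" "M = mon_code B xs k'"
  have "k' < B ^ length xs" using Cons.prems by (simp add: defs power_Suc div_less_iff_less_mult mult.commute)
  then have IH: "M - (t ^ B) ^ k' * w ^ d' \<in> ?V d'"
    using Cons.IH[of k' "t ^ B"] Cons.prems by (simp add: defs)
  have "x ^ a * (M - (t ^ B) ^ k' * w ^ d') \<in> ?V (a + d')"
    using Cons.prems by (intro prev_mult_mem[OF IH] power_mem) auto
  moreover have "x ^ a - (t * w) ^ a \<in> ?V a"
    using Cons.prems by (intro power_diff_mem) (auto intro: idl_mult)
  then have "((t ^ B) ^ k' * w ^ d') * (x ^ a - (t * w) ^ a) \<in> ?V (d' + a)"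
    using Cons.prems by (intro prev_mult_mem idl_mult power_mem) auto
  ultimately have "x ^ a * (M - (t ^ B) ^ k' * w ^ d') + ((t ^ B) ^ k' * w ^ d') * (x ^ a - (t * w) ^ a) \<in> ?V (a + d')"
    by (simp add: add.commute[of d'] idl_add)
  moreover have "t ^ k = t ^ a * (t ^ B) ^ k'"
    by (simp add: defs flip: power_mult power_add)
  then have "x ^ a * (M - (t ^ B) ^ k' * w ^ d') + ((t ^ B) ^ k' * w ^ d') * (x ^ a - (t * w) ^ a)
      = x ^ a * M - t ^ k * w ^ (a + d')"
    by (simp add: algebra_simps power_mult_distrib power_add)
  ultimately show ?case by (simp add: defs)
qed

lemma lgen_map_combination:
  "a \<in> elts (lgen (map g [0..<k])) \<Longrightarrow> \<exists>c. a = (\<Sum>j<k. c j * g j)"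
proof (induction k arbitrary: a)
  case (Suc k)
  then obtain b r where b: "b \<in> elts (lgen (map g [0..<k]))" "a = b + r * g k"
    by (auto simp: elts_prin elim!: idl_plusE)
  from Suc.IH[OF b(1)] obtain c where "b = (\<Sum>j<k. c j * g j)" ..
  then have "a = (\<Sum>j<Suc k. (c(k := r)) j * g j)" by (simp add: b)
  then show ?case by blast
qed auto

section \<open>Reductions modulo \<open>K0\<close> and the growth of the powers of m\<close>

context local_base
begin

text \<open>The reverse inclusion holds modulo \<open>K0\<close> as soon as J \<le> m.\<close>

definition reduces :: "'a idl \<Rightarrow> nat \<Rightarrow> bool" where
  "reduces J N \<longleftrightarrow> m ^ Suc N \<le> K0 + J * m ^ N"

lemma reduces_power:
  assumes "reduces J N"
  shows "m ^ (n + N) \<le> K0 + J ^ n * m ^ N"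
proof (induction n)
  case (Suc n)
  have "m ^ (Suc n + N) = m * m ^ (n + N)" by (simp add: power_Suc)
  also have "\<dots> \<le> m * (K0 + J ^ n * m ^ N)" using Suc by (rule mult_left_mono) simp
  also have "\<dots> = m * K0 + J ^ n * m ^ Suc N" by (simp add: algebra_simps power_Suc)
  also have "\<dots> \<le> m * K0 + J ^ n * (K0 + J * m ^ N)"
    using assms by (intro add_left_mono mult_left_mono) (auto simp: reduces_def)
  also have "\<dots> \<le> K0 + J ^ Suc n * m ^ N"
    by (simp add: plus_le_iff distrib_left power_Suc idl_le_addI1) (simp add: ac_simps)
  finally show ?case .
qed simp

lemma reduces_mono:
  assumes "reduces J N" "n \<ge> N"
  shows "reduces J n"
  using assms(2,1)
proof (induction n rule: dec_induct)
  case (step n)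
  then have "m * m ^ Suc n \<le> m * (K0 + J * m ^ n)" unfolding reduces_def by (intro mult_left_mono) auto
  also have "\<dots> \<le> K0 + J * m ^ Suc n"
    by (simp add: distrib_left plus_le_iff idl_le_addI1 power_Suc) (simp add: ac_simps)
  finally show ?case by (simp add: reduces_def power_Suc)
qed

lemma reduces_primary: "reduces J N \<Longrightarrow> K0 \<le> J \<Longrightarrow> m ^ Suc N \<le> J"
  unfolding reduces_def by (erule order_trans) (simp add: plus_le_iff)

lemma len_m_1: "len m 1 = 1"
  using len_eq_1[OF K0_le_m, of 1] one_notin_m by simp

lemma m_power_step: "K0 + m ^ Suc n \<le> K0 + m ^ n" "m * (K0 + m ^ n) \<le> K0 + m ^ Suc n"
  by (auto simp: power_Suc distrib_left plus_le_iff intro: idl_le_addI1 idl_le_addI2)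

lemma len_m_power_finite: "len (K0 + m ^ n) 1 \<noteq> \<infinity>"
proof (induction n)
  case (Suc n)
  have "len (K0 + m ^ Suc n) (K0 + m ^ n) \<noteq> \<infinity>"
    by (rule len_quot_m_finite) (auto simp: m_power_step)
  then show ?case using Suc len_add[OF m_power_step(1), of n 1] by (auto simp: plus_eq_infty_iff_enat)
qed simp

lemma len_finite_above_m_power:
  assumes "m ^ n \<le> K" "K0 \<le> K" "K \<le> I"
  shows "len K I \<noteq> \<infinity>"
proof -
  have "K0 + m ^ n \<le> K" using assms by (simp add: plus_le_iff)
  then have "len K 1 \<le> len (K0 + m ^ n) 1" by (rule len_anti_left) simp
  moreover have "len K I \<le> len K 1" by (rule len_mono_right) (use assms in auto)
  ultimately show ?thesis using len_m_power_finite[of n] by (metis enat_ord_simps(5) order_trans)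
qed

lemma len_power_bound:
  assumes "set ys \<subseteq> elts m"
  shows "len (K0 + m ^ Suc n) 1 \<le> enat ((n + length ys) choose length ys) * len (K0 + lgen ys) 1"
proof -
  have "lgen ys ^ Suc n \<le> m ^ Suc n" using assms by (intro idl_pow_mono) (simp add: lgen_le_iff)
  then have "len (K0 + m ^ Suc n) 1 \<le> len (K0 + lgen ys ^ Suc n) 1"
    by (intro len_anti_left add_left_mono) auto
  also have "\<dots> \<le> enat ((n + length ys) choose length ys) * len (K0 + lgen ys) 1" by (rule len_power_le)
  finally show ?thesis .
qed

text \<open>Growth of order \<open>n\<^sup>d\<close> leaves no room for \<open>s + 1 > d\<close> algebraically independent forms.\<close>

lemma growth_gap:
  assumes ys: "set ys \<subseteq> elts m" "m ^ c \<le> K0 + lgen ys" and s: "length ys \<le> s" "s > 0"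
  shows "\<exists>n B. n > 0 \<and> B > 0 \<and> s * (B - 1) \<le> n \<and> len (K0 + m ^ Suc n) (K0 + m ^ n) < enat (B ^ s)"
proof (rule ccontr)
  assume neg: "\<not> ?thesis"
  let ?d = "length ys"
  obtain L where L: "len (K0 + lgen ys) 1 = enat L"
    using len_finite_above_m_power[OF ys(2), of 1] by auto
  \<comment> \<open>If the gap fails, take B = q + 1: each of the s q steps from exponent s q to 2 s
    q has length at least q^s. The total is at most C q^d by \<open>len_power_bound\<close>, hence
    at most C q^s, so s q \<le> C. The choice q = C + 1 contradicts this.\<close>
  define C where "C = L * (2 * s + ?d) ^ ?d"
  define q where "q = Suc C"
  have step: "enat (q ^ s) \<le> len (K0 + m ^ Suc n) (K0 + m ^ n)" if "n \<ge> s * q" for n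
  proof -
    have "n > 0" using that s by (auto simp: q_def intro: gr0I)
    moreover have "s * (Suc q - 1) \<le> n" using that by simp
    ultimately have "enat (Suc q ^ s) \<le> len (K0 + m ^ Suc n) (K0 + m ^ n)"
      using neg by (meson not_le zero_less_Suc)
    moreover have "q ^ s \<le> Suc q ^ s" by (rule power_mono) auto
    ultimately show ?thesis by (meson enat_ord_simps(1) order_trans)
  qed
  have "enat (k * q ^ s) \<le> len (K0 + m ^ (s * q + k)) 1" for k
  proof (induction k)
    case 0
    then show ?case by (simp flip: zero_enat_def)
  next
    case (Suc k)
    have "enat (Suc k * q ^ s) = enat (q ^ s) + enat (k * q ^ s)" by simp
    also have "\<dots> \<le> len (K0 + m ^ Suc (s * q + k)) (K0 + m ^ (s * q + k)) + len (K0 + m ^ (s * q + k)) 1"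
      by (intro add_mono step Suc) simp
    also have "\<dots> = len (K0 + m ^ Suc (s * q + k)) 1"
      by (rule len_add[symmetric]) (auto simp: m_power_step)
    finally show ?case by simp
  qed
  from this[of "s * q"] have 1: "enat (s * q * q ^ s) \<le> len (K0 + m ^ (2 * s * q)) 1"
    by (simp add: mult_2 distrib_right)
  obtain r where r: "2 * s * q = Suc r" using s by (cases "2 * s * q") (auto simp: q_def)
  have "len (K0 + m ^ (2 * s * q)) 1 \<le> enat ((r + ?d) choose ?d) * enat L"
    using len_power_bound[OF ys(1), of r] by (simp add: r L)
  with 1 have "s * q * q ^ s \<le> ((r + ?d) choose ?d) * L" using order_trans by fastforce
  also have "(r + ?d) choose ?d \<le> (r + ?d) ^ ?d" by (rule binomial_le_pow) simp
  also have "\<dots> \<le> ((2 * s + ?d) * q) ^ ?d"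
    using r by (intro power_mono) (auto simp: distrib_right q_def)
  also have "\<dots> = (2 * s + ?d) ^ ?d * q ^ ?d" by (rule power_mult_distrib)
  also have "q ^ ?d \<le> q ^ s" using s by (intro power_increasing) (auto simp: q_def)
  finally have "s * q * q ^ s \<le> C * q ^ s" by (simp add: C_def ac_simps)
  then have "s * q \<le> C" by (simp add: q_def)
  moreover have "q \<le> s * q" using s by simp
  ultimately show False by (simp add: q_def)
qed

end

context local_inf
begin

lemma reduction_drop_generator:
  assumes J: "J = K0 + lgen (w # xs)" "J \<le> m" "reduces J N"
    and n: "n > 0" "B > 0" "length xs * (B - 1) \<le> n"
    and len: "len (K0 + m ^ Suc n) (K0 + m ^ n) < enat (B ^ length xs)"
  shows "\<exists>ys N'. length ys = length xs \<and> K0 + lgen ys \<le> J \<and> reduces (K0 + lgen ys) N'"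
proof -
  define G where "G = prin w + lgen xs"
  have JG: "J = K0 + G" by (simp add: J(1) G_def)
  have Gm: "G \<le> m" using J(2) by (simp add: JG plus_le_iff)
  have xG: "set xs \<subseteq> elts G" "w \<in> elts G" by (auto simp: G_def intro: idl_plusI1 idl_plusI2 lgen_mem)
  have deg: "deg_code B xs k \<le> n" for k using deg_code_le[OF n(2), of xs k] n(3) by (rule order_trans)
  \<comment> \<open>Padding with powers of w brings all monomials to the common degree n; the bound
    on \<open>length xs * (B - 1)\<close> leaves room for it.\<close>
  define g where "g k = w ^ (n - deg_code B xs k) * mon_code B xs k" for k
  have gm: "g k \<in> elts (m ^ n)" for k
  proof -
    have "g k \<in> elts (G ^ (n - deg_code B xs k) * G ^ deg_code B xs k)"
      unfolding g_def by (intro times_mem power_mem xG mon_code_mem)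
    also have "G ^ (n - deg_code B xs k) * G ^ deg_code B xs k = G ^ n"
      using deg[of k] by (simp flip: power_add)
    finally show ?thesis using idl_leD[OF idl_pow_mono[OF Gm]] by blast
  qed
  define K where "K k = K0 + m ^ Suc n + lgen (map g [0..<k])" for k
  have K0K: "K0 \<le> K k" "K 0 \<le> K k" for k by (auto simp: K_def intro: idl_le_addI1)
  have KSuc: "K (Suc k) = K k + prin (g k)" for k by (simp add: K_def add.assoc)
  \<comment> \<open>There are more monomials than the length of m^n / m^(n+1) allows, so one of them
    is a combination of its predecessors modulo m^(n+1).\<close>
  have "\<exists>k < B ^ length xs. g k \<in> elts (K k)"
  proof (rule ccontr)
    assume neg: "\<not> ?thesis"
    have "len (K 0) (K k) = enat k" if "k \<le> B ^ length xs" for k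
      using that
    proof (induction k)
      case 0
      then show ?case by (simp flip: zero_enat_def)
    next
      case (Suc k)
      have "m * prin (g k) \<le> m ^ Suc n"
        using gm by (simp add: power_Suc mult_left_mono prin_le_iff)
      also have "\<dots> \<le> K k" by (simp add: K_def idl_le_addI1)
      finally have "len (K k) (K (Suc k)) = 1"
        unfolding KSuc using neg Suc.prems K0K by (intro len_eq_1) auto
      moreover have "len (K 0) (K (Suc k)) = len (K 0) (K k) + len (K k) (K (Suc k))"
        by (rule len_add) (auto simp: K0K KSuc)
      ultimately show ?case using Suc by (simp add: one_enat_def)
    qed
    then have "enat (B ^ length xs) = len (K 0) (K (B ^ length xs))" by simp
    also have "\<dots> \<le> len (K 0) (K0 + m ^ n)"
    proof (rule len_mono_right)
      have "lgen (map g [0..<B ^ length xs]) \<le> m ^ n" using gm by (auto simp: lgen_le_iff)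
      then show "K (B ^ length xs) \<le> K0 + m ^ n"
        using m_power_step(1)[of n] by (auto simp: K_def plus_le_iff intro: idl_le_addI2)
    qed (rule K0K)
    finally show False using len by (simp add: K_def)
  qed
  then obtain k where k: "k < B ^ length xs" "g k \<in> elts (K k)" by blast
  then obtain b where b: "b \<in> elts (lgen (map g [0..<k]))" "g k - b \<in> elts (K0 + m ^ Suc n)"
    unfolding K_def idl_plus_iff[of _ "K0 + m ^ Suc n"] by blast
  from lgen_map_combination[OF b(1)] obtain c where c: "b = (\<Sum>j<k. c j * g j)" ..
  \<comment> \<open>The relation after the substitution, with w^n taken out. Its coefficient at k is
    1, so it does not vanish modulo m and takes a unit value at all but finitely many t in
    T.\<close>
  define p where "p = Polynomial.monom 1 k - (\<Sum>j<k. Polynomial.monom (c j) j)"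
  have "Polynomial.coeff p k = 1" by (simp add: p_def coeff_sum)
  then have "finite {t \<in> T. poly p t \<in> elts m}"
    using poly_coeffs_mem_inf[OF K0_le_m, of p k] one_notin_m by fastforce
  from Diff_infinite_finite[OF this infinite_T]
  obtain t where t: "t \<in> T" "poly p t \<notin> elts m" using infinite_imp_nonempty by blast
  define ys where "ys = line_shift B w xs t"
  obtain e where e: "n = Suc e" using n(1) by (cases n) auto
  define Y where "Y = lgen ys"
  have YG: "Y \<le> G" unfolding Y_def ys_def G_def by (rule line_shift_lgen_le)
  have GY: "G = Y + prin w"
    using YG lgen_le_line_shift[of xs B w t] xG unfolding Y_def ys_def
    by (intro antisym) (auto simp: G_def plus_le_iff)
  \<comment> \<open>The relation holds modulo K0 + m^(n+1), and a factor from Y leaves e = n - 1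
    factors from m.\<close>
  define D where "D = K0 + m ^ Suc n + Y * m ^ e"
  have gt: "g j - t ^ j * w ^ n \<in> elts D" if "j < B ^ length xs" for j
  proof -
    have "w ^ (n - deg_code B xs j) * (mon_code B xs j - t ^ j * w ^ deg_code B xs j)
        \<in> elts (prev (\<lambda>e. Y * G ^ e) ((n - deg_code B xs j) + deg_code B xs j))"
      by (intro prev_mult_mem mon_code_line_shift that power_mem xG n(2)) (auto simp: Y_def ys_def lgen_mem)
    moreover have "w ^ n = w ^ (n - deg_code B xs j) * w ^ deg_code B xs j"
      using deg[of j] by (simp flip: power_add)
    then have "w ^ (n - deg_code B xs j) * (mon_code B xs j - t ^ j * w ^ deg_code B xs j) = g j - t ^ j * w ^ n"
      by (simp add: g_def algebra_simps)
    ultimately have "g j - t ^ j * w ^ n \<in> elts (Y * G ^ e)" using deg[of j] by (simp add: e)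
    moreover have "Y * G ^ e \<le> D" unfolding D_def by (intro idl_le_addI2 mult_left_mono idl_pow_mono Gm) simp
    ultimately show ?thesis using idl_leD by blast
  qed
  have sum_mem: "(\<Sum>j\<in>S. f j) \<in> elts I" if "\<And>j. j \<in> S \<Longrightarrow> f j \<in> elts I" for S :: "nat set" and f :: "nat \<Rightarrow> 'a" and I
    using that by (induction S rule: infinite_finite_induct) (auto intro: idl_add)
  have sD: "(\<Sum>j<k. c j * (g j - t ^ j * w ^ n)) \<in> elts D"
    by (rule sum_mem, rule idl_mult, rule gt) (use k in auto)
  have "g k - b \<in> elts D" using b(2) by (simp add: D_def idl_plusI1)
  from idl_add[OF idl_diff[OF this gt[OF k(1)]] sD] have "(g k - b) - (g k - t ^ k * w ^ n) + (\<Sum>j<k. c j * (g j - t ^ j * w ^ n)) \<in> elts D" .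
  also have "(g k - b) - (g k - t ^ k * w ^ n) + (\<Sum>j<k. c j * (g j - t ^ j * w ^ n)) = poly p t * w ^ n"
  proof -
    have "(\<Sum>j<k. c j * (g j - t ^ j * w ^ n)) = b - (\<Sum>j<k. c j * t ^ j) * w ^ n"
      unfolding c by (simp add: right_diff_distrib sum_subtractf sum_distrib_right mult.assoc)
    moreover have "poly p t = t ^ k - (\<Sum>j<k. c j * t ^ j)"
      by (simp add: p_def poly_monom poly_sum)
    ultimately show ?thesis by (simp add: left_diff_distrib)
  qed
  finally have "poly p t * w ^ n \<in> elts D" .
  then have wn: "w ^ n \<in> elts D"
    by (rule unit_cancel[OF _ t(2), rotated]) (simp add: D_def add.assoc)
  have "G ^ n \<le> D"
  proof -
    have "Y * (Y + prin w) ^ e \<le> D"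
      unfolding D_def GY[symmetric] by (intro idl_le_addI2 mult_left_mono idl_pow_mono Gm) simp
    moreover have "prin w ^ Suc e \<le> D" using wn by (simp add: prin_le_iff e flip: prin_power)
    ultimately show ?thesis unfolding GY e idl_power_add_Suc by (simp add: plus_le_iff)
  qed
  have "J ^ n \<le> K0 * (K0 + G) ^ e + G ^ n"
    unfolding JG e idl_power_add_Suc ..
  also have "\<dots> \<le> K0 + G ^ n" by (intro add_right_mono) simp
  also have "\<dots> \<le> D" using \<open>G ^ n \<le> D\<close> by (subst plus_le_iff) (simp add: D_def add.assoc)
  finally have JD: "J ^ n \<le> D" .
  have "m ^ (n + N) \<le> K0 + J ^ n * m ^ N" by (rule reduces_power[OF J(3)])
  also have "\<dots> \<le> K0 + D * m ^ N" by (intro add_left_mono mult_right_mono JD) simp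
  also have "D * m ^ N = K0 * m ^ N + m ^ Suc n * m ^ N + Y * m ^ e * m ^ N"
    by (simp add: D_def distrib_right)
  also have "\<dots> = K0 * m ^ N + m * m ^ (n + N) + Y * m ^ (e + N)"
    by (simp add: power_add power_Suc ac_simps)
  also have "K0 + (K0 * m ^ N + m * m ^ (n + N) + Y * m ^ (e + N)) \<le> (K0 + (K0 + Y) * m ^ (e + N)) + m * m ^ (n + N)"
  proof -
    let ?R = "(K0 + (K0 + Y) * m ^ (e + N)) + m * m ^ (n + N)"
    have "K0 \<le> ?R" "K0 * m ^ N \<le> ?R" by (rule idl_le_addI1, rule idl_le_addI1, simp)+
    moreover have "Y * m ^ (e + N) \<le> ?R"
      by (rule idl_le_addI1, rule idl_le_addI2, rule mult_right_mono) auto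
    ultimately show ?thesis by (simp only: plus_le_iff) simp
  qed
  \<comment> \<open>The summand m^(n+1) of D produced the surplus m * m^(n+N), which Nakayama
    absorbs.\<close>
  finally have "m ^ (n + N) \<le> K0 + (K0 + Y) * m ^ (e + N)" by (rule nakayama[rotated]) simp
  then have "reduces (K0 + lgen ys) (e + N)" by (simp add: reduces_def e Y_def)
  moreover have "K0 + lgen ys \<le> J" using YG by (simp add: JG Y_def add_left_mono)
  moreover have "length ys = length xs" by (simp add: ys_def)
  ultimately show ?thesis by blast
qed

text \<open>If a shortest list of generators had more than \<open>length ys\<close> entries,
  dropping one would give a reduction inside J; by minimality it equals J, against the choice of the
  list.\<close>

lemma minimal_reduction_generators:
  assumes J: "K0 \<le> J" "J \<le> m" "reduces J N"
    and min: "\<And>J' N'. K0 \<le> J' \<Longrightarrow> J' \<le> J \<Longrightarrow> reduces J' N' \<Longrightarrow> J' = J"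
    and ys: "set ys \<subseteq> elts m" "m ^ c \<le> K0 + lgen ys" "ys \<noteq> []"
  shows "\<exists>xs. length xs = length ys \<and> J = K0 + lgen xs"
proof -
  define l where "l = (LEAST l. \<exists>xs. length xs = l \<and> J = K0 + lgen xs)"
  obtain xs where xs: "length xs = l" "J = K0 + lgen xs"
    using LeastI_ex[of "\<lambda>l. \<exists>xs. length xs = l \<and> J = K0 + lgen xs"] finitely_generated[OF J(1)] unfolding l_def by blast
  have "l \<le> length ys"
  proof (rule ccontr)
    assume "\<not> l \<le> length ys"
    then obtain w xs' where w: "xs = w # xs'" "length ys \<le> length xs'" using xs(1) by (cases xs) auto
    moreover have "length xs' > 0" using w ys(3) by (cases ys) auto
    ultimately obtain n B where "n > 0" "B > 0" "length xs' * (B - 1) \<le> n"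
      "len (K0 + m ^ Suc n) (K0 + m ^ n) < enat (B ^ length xs')"
      using growth_gap[OF ys(1,2)] by blast
    then obtain zs N' where zs: "length zs = length xs'" "K0 + lgen zs \<le> J" "reduces (K0 + lgen zs) N'"
      using reduction_drop_generator[of J w xs' N n B] xs(2) w(1) J by blast
    then have "K0 + lgen zs = J" by (intro min) auto
    then have "l \<le> length zs" unfolding l_def by (intro Least_le) auto
    then show False using zs w xs by simp
  qed
  \<comment> \<open>Zeros fill the list up to the length of ys. They do no harm, since regular
    generators are formed later from general combinations.\<close>
  then have "length (xs @ replicate (length ys - l) 0) = length ys"
    "J = K0 + lgen (xs @ replicate (length ys - l) 0)"
    using xs by (auto simp: lgen_le_iff intro!: arg_cong[of _ _ "(+) K0"] idl_add_absorb2[symmetric])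
  then show ?thesis by blast
qed

end

section \<open>Lengths and multiplicity for a regular minimal reduction\<close>

text \<open>The middle term is the product (n + 1) (n + 2) ... (n + d).\<close>

lemma power_le_fact_binomial:
  "n ^ d \<le> fact d * ((n + d) choose d) \<and> fact d * ((n + d) choose d) \<le> (n + d) ^ d" for n d :: nat
proof (induction d)
  case (Suc d)
  have eq: "fact (Suc d) * ((n + Suc d) choose Suc d) = (n + Suc d) * (fact d * ((n + d) choose d))"
    using Suc_times_binomial_eq[of "n + d" d] by (simp add: algebra_simps del: binomial_Suc_Suc)
  have "n ^ Suc d \<le> (n + Suc d) * (fact d * ((n + d) choose d))"
    unfolding power_Suc using Suc by (intro mult_mono) auto
  moreover have "(n + d) ^ d \<le> (n + Suc d) ^ d" by (rule power_mono) auto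
  then have "(n + Suc d) * (fact d * ((n + d) choose d)) \<le> (n + Suc d) ^ Suc d"
    unfolding power_Suc using Suc by (intro mult_mono) auto
  ultimately show ?case unfolding eq by simp
qed simp

lemma tendsto_shift_ratio_power: "(\<lambda>n. ((real n + c) / real n) ^ d) \<longlonglongrightarrow> 1"
proof -
  have "(\<lambda>n. (1 + c / real n) ^ d) \<longlonglongrightarrow> (1 + 0) ^ d"
    by (intro tendsto_intros lim_const_over_n)
  moreover have "\<forall>\<^sub>F n in sequentially. (1 + c / real n) ^ d = ((real n + c) / real n) ^ d"
    using eventually_gt_at_top[of 0] by eventually_elim (simp add: add_divide_distrib)
  ultimately have "(\<lambda>n. ((real n + c) / real n) ^ d) \<longlonglongrightarrow> (1 + 0) ^ d" by (rule Lim_transform_eventually)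
  then show ?thesis by simp
qed

lemma tendsto_power_ratio: "a < b \<Longrightarrow> (\<lambda>n. real n ^ a / real n ^ b) \<longlonglongrightarrow> 0"
proof -
  assume "a < b"
  have "(\<lambda>n. (1 / real n) ^ (b - a)) \<longlonglongrightarrow> 0 ^ (b - a)"
    by (intro tendsto_intros lim_1_over_n)
  moreover have "\<forall>\<^sub>F n in sequentially. (1 / real n) ^ (b - a) = real n ^ a / real n ^ b"
    using eventually_gt_at_top[of 0]
  proof eventually_elim
    case (elim n)
    have "real n ^ b = real n ^ a * real n ^ (b - a)" using \<open>a < b\<close> by (simp flip: power_add)
    then show ?case using elim by (simp add: power_divide)
  qed
  ultimately have "(\<lambda>n. real n ^ a / real n ^ b) \<longlonglongrightarrow> 0 ^ (b - a)" by (rule Lim_transform_eventually)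
  then show ?thesis using \<open>a < b\<close> by (simp add: power_0_left)
qed

text \<open>Both bounds are asymptotic to e n^d / d!, so p(n) / n^d has the limit e / d!, which
  determines degree and leading coefficient.\<close>

lemma poly_binomial_sandwich:
  fixes p :: "real poly" and e :: real
  assumes "e > 0"
    and bounds: "\<And>n. n \<ge> N \<Longrightarrow> e * real ((n - N + d) choose d) \<le> poly p (real n) \<and>
      poly p (real n) \<le> e * real ((n + d) choose d)"
  shows "Polynomial.degree p = d" "Polynomial.lead_coeff p = e / fact d"
proof -
  define L where "L = e / fact d"
  have L: "L > 0" using assms(1) by (simp add: L_def)
  have f: "(\<lambda>n. poly p (real n) / real n ^ d) \<longlonglongrightarrow> L"
  proof (rule tendsto_sandwich)
    show "(\<lambda>n. L * ((real n + - real N) / real n) ^ d) \<longlonglongrightarrow> L"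
      using tendsto_mult_left[OF tendsto_shift_ratio_power, of L] by (simp only: mult_1_right)
    show "(\<lambda>n. L * ((real n + real d) / real n) ^ d) \<longlonglongrightarrow> L"
      using tendsto_mult_left[OF tendsto_shift_ratio_power, of L] by (simp only: mult_1_right)
    have e: "e * real k = L * real (fact d * k)" for k by (simp add: L_def)
    show "\<forall>\<^sub>F n in sequentially. L * ((real n + - real N) / real n) ^ d \<le> poly p (real n) / real n ^ d"
      using eventually_ge_at_top[of N]
    proof eventually_elim
      case (elim n)
      have "L * (real n + - real N) ^ d = L * real ((n - N) ^ d)" using elim by (simp add: of_nat_diff)
      also have "\<dots> \<le> L * real (fact d * ((n - N + d) choose d))"
        using power_le_fact_binomial[of "n - N" d] L by (intro mult_left_mono of_nat_mono) auto
      also have "\<dots> \<le> poly p (real n)" using bounds[OF elim] by (simp only: e)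
      finally show ?case by (simp add: power_divide divide_right_mono)
    qed
    show "\<forall>\<^sub>F n in sequentially. poly p (real n) / real n ^ d \<le> L * ((real n + real d) / real n) ^ d"
      using eventually_ge_at_top[of N]
    proof eventually_elim
      case (elim n)
      have "poly p (real n) \<le> L * real (fact d * ((n + d) choose d))" using bounds[OF elim] by (simp only: e)
      also have "\<dots> \<le> L * real ((n + d) ^ d)"
        using power_le_fact_binomial[of n d] L by (intro mult_left_mono of_nat_mono) auto
      finally show ?case by (simp add: power_divide divide_right_mono)
    qed
  qed
  let ?k = "Polynomial.degree p"
  have g: "(\<lambda>n. poly p (real n) / real n ^ ?k) \<longlonglongrightarrow> Polynomial.lead_coeff p"
    using filterlim_compose[OF poly_divide_tendsto_aux[of p] filterlim_mono[OF tendsto_of_nat order_refl order_refl]] .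
  show deg: "?k = d"
  proof (rule ccontr)
    assume "?k \<noteq> d"
    then consider "?k < d" | "d < ?k" by linarith
    then show False
    proof cases
      case 1
      have "(\<lambda>n. (poly p (real n) / real n ^ ?k) * (real n ^ ?k / real n ^ d)) \<longlonglongrightarrow> Polynomial.lead_coeff p * 0"
        by (intro tendsto_mult g tendsto_power_ratio 1)
      moreover have "\<forall>\<^sub>F n in sequentially. (poly p (real n) / real n ^ ?k) * (real n ^ ?k / real n ^ d) = poly p (real n) / real n ^ d"
        using eventually_gt_at_top[of 0] by eventually_elim simp
      ultimately have "(\<lambda>n. poly p (real n) / real n ^ d) \<longlonglongrightarrow> Polynomial.lead_coeff p * 0" by (rule Lim_transform_eventually)
      then show False using LIMSEQ_unique[OF f] L by auto
    next
      case 2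
      have "(\<lambda>n. (poly p (real n) / real n ^ d) * (real n ^ d / real n ^ ?k)) \<longlonglongrightarrow> L * 0"
        by (intro tendsto_mult f tendsto_power_ratio 2)
      moreover have "\<forall>\<^sub>F n in sequentially. (poly p (real n) / real n ^ d) * (real n ^ d / real n ^ ?k) = poly p (real n) / real n ^ ?k"
        using eventually_gt_at_top[of 0] by eventually_elim simp
      ultimately have "(\<lambda>n. poly p (real n) / real n ^ ?k) \<longlonglongrightarrow> L * 0" by (rule Lim_transform_eventually)
      then have "Polynomial.lead_coeff p = 0" using LIMSEQ_unique[OF g] by auto
      then show False using 2 by simp
    qed
  qed
  show "Polynomial.lead_coeff p = e / fact d"
    using LIMSEQ_unique[OF f g[unfolded deg]] by (simp add: L_def deg)
qed

section \<open>Colon ideals and lengths for a regular minimal reduction\<close>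

locale regular_reduction = local_inf +
  fixes J :: "'a idl" and N :: nat and zs :: "'a list"
  assumes J_le: "J \<le> m" and red: "reduces J N"
    and min_red: "\<And>J' N'. K0 \<le> J' \<Longrightarrow> J' \<le> J \<Longrightarrow> reduces J' N' \<Longrightarrow> J' = J"
    and reg_zs: "reg K0 zs" and J_eq: "J = K0 + lgen zs"
begin

abbreviation "M2 \<equiv> K0 + m\<^sup>2"
abbreviation "M3 \<equiv> K0 + m ^ 3"
abbreviation "W \<equiv> K0 + J * m\<^sup>2"

lemma K0_le_J: "K0 \<le> J"
  by (simp add: J_eq)

lemma zs_mem: "set zs \<subseteq> elts m"
  using J_le by (simp add: J_eq plus_le_iff lgen_le_iff)

text \<open>If z were redundant modulo m^2, Nakayama would make the ideal J' of the other generators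
  a reduction, so J' = J by minimality and z lies in J'. But z can be moved to the end of the
  sequence, hence is regular modulo J', and J' would contain 1.\<close>

lemma independent:
  assumes zs: "zs = as @ z # bs"
  shows "z \<notin> elts (M2 + lgen (as @ bs))"
proof
  assume z: "z \<in> elts (M2 + lgen (as @ bs))"
  define J' where "J' = K0 + lgen (as @ bs)"
  have J'J: "J' \<le> J" by (auto simp: J'_def J_eq zs plus_le_iff intro: idl_le_addI2)
  have "J \<le> J' + m\<^sup>2"
    using z by (auto simp: J_eq zs J'_def plus_le_iff prin_le_iff ac_simps intro: idl_le_addI1 idl_le_addI2)
  have "m ^ Suc N \<le> K0 + J * m ^ N" using red by (simp add: reduces_def)
  also have "\<dots> \<le> K0 + (J' + m\<^sup>2) * m ^ N" using \<open>J \<le> J' + m\<^sup>2\<close> by (intro add_left_mono mult_right_mono) auto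
  also have "\<dots> = (K0 + J' * m ^ N) + m * m ^ Suc N"
    by (simp add: algebra_simps power2_eq_square power_Suc)
  finally have "m ^ Suc N \<le> K0 + J' * m ^ N" by (rule nakayama[rotated]) simp
  then have "J' = J" using min_red[of J' N] J'J by (simp add: reduces_def J'_def)
  have "reg (K0 + lgen as) (z # bs)" using reg_zs by (simp add: zs reg_append)
  then have "reg (K0 + lgen as) (bs @ [z])" using zs_mem by (intro reg_to_back) (auto simp: zs)
  then have "colon J' z \<le> J'" by (simp add: reg_append J'_def add.assoc)
  moreover have "z \<in> elts J'" using \<open>J' = J\<close> by (simp add: J_eq zs idl_plusI1 idl_plusI2)
  ultimately have "1 \<in> elts J'" using colon_leD[of J' z 1] by simp
  then show False using J_le \<open>J' = J\<close> one_notin_m idl_leD by blast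
qed

text \<open>A coefficient outside m is a unit and would express its v through the others. The list
  \<open>ws\<close> collects the entries already treated, which keeps the independence hypothesis
  available for the rest.\<close>

lemma coefficients_mem:
  assumes "\<And>as v bs. vs = as @ v # bs \<Longrightarrow> v \<notin> elts (M2 + lgen (as @ bs) + lgen ws)"
    and "g \<in> elts (lgen vs)" "g \<in> elts (M2 + lgen ws)"
  shows "g \<in> elts (m * lgen vs)"
  using assms
proof (induction vs arbitrary: g ws)
  case Nil
  then show ?case by simp
next
  case (Cons v vs)
  obtain c g1 where g: "g1 \<in> elts (lgen vs)" "g = c * v + g1"
    using Cons.prems(2) by (auto simp: elts_prin elim!: idl_plusE)
  have "g - g1 \<in> elts ((M2 + lgen ws) + lgen vs)"
    by (rule idl_diff[OF idl_plusI1[OF Cons.prems(3)] idl_plusI2[OF g(1)]])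
  then have cv: "c * v \<in> elts (M2 + lgen vs + lgen ws)" by (simp add: g ac_simps)
  have cm: "c \<in> elts m"
  proof (rule ccontr)
    assume "c \<notin> elts m"
    then have "v \<in> elts (M2 + lgen vs + lgen ws)"
      using unit_cancel[OF _ _ cv] by (simp add: add.assoc)
    then show False using Cons.prems(1)[of "[]" v vs] by simp
  qed
  have "g1 \<in> elts (m * lgen vs)"
  proof (rule Cons.IH)
    have "g - c * v \<in> elts (M2 + lgen ws + prin v)"
      by (rule idl_diff[OF idl_plusI1[OF Cons.prems(3)] idl_plusI2]) (simp add: idl_mult)
    then show "g1 \<in> elts (M2 + lgen (v # ws))" by (simp add: g ac_simps)
    fix as u bs assume "vs = as @ u # bs"
    then show "u \<notin> elts (M2 + lgen (as @ bs) + lgen (v # ws))"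
      using Cons.prems(1)[of "v # as" u bs] by (simp add: ac_simps)
  qed (rule g)
  moreover have "c * v \<in> elts (m * prin v)" using cm by (intro times_mem) auto
  ultimately show ?case by (auto simp: g distrib_left intro: idl_plusI)
qed

text \<open>The last v is eliminated. In x a = h + v b, regularity of v modulo (us, x, vs) gives b =
  \<alpha> + c x + g; since b lies in m^2, independence puts c and the coefficients of g into m.
  Then x (a - c v) is a relation without v, and c v lies in m^2.\<close>

lemma colon_aux:
  assumes "zs = us @ x # vs @ rest" "x * a \<in> elts (K0 + lgen us + m\<^sup>2 * lgen vs)"
  shows "a \<in> elts (M2 + lgen us)"
  using assms
proof (induction vs arbitrary: a rest rule: rev_induct)
  case Nil
  have c: "colon (K0 + lgen us) x \<le> K0 + lgen us" using reg_zs Nil by (simp add: reg_append)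
  have "a \<in> elts (K0 + lgen us)" using colon_leD[OF c, of a] Nil by simp
  moreover have "K0 + lgen us \<le> M2 + lgen us" by (intro add_right_mono) simp
  ultimately show ?case using idl_leD by blast
next
  case (snoc v vs)
  define Q where "Q = K0 + lgen us"
  have zs: "zs = us @ x # vs @ v # rest" using snoc.prems by simp
  have vm: "v \<in> elts m" "set vs \<subseteq> elts m" using zs_mem zs by auto
  have "x * a \<in> elts ((Q + m\<^sup>2 * lgen vs) + prin v * m\<^sup>2)"
    using snoc.prems(2) by (simp add: Q_def algebra_simps)
  then obtain h b where h: "h \<in> elts (Q + m\<^sup>2 * lgen vs)" and b: "b \<in> elts (m\<^sup>2)" and xa: "x * a = h + v * b"
    by (auto simp: elts_prin_times elim!: idl_plusE[of _ "Q + m\<^sup>2 * lgen vs"])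
  define V where "V = Q + prin x + lgen vs"
  have "Q + m\<^sup>2 * lgen vs \<le> V" by (auto simp: V_def plus_le_iff[of Q] add.assoc intro!: idl_le_addI2[of _ _ Q] idl_le_addI2[of _ "lgen vs"])
  then have hV: "h \<in> elts V" using h by (rule idl_leD)
  have xaV: "x * a \<in> elts V" unfolding V_def by (rule idl_plusI1, rule idl_plusI2, rule idl_mult') simp
  have "v * b \<in> elts V" using idl_diff[OF xaV hV] by (simp add: xa)
  moreover have "colon V v \<le> V"
    using reg_zs by (simp add: zs reg_append V_def Q_def add.assoc)
  ultimately have "b \<in> elts V" by (rule colon_leD[rotated])
  then obtain \<alpha> c g where \<alpha>: "\<alpha> \<in> elts Q" and g: "g \<in> elts (lgen vs)" and beq: "b = \<alpha> + c * x + g"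
    by (auto simp: V_def elts_prin elim!: idl_plusE)
  have cx: "c * x \<in> elts (M2 + lgen us + lgen vs)"
  proof -
    have "b - \<alpha> - g \<in> elts ((m\<^sup>2 + Q) + lgen vs)"
      by (rule idl_diff[OF idl_plusI1[OF idl_diff[OF idl_plusI1[OF b] idl_plusI2[OF \<alpha>]]] idl_plusI2[OF g]])
    then show ?thesis by (simp add: beq Q_def ac_simps)
  qed
  have cm: "c \<in> elts m"
  proof (rule ccontr)
    assume "c \<notin> elts m"
    then have "x \<in> elts (M2 + lgen us + lgen vs)"
      using unit_cancel[OF _ _ cx] by (simp add: add.assoc)
    then have "x \<in> elts ((M2 + lgen us + lgen vs) + lgen (v # rest))" by (rule idl_plusI1)
    then show False using independent[OF zs] by (simp add: ac_simps)
  qed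
  have gm: "g \<in> elts (m * lgen vs)"
  proof (rule coefficients_mem[OF _ g, of "us @ [x]"])
    have "b - \<alpha> - c * x \<in> elts ((m\<^sup>2 + Q) + prin x)"
      by (rule idl_diff[OF idl_plusI1[OF idl_diff[OF idl_plusI1[OF b] idl_plusI2[OF \<alpha>]]] idl_plusI2]) (simp add: idl_mult)
    then show "g \<in> elts (M2 + lgen (us @ [x]))" by (simp add: beq Q_def ac_simps)
    fix as u bs assume vs: "vs = as @ u # bs"
    show "u \<notin> elts (M2 + lgen (as @ bs) + lgen (us @ [x]))"
    proof
      assume "u \<in> elts (M2 + lgen (as @ bs) + lgen (us @ [x]))"
      then have "u \<in> elts (M2 + lgen (as @ bs) + lgen (us @ [x]) + lgen (v # rest))" by (rule idl_plusI1)
      then show False using independent[of "us @ x # as" u "bs @ v # rest"] zs vs by (simp add: ac_simps)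
    qed
  qed
  have "v * g \<in> elts (m * (m * lgen vs))" using vm gm by (intro times_mem)
  then have vg: "v * g \<in> elts (m\<^sup>2 * lgen vs)" by (simp add: power2_eq_square mult.assoc)
  have "x * (a - c * v) = h + v * \<alpha> + v * g"
    using xa by (simp add: beq algebra_simps)
  also have "\<dots> \<in> elts (Q + m\<^sup>2 * lgen vs)"
    by (rule idl_add[OF idl_add[OF h idl_plusI1[OF idl_mult[OF \<alpha>]]] idl_plusI2[OF vg]])
  finally have "a - c * v \<in> elts (M2 + lgen us)"
    using snoc.IH[of "v # rest" "a - c * v"] zs by (simp add: Q_def)
  moreover have "c * v \<in> elts (m\<^sup>2)" unfolding power2_eq_square using cm vm by (intro times_mem)
  then have "c * v \<in> elts (M2 + lgen us)" by (intro idl_plusI1 idl_plusI2)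
  ultimately show ?case by (rule idl_diff_cancel)
qed

text \<open>The part x m^2 of J m^2 changes a only by an element of m^2. What remains involves us
  and the later generators, which is the case of \<open>colon_aux\<close>.\<close>

lemma colon_W:
  assumes zs: "zs = us @ x # vs"
  shows "colon (W + lgen us) x = M2 + lgen us"
proof (rule antisym)
  show "colon (W + lgen us) x \<le> M2 + lgen us"
  proof (rule colon_leI)
    fix a assume "x * a \<in> elts (W + lgen us)"
    moreover have "W + lgen us \<le> (K0 + lgen us + m\<^sup>2 * lgen vs) + prin x * m\<^sup>2"
      by (simp add: J_eq zs plus_le_iff distrib_right)
        (auto simp: ac_simps intro: idl_le_addI1 idl_le_addI2 order_trans[OF idl_mult_le1] order_trans[OF idl_mult_le2])
    ultimately have "x * a \<in> elts ((K0 + lgen us + m\<^sup>2 * lgen vs) + prin x * m\<^sup>2)" using idl_leD by blast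
    then obtain b where b: "b \<in> elts (m\<^sup>2)" "x * a - x * b \<in> elts (K0 + lgen us + m\<^sup>2 * lgen vs)"
      unfolding idl_plus_iff[of _ "K0 + lgen us + m\<^sup>2 * lgen vs"] elts_prin_times by blast
    then have "a - b \<in> elts (M2 + lgen us)"
      using colon_aux[of us x vs "[]" "a - b"] zs by (simp add: right_diff_distrib)
    moreover have "b \<in> elts (M2 + lgen us)" using b(1) by (intro idl_plusI1 idl_plusI2)
    ultimately show "a \<in> elts (M2 + lgen us)" by (rule idl_diff_cancel)
  qed
  have "x \<in> elts J" by (simp add: J_eq zs idl_plusI1 idl_plusI2)
  then have "m\<^sup>2 \<le> colon (W + lgen us) x"
    by (auto simp: less_eq_idl_def intro!: idl_plusI1[OF idl_plusI2[OF times_mem]])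
  moreover have "W + lgen us \<le> colon (W + lgen us) x" by (rule colon_ge)
  ultimately show "M2 + lgen us \<le> colon (W + lgen us) x" by (simp add: plus_le_iff)
qed

lemma split_at: "i < length zs \<Longrightarrow> zs = take i zs @ zs ! i # drop (Suc i) zs"
  by (rule id_take_nth_drop)

lemma len_M2_take: "i \<le> length zs \<Longrightarrow> len M2 (M2 + lgen (take i zs)) = enat i"
proof (induction i)
  case 0
  then show ?case by (simp flip: zero_enat_def)
next
  case (Suc i)
  let ?V = "M2 + lgen (take i zs)" and ?z = "zs ! i"
  have V: "M2 + lgen (take (Suc i) zs) = ?V + prin ?z"
    using Suc.prems by (simp add: take_Suc_conv_app_nth add.assoc)
  have "?z \<in> elts m" using zs_mem Suc.prems by auto
  then have "m * prin ?z \<le> m\<^sup>2" unfolding power2_eq_square by (intro mult_left_mono) (auto simp: prin_le_iff)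
  then have m: "m * prin ?z \<le> ?V" by (auto intro: idl_le_addI1 idl_le_addI2)
  have "?z \<notin> elts (?V + lgen (drop (Suc i) zs))"
    using independent[OF split_at] Suc.prems by (simp add: add.assoc)
  then have "?z \<notin> elts ?V" using idl_plusI1 by blast
  then have "len ?V (?V + prin ?z) = 1" using m by (intro len_eq_1) (auto intro: idl_le_addI1)
  moreover have "len M2 (?V + prin ?z) = len M2 ?V + len ?V (?V + prin ?z)"
    by (rule len_add) simp_all
  ultimately show ?case using Suc unfolding V by (simp add: one_enat_def)
qed

lemma len_W_take:
  "i \<le> length zs \<Longrightarrow> len W (W + lgen (take i zs)) = (\<Sum>k<i. len (M2 + lgen (take k zs)) 1)"
proof (induction i)
  case (Suc i)
  let ?U = "W + lgen (take i zs)" and ?z = "zs ! i"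
  have U: "W + lgen (take (Suc i) zs) = ?U + prin ?z"
    using Suc.prems by (simp add: take_Suc_conv_app_nth add.assoc)
  have "len ?U (?U + prin ?z) = len (M2 + lgen (take i zs)) 1"
    unfolding len_prin using colon_W[OF split_at] Suc.prems by simp
  moreover have "len W (?U + prin ?z) = len W ?U + len ?U (?U + prin ?z)"
    by (rule len_add) simp_all
  ultimately show ?case using Suc unfolding U by simp
qed simp

lemma primary: "m ^ Suc N \<le> J"
  using reduces_primary[OF red K0_le_J] .

theorem length_formula:
  assumes e: "len J 1 = enat e" and \<mu>: "len M2 m = enat \<mu>" and \<mu>2: "len M3 M2 = enat \<mu>2"
    and d: "length zs = d" "d \<ge> 1"
  shows "\<exists>l. len W M3 = enat l \<and>
    int l = int e + (int d - 1) * int \<mu> - int \<mu>2 - int ((d - 1) choose 2)"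
proof -
  have W3: "W \<le> M3"
    using mult_right_mono[OF J_le, of "m\<^sup>2"]
    by (simp add: plus_le_iff numeral_3_eq_3 power_Suc power2_eq_square idl_le_addI2)
  have "m ^ (Suc N + 2) \<le> J * m\<^sup>2" unfolding power_add by (intro mult_right_mono primary) simp
  then have "m ^ (Suc N + 2) \<le> W" by (rule idl_le_addI2)
  then obtain l where l: "len W M3 = enat l" using len_finite_above_m_power[OF _ _ W3] by auto
  have "M3 \<le> M2" unfolding power2_eq_square
    by (simp add: plus_le_iff numeral_3_eq_3 power_Suc idl_le_addI2)
  have M2m: "M2 \<le> m" using K0_le_m by (simp add: plus_le_iff power2_eq_square)
  have M21: "len M2 1 = enat (\<mu> + 1)"
    using len_add[OF M2m, of 1] \<mu> len_m_1 by (simp add: one_enat_def)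
  have "len M3 1 = enat (\<mu>2 + \<mu> + 1)"
    using len_add[OF \<open>M3 \<le> M2\<close>, of 1] \<mu>2 M21 by simp
  then have W1: "len W 1 = enat (l + \<mu>2 + \<mu> + 1)"
    using len_add[OF W3, of 1] l by simp
  \<comment> \<open>The subtraction is truncated, but independence gives k \<le> \<mu> + 1 for all k
    up to d, so no value is cut off.\<close>
  define v where "v k = \<mu> + 1 - k" for k
  have v: "len (M2 + lgen (take k zs)) 1 = enat (v k)" "k \<le> \<mu> + 1" if "k \<le> d" for k
  proof -
    have "enat (\<mu> + 1) = enat k + len (M2 + lgen (take k zs)) 1"
      using len_add[of M2 "M2 + lgen (take k zs)" 1] M21 len_M2_take[of k] that d by simp
    then show "len (M2 + lgen (take k zs)) 1 = enat (v k)" "k \<le> \<mu> + 1"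
      by (cases "len (M2 + lgen (take k zs)) 1"; simp add: v_def)+
  qed
  have WJ: "W + lgen zs = J"
    by (rule antisym) (auto simp: plus_le_iff K0_le_J J_eq add.assoc intro: idl_le_addI2)
  have "len W J = (\<Sum>k<d. enat (v k))"
    using len_W_take[of d] d WJ v by simp
  then have "len W J = enat (\<Sum>k<d. v k)" by (simp add: sum_enat)
  moreover have "W \<le> J" by (simp add: plus_le_iff K0_le_J)
  ultimately have eq: "l + \<mu>2 + \<mu> + 1 = (\<Sum>k<d. v k) + e"
    using len_add[of W J 1] W1 e by simp
  have "int (\<Sum>k<d. v k) = int d * (int \<mu> + 1) - int (d choose 2)" if "d \<le> \<mu> + 2" for d
    using that
  proof (induction d)
    case (Suc d)
    have "Suc d choose 2 = (d choose 2) + d" by (simp add: numeral_2_eq_2)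
    then show ?case using Suc by (simp add: v_def algebra_simps of_nat_diff)
  qed (simp add: numeral_2_eq_2)
  then have S: "int (\<Sum>k<d. v k) = int d * (int \<mu> + 1) - int (d choose 2)"
    using v(2)[of d] by simp
  have "d choose 2 = ((d - 1) choose 2) + (d - 1)"
    using d(2) by (cases d) (simp_all add: numeral_2_eq_2)
  then have C: "int (d choose 2) = int ((d - 1) choose 2) + int d - 1"
    using d(2) by (simp add: of_nat_diff)
  have "int l + int \<mu>2 + int \<mu> + 1 = int d * (int \<mu> + 1) - int (d choose 2) + int e"
    using arg_cong[OF eq, of int] unfolding of_nat_add S by simp
  then have "int l = int e + (int d - 1) * int \<mu> - int \<mu>2 - int ((d - 1) choose 2)"
    unfolding C by (simp add: algebra_simps)
  with l show ?thesis by blast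
qed

theorem hilbert_samuel:
  assumes e: "len J 1 = enat e" and d: "length zs = d"
  shows "0 < e \<and> (\<exists>p :: real poly. Polynomial.degree p = d \<and> Polynomial.lead_coeff p = real e / fact d \<and>
    (\<forall>\<^sub>F n in sequentially. \<exists>l. len (K0 + m ^ (n + 1)) 1 = enat l \<and> real l = poly p (real n)))"
proof
  define E where "E n = K0 + m ^ n" for n
  define F where "F n = K0 + m ^ Suc n" for n
  have FE: "F n \<le> E n" for n unfolding E_def F_def by (rule m_power_step)
  have fin: "len (F n) (E n) \<noteq> \<infinity>" for n
    unfolding E_def F_def by (rule len_finite_above_m_power[of "Suc n"]) (auto simp: m_power_step)
  have step: "prin z * (K0 + m ^ n) \<le> K0 + m ^ Suc n" if "z \<in> set zs" for z n
  proof -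
    have "prin z * (K0 + m ^ n) \<le> m * (K0 + m ^ n)"
      using that zs_mem by (intro mult_right_mono) (auto simp: prin_le_iff)
    then show ?thesis using m_power_step(2) by (rule order_trans)
  qed
  have "eventually_poly (\<lambda>n. real (the_enat (len (F n) (E n))))"
  proof (rule hilbert_function[OF _ _ _ _ fin])
    show "K0 \<le> F n" for n by (simp add: F_def)
    show "var_stable zs E" using step by (simp add: var_stable_def E_def)
    show "subsystem zs F E F" using step FE by (simp add: subsystem_def var_stable_def F_def)
    \<comment> \<open>The reduction equation says that the associated graded ring of m is generated
      in degrees up to N over the polynomial ring with variables for zs.\<close>
    show "generated_from N zs F E"
      unfolding generated_from_def
    proof (intro allI impI)
      fix n assume "N \<le> n"
      then have "m ^ Suc n \<le> K0 + J * m ^ n" using reduces_mono[OF red] by (simp add: reduces_def)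
      also have "\<dots> \<le> K0 + lgen zs * m ^ n"
        by (simp add: J_eq distrib_right plus_le_iff idl_le_addI1)
      also have "\<dots> \<le> F (Suc n) + lgen zs * E n"
        unfolding F_def E_def by (intro add_mono mult_left_mono) auto
      finally show "E (Suc n) \<le> F (Suc n) + lgen zs * E n"
        by (simp add: E_def F_def plus_le_iff add.assoc)
    qed
  qed
  then have "eventually_poly (\<lambda>n. \<Sum>i\<le>n. real (the_enat (len (F i) (E i))))"
    by (rule eventually_poly_partial_sums)
  then obtain M p where p: "\<And>n. n \<ge> M \<Longrightarrow> (\<Sum>i\<le>n. real (the_enat (len (F i) (E i)))) = poly p (real n)"
    by (rule eventually_polyE) blast
  define h where "h n = (\<Sum>i\<le>n. the_enat (len (F i) (E i)))" for n
  have h: "len (K0 + m ^ Suc n) 1 = enat (h n)" for n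
  proof -
    have the: "len (F i) (E i) = enat (the_enat (len (F i) (E i)))" for i
      using fin[of i] by (cases "len (F i) (E i)") auto
    have "len (F n) 1 = (\<Sum>i\<le>n. len (F i) (E i))"
    proof (induction n)
      case 0
      then show ?case by (simp add: E_def)
    next
      case (Suc n)
      have "len (F (Suc n)) 1 = len (F (Suc n)) (E (Suc n)) + len (E (Suc n)) 1"
        by (rule len_add[OF FE]) simp
      moreover have "E (Suc n) = F n" by (simp add: E_def F_def)
      ultimately show ?case using Suc by (simp add: add.commute)
    qed
    also have "\<dots> = (\<Sum>i\<le>n. enat (the_enat (len (F i) (E i))))" using the by (intro sum.cong refl)
    finally show ?thesis by (simp add: sum_enat h_def F_def)
  qed
  have Jz: "len (K0 + lgen zs ^ Suc n) 1 = enat (e * ((n + d) choose d))" for n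
    using len_power_reg[OF order_refl zs_mem reg_zs, of n] e d by (simp add: J_eq mult.commute)
  have upper: "h n \<le> e * ((n + d) choose d)" for n
  proof -
    have "lgen zs ^ Suc n \<le> m ^ Suc n" using zs_mem by (intro idl_pow_mono) (simp add: lgen_le_iff)
    then have "len (K0 + m ^ Suc n) 1 \<le> len (K0 + lgen zs ^ Suc n) 1"
      by (intro len_anti_left add_left_mono) auto
    then show ?thesis by (simp only: h Jz enat_ord_simps)
  qed
  \<comment> \<open>Modulo \<open>K0\<close>, m^(n+1) lies in J^(n+1-N). The shift by N does not
    affect the leading term.\<close>
  have lower: "e * ((n - N + d) choose d) \<le> h n" if "n \<ge> N" for n
  proof -
    have "m ^ Suc n = m ^ (Suc (n - N) + N)" using that by simp
    also have "\<dots> \<le> K0 + J ^ Suc (n - N) * m ^ N" by (rule reduces_power[OF red])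
    also have "\<dots> \<le> K0 + J ^ Suc (n - N)" by (intro add_left_mono) simp
    also have "J ^ Suc (n - N) = K0 * (K0 + lgen zs) ^ (n - N) + lgen zs ^ Suc (n - N)"
      unfolding J_eq by (rule idl_power_add_Suc)
    also have "K0 + \<dots> \<le> K0 + lgen zs ^ Suc (n - N)"
      by (simp add: plus_le_iff idl_le_addI1)
    finally have "len (K0 + lgen zs ^ Suc (n - N)) 1 \<le> len (K0 + m ^ Suc n) 1"
      by (intro len_anti_left) (auto simp: plus_le_iff)
    then show ?thesis by (simp only: h Jz enat_ord_simps)
  qed
  have "J \<noteq> 1" using J_le m_proper by (metis idl_le_1 order_antisym)
  then show "0 < e" using len_eq_0[of J 1] e by (auto intro: gr0I simp: zero_enat_def)
  then have e0: "real e > 0" by simp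
  have bounds: "real e * real ((n - max M N + d) choose d) \<le> poly p (real n) \<and>
      poly p (real n) \<le> real e * real ((n + d) choose d)" if "n \<ge> max M N" for n
  proof
    have hp: "poly p (real n) = real (h n)" using p[of n] that by (simp add: h_def)
    have "(n - max M N + d) choose d \<le> (n - N + d) choose d" by (rule binomial_right_mono) simp
    then have "e * ((n - max M N + d) choose d) \<le> e * ((n - N + d) choose d)" by (rule mult_left_mono) simp
    also have "\<dots> \<le> h n" using lower that by simp
    finally show "real e * real ((n - max M N + d) choose d) \<le> poly p (real n)"
      unfolding hp by (simp flip: of_nat_mult)
    show "poly p (real n) \<le> real e * real ((n + d) choose d)"
      unfolding hp using upper[of n] by (simp flip: of_nat_mult)
  qed
  have "\<exists>l. len (K0 + m ^ (n + 1)) 1 = enat l \<and> real l = poly p (real n)" if "n \<ge> M" for n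
    using h[of n] p[OF that] by (intro exI[of _ "h n"]) (simp add: h_def)
  then have "\<forall>\<^sub>F n in sequentially. \<exists>l. len (K0 + m ^ (n + 1)) 1 = enat l \<and> real l = poly p (real n)"
    by (auto simp: eventually_sequentially)
  with poly_binomial_sandwich[OF e0 bounds]
  show "\<exists>p :: real poly. Polynomial.degree p = d \<and> Polynomial.lead_coeff p = real e / fact d \<and>
    (\<forall>\<^sub>F n in sequentially. \<exists>l. len (K0 + m ^ (n + 1)) 1 = enat l \<and> real l = poly p (real n))"
    by blast
qed

end

section \<open>Transfer from rings given by records\<close>

datatype 'a rexp = RVar 'a | RZero | ROne | RNeg "'a rexp" | RAdd "'a rexp" "'a rexp" | RMul "'a rexp" "'a rexp"

inductive ring_eq :: "'a rexp \<Rightarrow> 'a rexp \<Rightarrow> bool" where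
  refl: "ring_eq a a"
| sym: "ring_eq a b \<Longrightarrow> ring_eq b a"
| trans: "ring_eq a b \<Longrightarrow> ring_eq b c \<Longrightarrow> ring_eq a c"
| neg: "ring_eq a b \<Longrightarrow> ring_eq (RNeg a) (RNeg b)"
| add: "ring_eq a b \<Longrightarrow> ring_eq c d \<Longrightarrow> ring_eq (RAdd a c) (RAdd b d)"
| mul: "ring_eq a b \<Longrightarrow> ring_eq c d \<Longrightarrow> ring_eq (RMul a c) (RMul b d)"
| add_assoc: "ring_eq (RAdd (RAdd a b) c) (RAdd a (RAdd b c))"
| add_comm: "ring_eq (RAdd a b) (RAdd b a)"
| add_zero: "ring_eq (RAdd RZero a) a"
| add_neg: "ring_eq (RAdd (RNeg a) a) RZero"
| mul_assoc: "ring_eq (RMul (RMul a b) c) (RMul a (RMul b c))"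
| mul_comm: "ring_eq (RMul a b) (RMul b a)"
| mul_one: "ring_eq (RMul ROne a) a"
| distrib: "ring_eq (RMul (RAdd a b) c) (RAdd (RMul a c) (RMul b c))"

text \<open>The integer value with all variables set to 0; it separates 0 from 1 in the free
  ring.\<close>

primrec int_eval :: "'a rexp \<Rightarrow> int" where
  "int_eval (RVar x) = 0"
| "int_eval RZero = 0"
| "int_eval ROne = 1"
| "int_eval (RNeg a) = - int_eval a"
| "int_eval (RAdd a b) = int_eval a + int_eval b"
| "int_eval (RMul a b) = int_eval a * int_eval b"

lemma int_eval_cong: "ring_eq a b \<Longrightarrow> int_eval a = int_eval b"
  by (induction rule: ring_eq.induct) (simp_all add: algebra_simps)

text \<open>The free commutative ring on a type. A ring given by a record is a quotient of it, so its ideals are the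
  ideals of the free ring that contain a fixed ideal; this brings the ring into the scope of type classes.\<close>

quotient_type 'a free_ring = "'a rexp" / ring_eq
  by (rule equivpI) (auto simp: reflp_def symp_def transp_def intro: ring_eq.intros)

instantiation free_ring :: (type) comm_ring_1
begin

lift_definition zero_free_ring :: "'a free_ring" is RZero .
lift_definition one_free_ring :: "'a free_ring" is ROne .
lift_definition uminus_free_ring :: "'a free_ring \<Rightarrow> 'a free_ring" is RNeg by (rule ring_eq.neg)
lift_definition plus_free_ring :: "'a free_ring \<Rightarrow> 'a free_ring \<Rightarrow> 'a free_ring" is RAdd by (rule ring_eq.add)
lift_definition times_free_ring :: "'a free_ring \<Rightarrow> 'a free_ring \<Rightarrow> 'a free_ring" is RMul by (rule ring_eq.mul)
definition minus_free_ring :: "'a free_ring \<Rightarrow> 'a free_ring \<Rightarrow> 'a free_ring" where "minus_free_ring a b = a + - b"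

instance
proof
  fix a b c :: "'a free_ring"
  show "a + b + c = a + (b + c)" by transfer (rule ring_eq.add_assoc)
  show "a + b = b + a" by transfer (rule ring_eq.add_comm)
  show "0 + a = a" by transfer (rule ring_eq.add_zero)
  show "- a + a = 0" by transfer (rule ring_eq.add_neg)
  show "a - b = a + - b" by (rule minus_free_ring_def)
  show "a * b * c = a * (b * c)" by transfer (rule ring_eq.mul_assoc)
  show "a * b = b * a" by transfer (rule ring_eq.mul_comm)
  show "1 * a = a" by transfer (rule ring_eq.mul_one)
  show "(a + b) * c = a * c + b * c" by transfer (rule ring_eq.distrib)
  show "(0 :: 'a free_ring) \<noteq> 1" by transfer (auto dest: int_eval_cong)
qed

end

text \<open>The variables range over the whole type. Those outside the carrier go to zero, so that
  every expression has a value in the carrier.\<close>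

primrec ring_eval :: "('a, 'b) ring_scheme \<Rightarrow> 'a rexp \<Rightarrow> 'a" where
  "ring_eval R (RVar x) = (if x \<in> carrier R then x else \<zero>\<^bsub>R\<^esub>)"
| "ring_eval R RZero = \<zero>\<^bsub>R\<^esub>"
| "ring_eval R ROne = \<one>\<^bsub>R\<^esub>"
| "ring_eval R (RNeg a) = \<ominus>\<^bsub>R\<^esub> ring_eval R a"
| "ring_eval R (RAdd a b) = ring_eval R a \<oplus>\<^bsub>R\<^esub> ring_eval R b"
| "ring_eval R (RMul a b) = ring_eval R a \<otimes>\<^bsub>R\<^esub> ring_eval R b"

lemma (in cring) ring_eval_closed [simp]: "ring_eval R a \<in> carrier R"
  by (induction a) auto

lemma (in cring) ring_eval_cong: "ring_eq a b \<Longrightarrow> ring_eval R a = ring_eval R b"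
proof (induction rule: ring_eq.induct)
  case (add_assoc a b c)
  show ?case by (simp add: a_assoc)
next
  case (add_comm a b)
  show ?case by (simp add: a_comm)
next
  case (add_neg a)
  show ?case by (simp add: l_neg)
next
  case (mul_assoc a b c)
  show ?case by (simp add: m_assoc)
next
  case (mul_comm a b)
  show ?case by (simp add: m_comm)
next
  case (distrib a b c)
  show ?case by (simp add: l_distr)
qed simp_all

text \<open>Lifting demands compatibility with \<open>ring_eq\<close> for every record R, including
  those that are no commutative rings; the guard makes the function constant there.\<close>

lift_definition free_eval :: "('a, 'b) ring_scheme \<Rightarrow> 'a free_ring \<Rightarrow> 'a" is
  "\<lambda>R a. if cring R then ring_eval R a else undefined"
  by (auto intro: cring.ring_eval_cong)

lemma free_eval_0: "cring R \<Longrightarrow> free_eval R 0 = \<zero>\<^bsub>R\<^esub>"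
  by transfer simp

lemma free_eval_1: "cring R \<Longrightarrow> free_eval R 1 = \<one>\<^bsub>R\<^esub>"
  by transfer simp

lemma free_eval_add: "cring R \<Longrightarrow> free_eval R (u + v) = free_eval R u \<oplus>\<^bsub>R\<^esub> free_eval R v"
  by transfer simp

lemma free_eval_mult: "cring R \<Longrightarrow> free_eval R (u * v) = free_eval R u \<otimes>\<^bsub>R\<^esub> free_eval R v"
  by transfer simp

lemma free_eval_uminus: "cring R \<Longrightarrow> free_eval R (- u) = \<ominus>\<^bsub>R\<^esub> free_eval R u"
  by transfer simp

lemma free_eval_diff: "cring R \<Longrightarrow> free_eval R (u - v) = free_eval R u \<ominus>\<^bsub>R\<^esub> free_eval R v"
  unfolding minus_free_ring_def a_minus_def by (simp only: free_eval_add free_eval_uminus)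

lemma free_eval_closed: "cring R \<Longrightarrow> free_eval R u \<in> carrier R"
  by transfer (simp add: cring.ring_eval_closed)

lemma (in module) submodule_criterion:
  assumes "H \<subseteq> carrier M" "\<zero>\<^bsub>M\<^esub> \<in> H" "\<And>a b. a \<in> H \<Longrightarrow> b \<in> H \<Longrightarrow> a \<oplus>\<^bsub>M\<^esub> b \<in> H"
    "\<And>a x. a \<in> carrier R \<Longrightarrow> x \<in> H \<Longrightarrow> a \<odot>\<^bsub>M\<^esub> x \<in> H"
  shows "submodule H R M"
proof (rule submoduleI)
  fix a assume "a \<in> H"
  then have "(\<ominus> \<one>) \<odot>\<^bsub>M\<^esub> a \<in> H" "a \<in> carrier M" using assms by auto
  then show "\<ominus>\<^bsub>M\<^esub> a \<in> H" by (simp add: smult_l_minus)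
qed (use assms in auto)

section \<open>Correspondence between the ideals of R and the ideals above
  \<open>ker0\<close>\<close>

context cring
begin

lemma ideal_criterion:
  assumes "S \<subseteq> carrier R" "\<zero> \<in> S" "\<And>a b. a \<in> S \<Longrightarrow> b \<in> S \<Longrightarrow> a \<oplus> b \<in> S"
    "\<And>r a. r \<in> carrier R \<Longrightarrow> a \<in> S \<Longrightarrow> r \<otimes> a \<in> S"
  shows "ideal S R"
proof (rule idealI[OF ring_axioms])
  show "subgroup S (add_monoid R)"
  proof (rule add.subgroupI)
    fix a assume "a \<in> S"
    then have "(\<ominus> \<one>) \<otimes> a \<in> S" "a \<in> carrier R" using assms by auto
    then show "\<ominus> a \<in> S" by (simp add: l_minus)
  qed (use assms in auto)
  show "a \<otimes> x \<in> S" if "a \<in> S" "x \<in> carrier R" for a x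
    using assms(4)[OF that(2,1)] that assms(1) by (metis m_comm subsetD)
qed (use assms in auto)

lemma idealD:
  assumes "ideal I R"
  shows "I \<subseteq> carrier R" "\<zero> \<in> I" "\<And>a b. a \<in> I \<Longrightarrow> b \<in> I \<Longrightarrow> a \<oplus> b \<in> I"
    "\<And>r a. r \<in> carrier R \<Longrightarrow> a \<in> I \<Longrightarrow> r \<otimes> a \<in> I"
    "\<And>a b. a \<in> I \<Longrightarrow> b \<in> I \<Longrightarrow> a \<ominus> b \<in> I"
proof -
  interpret ideal I R by fact
  show "I \<subseteq> carrier R" "\<zero> \<in> I" "\<And>a b. a \<in> I \<Longrightarrow> b \<in> I \<Longrightarrow> a \<oplus> b \<in> I"
    "\<And>r a. r \<in> carrier R \<Longrightarrow> a \<in> I \<Longrightarrow> r \<otimes> a \<in> I"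
    using a_subset by (auto intro: I_l_closed)
  show "\<And>a b. a \<in> I \<Longrightarrow> b \<in> I \<Longrightarrow> a \<ominus> b \<in> I" by (simp add: a_minus_def)
qed

abbreviation \<phi> :: "'a free_ring \<Rightarrow> 'a" where
  "\<phi> \<equiv> free_eval R"

lemma \<phi>_simps [simp]:
  "\<phi> 0 = \<zero>" "\<phi> 1 = \<one>" "\<phi> (u + v) = \<phi> u \<oplus> \<phi> v" "\<phi> (u * v) = \<phi> u \<otimes> \<phi> v" "\<phi> u \<in> carrier R"
  "\<phi> (- u) = \<ominus> \<phi> u" "\<phi> (u - v) = \<phi> u \<ominus> \<phi> v"
  by (rule free_eval_0[OF is_cring] free_eval_1[OF is_cring] free_eval_add[OF is_cring]
      free_eval_mult[OF is_cring] free_eval_closed[OF is_cring] free_eval_uminus[OF is_cring]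
      free_eval_diff[OF is_cring])+

lemma \<phi>_surj: "a \<in> carrier R \<Longrightarrow> \<exists>u. \<phi> u = a"
proof -
  assume a: "a \<in> carrier R"
  have "\<phi> (abs_free_ring (RVar a)) = a" using a is_cring by (simp add: free_eval.abs_eq)
  then show ?thesis ..
qed

definition pre :: "'a set \<Rightarrow> 'a free_ring idl" where
  "pre I = Abs_idl {u. \<phi> u \<in> I}"

definition img :: "'a free_ring idl \<Rightarrow> 'a set" where
  "img K = \<phi> ` elts K"

abbreviation ker0 :: "'a free_ring idl" where
  "ker0 \<equiv> pre {\<zero>}"

lemma elts_pre: "ideal I R \<Longrightarrow> elts (pre I) = {u. \<phi> u \<in> I}"
  unfolding pre_def by (rule elts_Abs) (simp_all add: idealD(2-4))

lemma pre_mono_iff: "ideal I R \<Longrightarrow> ideal I' R \<Longrightarrow> pre I \<le> pre I' \<longleftrightarrow> I \<subseteq> I'"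
proof
  assume *: "ideal I R" "ideal I' R" "pre I \<le> pre I'"
  show "I \<subseteq> I'"
  proof
    fix a assume a: "a \<in> I"
    then obtain u where "\<phi> u = a" using \<phi>_surj idealD(1)[OF *(1)] by blast
    then show "a \<in> I'" using * a by (auto simp: less_eq_idl_def elts_pre)
  qed
qed (auto simp: less_eq_idl_def elts_pre)

lemma pre_inj: "ideal I R \<Longrightarrow> ideal I' R \<Longrightarrow> pre I = pre I' \<longleftrightarrow> I = I'"
  by (auto simp: order_eq_iff[of "pre I"] pre_mono_iff)

lemma pre_less_iff: "ideal I R \<Longrightarrow> ideal I' R \<Longrightarrow> pre I < pre I' \<longleftrightarrow> I \<subset> I'"
  by (auto simp: less_le pre_mono_iff pre_inj)

lemma ker0_le_pre: "ideal I R \<Longrightarrow> ker0 \<le> pre I"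
  using pre_mono_iff[OF zeroideal] idealD(2) by simp

lemma img_ideal: "ideal (img K) R"
proof (rule ideal_criterion)
  show "\<zero> \<in> img K" unfolding img_def by (rule image_eqI[of _ _ 0]) auto
  show "a \<oplus> b \<in> img K" if "a \<in> img K" "b \<in> img K" for a b
  proof -
    from that obtain u v where "u \<in> elts K" "v \<in> elts K" "a = \<phi> u" "b = \<phi> v" by (auto simp: img_def)
    then show ?thesis unfolding img_def by (intro image_eqI[of _ _ "u + v"]) (auto intro: idl_add)
  qed
  show "r \<otimes> a \<in> img K" if r: "r \<in> carrier R" and a: "a \<in> img K" for r a
  proof -
    obtain u where u: "u \<in> elts K" "a = \<phi> u" using a by (auto simp: img_def)
    obtain v where v: "\<phi> v = r" using \<phi>_surj[OF r] ..
    show ?thesis unfolding img_def using u v by (intro image_eqI[of _ _ "v * u"]) (auto intro: idl_mult)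
  qed
qed (auto simp: img_def)

lemma pre_img:
  assumes "ker0 \<le> K"
  shows "pre (img K) = K"
proof (rule idl_eqI, unfold elts_pre[OF img_ideal], intro equalityI subsetI)
  fix u assume "u \<in> {u. \<phi> u \<in> img K}"
  then obtain v where v: "v \<in> elts K" "\<phi> u = \<phi> v" by (auto simp: img_def)
  then have "\<phi> (u - v) = \<zero>" by (simp add: r_neg a_minus_def)
  then have "u - v \<in> elts ker0" by (simp add: elts_pre[OF zeroideal])
  then show "u \<in> elts K" using idl_leD[OF assms] idl_diff_cancel v by blast
qed (auto simp: img_def)

lemma pre_carrier: "pre (carrier R) = 1"
  by (rule idl_eqI) (simp add: elts_pre[OF oneideal])

lemma pre_eq_1_iff: "ideal I R \<Longrightarrow> pre I = 1 \<longleftrightarrow> I = carrier R"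
  using pre_inj[OF _ oneideal] by (simp add: pre_carrier)

text \<open>A product of preimages need not contain the kernel, so \<open>ker0\<close> is added.
  This is the origin of the summand \<open>K0\<close> next to the powers of m.\<close>

lemma pre_prod:
  assumes I: "ideal I R" and L: "ideal L R"
  shows "pre (I \<cdot> L) = ker0 + pre I * pre L"
proof (rule antisym)
  have IL: "ideal (I \<cdot> L) R" using I L by (rule ideal_prod_is_ideal)
  show "ker0 + pre I * pre L \<le> pre (I \<cdot> L)"
    unfolding plus_le_iff times_le_iff using ker0_le_pre[OF IL]
    by (auto simp: elts_pre I L IL intro: ideal_prod.prod)
  have K: "ker0 \<le> ker0 + pre I * pre L" by simp
  have "I \<cdot> L \<subseteq> img (ker0 + pre I * pre L)"
  proof
    fix s assume "s \<in> I \<cdot> L"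
    then show "s \<in> img (ker0 + pre I * pre L)"
    proof (induction rule: ideal_prod.induct)
      case (prod i j)
      obtain u v where uv: "\<phi> u = i" "\<phi> v = j" using \<phi>_surj idealD(1) I L prod by (metis subsetD)
      then have "u * v \<in> elts (ker0 + pre I * pre L)"
        using prod by (intro idl_plusI2 times_mem) (auto simp: elts_pre I L)
      then show ?case using uv by (force simp: img_def)
    next
      case (sum s1 s2)
      then show ?case using idealD(3)[OF img_ideal] by blast
    qed
  qed
  then have "pre (I \<cdot> L) \<le> pre (img (ker0 + pre I * pre L))"
    by (subst pre_mono_iff[OF IL img_ideal])
  then show "pre (I \<cdot> L) \<le> ker0 + pre I * pre L" by (simp only: pre_img[OF K])
qed

lemma ideal_pow_Suc: "ideal_pow R I (Suc n) = ideal_pow R I n \<cdot> I"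
  by (simp add: nat_pow_def ideals_set_def)

lemma ideal_pow_ideal: "ideal I R \<Longrightarrow> ideal (ideal_pow R I n) R"
proof (induction n)
  case 0
  then show ?case using oneideal by (simp add: nat_pow_def ideals_set_def)
next
  case (Suc n)
  then show ?case using ideal_prod_is_ideal by (simp only: ideal_pow_Suc)
qed

lemma pre_pow:
  assumes I: "ideal I R"
  shows "pre (ideal_pow R I n) = ker0 + pre I ^ n"
proof (induction n)
  case 0
  then show ?case by (simp add: nat_pow_def ideals_set_def pre_carrier)
next
  case (Suc n)
  have "pre (ideal_pow R I (Suc n)) = ker0 + (ker0 + pre I ^ n) * pre I"
    unfolding ideal_pow_Suc pre_prod[OF ideal_pow_ideal[OF I] I] Suc ..
  also have "\<dots> = ker0 + pre I ^ Suc n"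
  proof -
    have "ker0 + ker0 * pre I = ker0" by (rule idl_add_absorb2) simp
    then show ?thesis by (simp only: distrib_right add.assoc[symmetric] power_Suc2)
  qed
  finally show ?case .
qed

lemma pre_genideal: "pre (Idl (\<phi> ` set us)) = ker0 + lgen us"
proof (rule antisym)
  have c: "\<phi> ` set us \<subseteq> carrier R" by auto
  have g: "ideal (Idl (\<phi> ` set us)) R" using c by (rule genideal_ideal)
  show "ker0 + lgen us \<le> pre (Idl (\<phi> ` set us))"
    unfolding plus_le_iff lgen_le_iff using ker0_le_pre[OF g] genideal_self[OF c]
    by (auto simp: elts_pre[OF g])
  have "Idl (\<phi> ` set us) \<subseteq> img (ker0 + lgen us)"
    by (rule genideal_minimal[OF img_ideal]) (auto simp: img_def intro!: imageI idl_plusI2 lgen_mem)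
  then have "pre (Idl (\<phi> ` set us)) \<le> pre (img (ker0 + lgen us))"
    by (subst pre_mono_iff[OF g img_ideal])
  then show "pre (Idl (\<phi> ` set us)) \<le> ker0 + lgen us" by (simp only: pre_img[OF idl_le_add1])
qed

lemma lift_list: "set xs \<subseteq> carrier R \<Longrightarrow> \<exists>us. map \<phi> us = xs"
proof (induction xs)
  case (Cons x xs)
  then obtain us u where "map \<phi> us = xs" "\<phi> u = x" using \<phi>_surj by fastforce
  then have "map \<phi> (u # us) = x # xs" by simp
  then show ?case ..
qed simp

section \<open>Module length as length of an interval of ideals\<close>

lemma submodule_ideal_module_iff:
  assumes I: "ideal I R"
  shows "submodule N R (ideal_module R I) \<longleftrightarrow> ideal N R \<and> N \<subseteq> I"
proof
  interpret M: module R "ideal_module R I" by (rule ideal_module_is_module[OF I])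
  {
    assume N: "submodule N R (ideal_module R I)"
    have NI: "N \<subseteq> I" using M.submoduleE(1)[OF N] by (simp add: ideal_module_def)
    have add: "a \<in> N \<Longrightarrow> b \<in> N \<Longrightarrow> a \<oplus> b \<in> N" for a b
      using M.submoduleE(5)[OF N] by (simp add: ideal_module_def)
    have mult: "r \<in> carrier R \<Longrightarrow> a \<in> N \<Longrightarrow> r \<otimes> a \<in> N" for r a
      using M.submoduleE(4)[OF N] by (simp add: ideal_module_def)
    obtain a where a: "a \<in> N" using M.submoduleE(2)[OF N] by blast
    then have "\<zero> \<otimes> a \<in> N" using mult by blast
    then have "\<zero> \<in> N" using a NI idealD(1)[OF I] by (metis l_null subsetD)
    then show "ideal N R \<and> N \<subseteq> I" using NI add mult idealD(1)[OF I] by (auto intro!: ideal_criterion)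
  }
  {
    assume N: "ideal N R \<and> N \<subseteq> I"
    show "submodule N R (ideal_module R I)"
      using N idealD[of N] by (intro M.submodule_criterion) (auto simp: ideal_module_def)
  }
qed

text \<open>\<open>up\<close> and \<open>dn\<close> are preimage and image under I \<rightarrow> I /
  L. Both preserve strict inclusion, so chains of submodules and chains of ideals between L and I
  have the same lengths.\<close>

lemma module_length_quot:
  assumes I: "ideal I R" and L: "ideal L R" and LI: "L \<subseteq> I"
  shows "module_length R (quot_module (ideal_module R I) L) = len (pre L) (pre I)"
proof -
  let ?M = "ideal_module R I" and ?Q = "quot_module (ideal_module R I) L"
  interpret M: module R ?M by (rule ideal_module_is_module[OF I])
  have "submodule L R ?M" using L LI by (simp add: submodule_ideal_module_iff[OF I])
  then interpret Q: module R ?Q by (rule M.quot_module_is_module)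
  interpret L: ideal L R by (rule L)
  have coset: "L +>\<^bsub>?M\<^esub> x = L +> x" for x
    by (simp add: a_r_coset_def r_coset_def ideal_module_def)
  have carr: "carrier ?Q = (\<lambda>x. L +> x) ` I"
    by (auto simp: quot_module_def A_RCOSETS_def' coset) (auto simp: ideal_module_def)
  have zero: "\<zero>\<^bsub>?Q\<^esub> = L" by (simp add: quot_module_def)
  have cI: "x \<in> I \<Longrightarrow> x \<in> carrier R" for x using idealD(1)[OF I] by blast
  have eq_iff: "L +> x = L +> y \<longleftrightarrow> x \<ominus> y \<in> L" if "x \<in> carrier R" "y \<in> carrier R" for x y
    using quotient_eq_iff_same_a_r_cos[OF L that] by simp
  have Lmem: "L +> x = L" if "x \<in> L" for x
    by (rule a_rcos_zero[OF L that])
  then have L0: "L +> \<zero> = L" using idealD(2)[OF L] by blast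
  have addQ: "(L +> x) \<oplus>\<^bsub>?Q\<^esub> (L +> y) = L +> (x \<oplus> y)" if "x \<in> carrier R" "y \<in> carrier R" for x y
  proof -
    have "set_add ?M A B = A <+> B" for A B by (simp add: set_add_def set_mult_def ideal_module_def)
    then show ?thesis using L.a_rcos_sum[OF that] by (simp add: quot_module_def)
  qed
  have smQ: "a \<odot>\<^bsub>?Q\<^esub> (L +> x) = L +> (a \<otimes> x)" if a: "a \<in> carrier R" and x: "x \<in> carrier R" for a x
  proof -
    have "L +> (a \<otimes> y) = L +> (a \<otimes> x)" if y: "y \<in> L +> x" for y
    proof -
      obtain h where h: "h \<in> L" "y = h \<oplus> x" using y by (auto simp: a_r_coset_def r_coset_def)
      have hc: "h \<in> carrier R" using h L.Icarr by blast
      then have "a \<otimes> y \<ominus> a \<otimes> x = a \<otimes> h"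
        using a x h by (simp add: r_distr a_minus_def a_assoc r_neg)
      then show ?thesis using eq_iff[of "a \<otimes> y" "a \<otimes> x"] a x h hc L.I_l_closed by simp
    qed
    moreover have "x \<in> L +> x" using x by (rule L.a_rcos_self)
    ultimately have "(\<Union>y\<in>L +> x. L +> (a \<otimes> y)) = L +> (a \<otimes> x)" by blast
    then show ?thesis by (simp add: quot_module_def coset) (simp add: ideal_module_def)
  qed
  define up where "up N = {x \<in> I. L +> x \<in> N}" for N
  define dn where "dn B = (\<lambda>x. L +> x) ` B" for B
  have up: "ideal (up N) R \<and> L \<subseteq> up N \<and> up N \<subseteq> I \<and> N = dn (up N)" if N: "submodule N R ?Q" for N
  proof -
    have NQ: "N \<subseteq> carrier ?Q" by (rule Q.submoduleE(1)[OF N])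
    have dn: "N = dn (up N)" using NQ by (auto simp: carr dn_def up_def)
    obtain X where X: "X \<in> N" using Q.submoduleE(2)[OF N] by blast
    then obtain x where x: "x \<in> I" "X = L +> x" using NQ carr by auto
    have "\<zero> \<odot>\<^bsub>?Q\<^esub> X \<in> N" by (rule Q.submoduleE(4)[OF N _ X]) simp
    then have LN: "L \<in> N" using x cI by (simp add: smQ L0)
    have LI': "L \<subseteq> up N" using LI LN Lmem by (auto simp: up_def)
    have "ideal (up N) R"
    proof (rule ideal_criterion)
      show "up N \<subseteq> carrier R" using cI by (auto simp: up_def)
      show "\<zero> \<in> up N" using LI' L.zero_closed by blast
      show "a \<oplus> b \<in> up N" if "a \<in> up N" "b \<in> up N" for a b
        using that Q.submoduleE(5)[OF N, of "L +> a" "L +> b"] cI idealD(3)[OF I] by (auto simp: up_def addQ)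
      show "r \<otimes> a \<in> up N" if "r \<in> carrier R" "a \<in> up N" for r a
        using that Q.submoduleE(4)[OF N, of r "L +> a"] cI idealD(4)[OF I] by (auto simp: up_def smQ)
    qed
    with dn LI' show ?thesis by (auto simp: up_def)
  qed
  have up_less: "up N \<subset> up N'" if "submodule N R ?Q" "submodule N' R ?Q" "N \<subset> N'" for N N'
  proof -
    have "up N \<subseteq> up N'" using that by (auto simp: up_def)
    moreover have "up N \<noteq> up N'" using up[OF that(1)] up[OF that(2)] that(3) by (metis psubset_eq)
    ultimately show ?thesis by blast
  qed
  have dn: "submodule (dn B) R ?Q" if B: "ideal B R" "L \<subseteq> B" "B \<subseteq> I" for B
  proof (rule Q.submodule_criterion)
    show "dn B \<subseteq> carrier ?Q" using B by (auto simp: dn_def carr)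
    show "\<zero>\<^bsub>?Q\<^esub> \<in> dn B" unfolding zero dn_def using idealD(2)[OF B(1)] L0 by (metis imageI)
    show "X \<oplus>\<^bsub>?Q\<^esub> Y \<in> dn B" if "X \<in> dn B" "Y \<in> dn B" for X Y
      using that B cI idealD(3)[OF B(1)] by (auto simp: dn_def addQ subset_iff)
    show "a \<odot>\<^bsub>?Q\<^esub> X \<in> dn B" if "a \<in> carrier R" "X \<in> dn B" for a X
      using that B cI idealD(4)[OF B(1)] by (auto simp: dn_def smQ subset_iff)
  qed
  have dn_mem: "x \<in> B" if B: "ideal B R" "L \<subseteq> B" and x: "x \<in> carrier R" "L +> x \<in> dn B" for x B
  proof -
    obtain y where y: "y \<in> B" "L +> x = L +> y" using x by (auto simp: dn_def)
    have yc: "y \<in> carrier R" using y idealD(1)[OF B(1)] by blast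
    then have "x \<ominus> y \<in> B" using eq_iff[OF x(1)] y B by blast
    then have "(x \<ominus> y) \<oplus> y \<in> B" using y idealD(3)[OF B(1)] by blast
    then show ?thesis using x yc by (simp add: a_minus_def a_assoc l_neg)
  qed
  have dn_less: "dn B \<subset> dn B'" if "ideal B R" "L \<subseteq> B" "ideal B' R" "B \<subset> B'" for B B'
  proof -
    from \<open>B \<subset> B'\<close> obtain x where x: "x \<in> B'" "x \<notin> B" by blast
    then have "x \<in> carrier R" using idealD(1)[OF that(3)] by blast
    then have "L +> x \<notin> dn B" using dn_mem[OF that(1,2)] x by blast
    moreover have "L +> x \<in> dn B'" using x by (auto simp: dn_def)
    moreover have "dn B \<subseteq> dn B'" using that by (auto simp: dn_def)
    ultimately show ?thesis by blast
  qed
  have "(\<exists>N. (\<forall>i\<le>n. submodule (N i) R ?Q) \<and> (\<forall>i<n. N i \<subset> N (Suc i))) \<longleftrightarrow> chain_from n (pre L) (pre I)" for n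
  proof
    assume "\<exists>N. (\<forall>i\<le>n. submodule (N i) R ?Q) \<and> (\<forall>i<n. N i \<subset> N (Suc i))"
    then obtain N where N: "\<And>i. i \<le> n \<Longrightarrow> submodule (N i) R ?Q" "\<And>i. i < n \<Longrightarrow> N i \<subset> N (Suc i)" by blast
    show "chain_from n (pre L) (pre I)"
      unfolding chain_from_iff_fun
    proof (intro exI[of _ "\<lambda>i. pre (up (N i))"] conjI allI impI)
      show "pre L \<le> pre (up (N 0))" using up[OF N(1)[of 0]] L by (simp add: pre_mono_iff)
      show "pre (up (N n)) \<le> pre I" using up[OF N(1)[of n]] I by (simp add: pre_mono_iff)
      show "pre (up (N i)) < pre (up (N (Suc i)))" if "i < n" for i
        using up[OF N(1)[of i]] up[OF N(1)[of "Suc i"]] up_less[OF N(1) N(1) N(2)[OF that]] that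
        by (simp add: pre_less_iff)
    qed
  next
    assume "chain_from n (pre L) (pre I)"
    then obtain f where f: "pre L \<le> f 0" "\<And>i. i < n \<Longrightarrow> f i < f (Suc i)" "f n \<le> pre I"
      unfolding chain_from_iff_fun by blast
    have f0: "pre L \<le> f i" if "i \<le> n" for i
      using that
    proof (induction i)
      case (Suc i)
      then show ?case using f(2)[of i] by simp
    qed (use f in simp)
    have fn: "f (n - i) \<le> pre I" if "i \<le> n" for i
      using that
    proof (induction i)
      case (Suc i)
      then have "f (n - Suc i) < f (Suc (n - Suc i))" by (intro f) simp
      moreover have "Suc (n - Suc i) = n - i" using Suc.prems by simp
      ultimately show ?case using Suc by simp
    qed (use f in simp)
    have fi: "pre (img (f i)) = f i \<and> L \<subseteq> img (f i) \<and> img (f i) \<subseteq> I" if "i \<le> n" for i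
    proof -
      have "ker0 \<le> f i" using f0[OF that] ker0_le_pre[OF L] by (rule order_trans[rotated])
      then have "pre (img (f i)) = f i" by (rule pre_img)
      then show ?thesis
        using f0[OF that] fn[of "n - i"] that pre_mono_iff[OF L img_ideal, of "f i"] pre_mono_iff[OF img_ideal I, of "f i"]
        by simp
    qed
    show "\<exists>N. (\<forall>i\<le>n. submodule (N i) R ?Q) \<and> (\<forall>i<n. N i \<subset> N (Suc i))"
    proof (intro exI[of _ "\<lambda>i. dn (img (f i))"] conjI allI impI)
      show "submodule (dn (img (f i))) R ?Q" if "i \<le> n" for i
        using fi[OF that] img_ideal by (intro dn) auto
      show "dn (img (f i)) \<subset> dn (img (f (Suc i)))" if "i < n" for i
      proof (rule dn_less[OF img_ideal _ img_ideal])
        show "L \<subseteq> img (f i)" using fi[of i] that by simp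
        show "img (f i) \<subset> img (f (Suc i))"
          using fi[of i] fi[of "Suc i"] f(2)[OF that] that pre_less_iff[OF img_ideal img_ideal, of "f i" "f (Suc i)"] by simp
      qed
    qed
  qed
  then show ?thesis unfolding module_length_def len_def by (intro arg_cong[of _ _ Sup]) auto
qed

end

text \<open>The bound d \<ge> 1 excludes the empty set, whose supremum is 0.\<close>

lemma Sup_enat_attained:
  assumes "Sup S = enat d" "d \<ge> 1"
  shows "enat d \<in> S"
proof -
  have "S \<noteq> {}" using assms by (auto simp: Sup_enat_def zero_enat_def)
  moreover have "finite S" "Max S = enat d"
    using assms(1) \<open>S \<noteq> {}\<close> by (auto simp: Sup_enat_def split: if_splits)
  ultimately show ?thesis using Max_in[of S] by simp
qed

lemma reg_iff_nth:
  "reg K us \<longleftrightarrow> (\<forall>i<length us. colon (K + lgen (take i us)) (us ! i) \<le> K + lgen (take i us))"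
proof (induction us arbitrary: K)
  case (Cons u us)
  then show ?case by (simp add: All_less_Suc2 add.assoc)
qed simp

lemma poly_eq_if_eventually_eq:
  fixes p q :: "real poly"
  assumes "\<forall>\<^sub>F n in sequentially. poly p (real n) = poly q (real n)"
  shows "p = q"
proof (rule ccontr)
  assume "p \<noteq> q"
  then have fin: "finite {x. poly (p - q) x = 0}" by (intro poly_roots_finite) simp
  obtain N where "\<And>n. n \<ge> N \<Longrightarrow> poly p (real n) = poly q (real n)"
    using assms by (auto simp: eventually_sequentially)
  then have "real ` {N..} \<subseteq> {x. poly (p - q) x = 0}" by auto
  then have "finite (real ` {N..})" using fin by (rule finite_subset)
  then have "finite {N..}" by (rule finite_imageD) simp
  then show False using infinite_Ici by blast
qed

context cring
begin

lemma min_num_gens_eq: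
  assumes "local_base ker0 M" and I: "ideal I R"
  shows "len (ker0 + M * pre I) (pre I) = enat (min_num_gens R (ideal_module R I))"
proof -
  interpret local_base ker0 M by fact
  let ?P = "\<lambda>n. \<exists>S\<subseteq>carrier (ideal_module R I). finite S \<and> card S = n \<and>
      (\<lambda>N. submodule N R (ideal_module R I)) hull S = carrier (ideal_module R I)"
  have K: "ker0 \<le> pre I" by (rule ker0_le_pre[OF I])
  have le: "ker0 + M * pre I \<le> pre I" using K by (simp add: plus_le_iff)
  have hull: "(\<lambda>N. submodule N R (ideal_module R I)) hull S = Idl S" if S: "S \<subseteq> I" for S
  proof (rule hull_unique)
    have c: "S \<subseteq> carrier R" using S idealD(1)[OF I] by blast
    show "S \<subseteq> Idl S" using c by (rule genideal_self)
    show "submodule (Idl S) R (ideal_module R I)"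
      using genideal_ideal[OF c] genideal_minimal[OF I S] by (simp add: submodule_ideal_module_iff[OF I])
    show "Idl S \<subseteq> N" if "S \<subseteq> N" "submodule N R (ideal_module R I)" for N
      using that genideal_minimal by (simp add: submodule_ideal_module_iff[OF I])
  qed
  have lower: "len (ker0 + M * pre I) (pre I) \<le> enat n" if P: "?P n" for n
  proof -
    obtain S where S: "S \<subseteq> I" "finite S" "card S = n" "Idl S = I"
      using P hull by (auto simp: ideal_module_def)
    obtain xs where xs: "set xs = S" "length xs = n" using S finite_distinct_list distinct_card by metis
    have "set xs \<subseteq> carrier R" using xs S(1) idealD(1)[OF I] by blast
    then obtain us where us: "map \<phi> us = xs" using lift_list by blast
    have "\<phi> ` set us = S" using xs(1) unfolding us[symmetric] by simp
    then have "pre I = ker0 + lgen us" using pre_genideal[of us] S(4) by simp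
    then have "len (ker0 + M * pre I) (pre I) \<le> enat (length us)" by (rule len_le_gens[OF K])
    then show ?thesis using xs(2) us by (metis length_map)
  qed
  have "len (ker0 + M * pre I) (pre I) \<noteq> \<infinity>"
    using len_quot_m_finite[OF _ K _ le] by simp
  then obtain l where l: "len (ker0 + M * pre I) (pre I) = enat l" by auto
  obtain us where us: "length us = l" "pre I = ker0 + lgen us" using min_gens[OF K l] by blast
  let ?S = "\<phi> ` set us"
  have "pre (Idl ?S) = pre I" by (simp only: pre_genideal us(2))
  moreover have "ideal (Idl ?S) R" by (rule genideal_ideal) auto
  ultimately have Idl: "Idl ?S = I" using pre_inj[OF _ I] by blast
  have "?S \<subseteq> Idl ?S" by (rule genideal_self) auto
  then have SI: "?S \<subseteq> I" by (simp only: Idl)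
  have P: "?P (card ?S)"
    using SI hull[OF SI] Idl by (intro exI[of _ ?S]) (auto simp: ideal_module_def)
  \<comment> \<open>Entries of the list may have equal images in R, so the set could be smaller than
    l; the bound \<open>lower\<close> excludes that.\<close>
  have "card ?S \<le> l" using us(1) card_image_le[of "set us" \<phi>] card_length[of us] by simp
  moreover have "l \<le> card ?S" using lower[OF P] l by simp
  ultimately have card: "card ?S = l" by simp
  have "min_num_gens R (ideal_module R I) = l"
    unfolding min_num_gens_def
  proof (rule Least_equality)
    show "?P l" using P unfolding card .
    show "l \<le> n" if "?P n" for n using lower[OF that] l by simp
  qed
  then show ?thesis by (simp add: l)
qed

lemma prime_above_img:
  assumes "local_base ker0 M" "local_base.prime_above ker0 P"
  shows "primeideal (img P) R \<and> pre (img P) = P"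
proof -
  interpret local_base ker0 M by fact
  have P: "ker0 \<le> P" "1 \<notin> elts P" "\<And>x y. x * y \<in> elts P \<Longrightarrow> x \<in> elts P \<or> y \<in> elts P"
    using assms(2) by (auto simp: prime_above_def)
  have pi: "pre (img P) = P" by (rule pre_img[OF P(1)])
  have mem: "u \<in> elts P \<longleftrightarrow> \<phi> u \<in> img P" for u using elts_pre[OF img_ideal, of P] by (auto simp: pi)
  have "primeideal (img P) R"
  proof (rule primeidealI[OF img_ideal is_cring])
    show "carrier R \<noteq> img P" using P(2) mem[of 1] by auto
    fix a b assume a: "a \<in> carrier R" "b \<in> carrier R" "a \<otimes> b \<in> img P"
    then obtain u v where uv: "\<phi> u = a" "\<phi> v = b" using \<phi>_surj by metis
    then have "u * v \<in> elts P" using a mem by simp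
    then show "a \<in> img P \<or> b \<in> img P" using P(3) uv mem by blast
  qed
  with pi show ?thesis by simp
qed

lemma regular_sequence_reg:
  assumes "regular_sequence R (map \<phi> us)"
  shows "reg ker0 us"
  unfolding reg_iff_nth
proof (intro allI impI colon_leI)
  fix i a assume i: "i < length us" and a: "us ! i * a \<in> elts (ker0 + lgen (take i us))"
  let ?S = "\<phi> ` set (take i us)"
  have ideal: "ideal (Idl ?S) R" by (rule genideal_ideal) auto
  have e: "elts (ker0 + lgen (take i us)) = {u. \<phi> u \<in> Idl ?S}"
    unfolding pre_genideal[symmetric] by (rule elts_pre[OF ideal])
  have S: "set (take i (map \<phi> us)) = ?S" by (simp add: take_map)
  have "\<forall>b\<in>carrier R. map \<phi> us ! i \<otimes> b \<in> Idl ?S \<longrightarrow> b \<in> Idl ?S"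
    using assms i unfolding regular_sequence_def S[symmetric] by simp
  then show "a \<in> elts (ker0 + lgen (take i us))" using a i unfolding e by simp
qed

end

section \<open>The free-ring model of a Noetherian local ring\<close>

context noetherian_local_ring
begin

lemma ideal_m: "ideal m R"
  by (rule is_ideal)

lemma local_base_free: "local_base ker0 (pre m)"
proof -
  interpret noetherian_above ker0
  proof
    fix f :: "nat \<Rightarrow> 'a free_ring idl"
    assume f: "\<And>n. ker0 \<le> f n" "\<And>n. f n \<le> f (Suc n)"
    have mono: "f i \<le> f j" if "i \<le> j" for i j
      using f(2) that by (rule lift_Suc_mono_le)
    have img_mono: "img (f i) \<subseteq> img (f j)" if "i \<le> j" for i j
      using mono[OF that] by (auto simp: img_def less_eq_idl_def)
    have "subset.chain {I. ideal I R} (range (\<lambda>n. img (f n)))"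
      unfolding subset_chain_def
    proof (intro conjI ballI)
      show "range (\<lambda>n. img (f n)) \<subseteq> {I. ideal I R}" using img_ideal by blast
      fix X Y assume "X \<in> range (\<lambda>n. img (f n))" "Y \<in> range (\<lambda>n. img (f n))"
      then obtain i j where "X = img (f i)" "Y = img (f j)" by blast
      then show "X \<subseteq> Y \<or> Y \<subseteq> X" using img_mono[of i j] img_mono[of j i] linear[of i j] by blast
    qed
    then have "\<Union>(range (\<lambda>n. img (f n))) \<in> range (\<lambda>n. img (f n))"
      by (intro ideal_chain_is_trivial) auto
    then obtain n where n: "(\<Union>k. img (f k)) = img (f n)" by auto
    have "f k = f n" if "k \<ge> n" for k
    proof -
      have "img (f k) = img (f n)" using n img_mono[OF that] by blast
      then show ?thesis using pre_img[OF f(1)] by metis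
    qed
    then show "\<exists>n. \<forall>k\<ge>n. f k = f n" by blast
  qed
  show ?thesis
  proof
    show "pre m \<noteq> 1" using I_notcarr by (simp add: pre_eq_1_iff[OF ideal_m])
    show "ker0 \<le> pre m" by (rule ker0_le_pre[OF ideal_m])
    fix I assume I: "ker0 \<le> I" "I \<noteq> 1"
    obtain M where M: "I \<le> M" "M \<noteq> 1" and max: "\<And>N. M < N \<Longrightarrow> N = 1"
      using maximal_exists[of "\<lambda>M. M \<noteq> 1" I] I by blast
    have pM: "pre (img M) = M" using I(1) M(1) by (intro pre_img) (rule order_trans)
    have "maximalideal (img M) R"
    proof (rule maximalidealI[OF img_ideal])
      show "carrier R \<noteq> img M" using M(2) pM pre_carrier by metis
      fix L assume L: "ideal L R" "img M \<subseteq> L" "L \<subseteq> carrier R"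
      then have "M \<le> pre L" using pre_mono_iff[OF img_ideal L(1), of M] pM by simp
      then have "M = pre L \<or> pre L = 1" using max[of "pre L"] by (auto simp: order.order_iff_strict)
      then show "L = img M \<or> L = carrier R"
        using pre_inj[OF img_ideal L(1), of M] pM pre_eq_1_iff[OF L(1)] by auto
    qed
    then have "img M = m" by (rule maximal_unique)
    then show "I \<le> pre m" using pM M(1) by simp
  qed
qed

lemma local_inf_free:
  assumes "infinite (carrier (R Quot m))"
  shows "\<exists>T. local_inf ker0 (pre m) T"
proof -
  define rep where "rep X = (SOME u. X = m +> \<phi> u)" for X
  have rep: "X = m +> \<phi> (rep X)" if X: "X \<in> carrier (R Quot m)" for X
  proof -
    obtain a where "a \<in> carrier R" "X = m +> a" using X by (auto simp: FactRing_def A_RCOSETS_def')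
    then have "\<exists>u. X = m +> \<phi> u" using \<phi>_surj by metis
    then show ?thesis unfolding rep_def by (rule someI_ex)
  qed
  define T where "T = rep ` carrier (R Quot m)"
  have "inj_on rep (carrier (R Quot m))" using rep by (metis inj_onI)
  then have "infinite T" using assms by (simp add: T_def finite_image_iff)
  moreover have "s - t \<notin> elts (pre m)" if "s \<in> T" "t \<in> T" "s \<noteq> t" for s t
  proof
    assume "s - t \<in> elts (pre m)"
    then have "\<phi> s \<ominus> \<phi> t \<in> m" by (simp add: elts_pre[OF ideal_m])
    then have eq: "m +> \<phi> s = m +> \<phi> t" using quotient_eq_iff_same_a_r_cos[OF ideal_m] by simp
    from \<open>s \<in> T\<close> \<open>t \<in> T\<close>
    obtain X Y where "X \<in> carrier (R Quot m)" "s = rep X" "Y \<in> carrier (R Quot m)" "t = rep Y"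
      by (auto simp: T_def)
    then have "X = Y" using rep eq by metis
    then show False using that \<open>s = rep X\<close> \<open>t = rep Y\<close> by simp
  qed
  ultimately have "local_inf ker0 (pre m) T"
    using local_base_free by (intro local_inf.intro local_inf_axioms.intro) auto
  then show ?thesis ..
qed

end

theorem theorem1:
  fixes A :: "('a, 'b) ring_scheme" (structure)
    and \<mm> J :: "'a set"
    and d :: nat
  assumes "cohen_macaulay_local_ring \<mm> A"
    and "krull_dim A = enat d"
    and "d \<ge> 1"
    and "infinite (carrier (A Quot \<mm>))"
    and "is_minimal_reduction A J \<mm>"
  shows "\<exists>l. module_length A
                (quot_module (ideal_module A (ideal_pow A \<mm> 3)) (J \<cdot>\<^bsub>A\<^esub> ideal_pow A \<mm> 2)) = enat l \<and>
             int l = int (local_multiplicity A \<mm>)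
               + (int d - 1) * int (min_num_gens A (ideal_module A \<mm>))
               - int (min_num_gens A (ideal_module A (ideal_pow A \<mm> 2)))
               - int ((d - 1) choose 2)"
proof -
  interpret cohen_macaulay_local_ring \<mm> A by fact
  obtain T where "local_inf ker0 (pre \<mm>) T" using local_inf_free[OF assms(4)] ..
  then interpret F: local_inf ker0 "pre \<mm>" T .
  let ?M = "pre \<mm>" and ?J = "pre J"
  have J: "ideal J A" "J \<subseteq> \<mm>" using assms(5) by (auto simp: is_minimal_reduction_def is_reduction_def)
  have JM: "?J \<le> ?M" using J by (simp add: pre_mono_iff ideal_m)
  note pow = ideal_pow_ideal[OF ideal_m]
  have pre_red: "pre (L \<cdot> ideal_pow A \<mm> n) = ker0 + pre L * ?M ^ n" if "ideal L A" for L n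
  proof -
    have "ker0 + pre L * ker0 = ker0" by (rule idl_add_absorb2) simp
    then show ?thesis by (simp add: pre_prod[OF that pow] pre_pow[OF ideal_m] distrib_left flip: add.assoc)
  qed
  \<comment> \<open>Minimality of J speaks about ideals of A, so an ideal with
    \<open>reduces\<close> has to be carried back to a reduction in A.\<close>
  have red: "is_reduction A (img L) \<mm>" if L: "ker0 \<le> L" "L \<le> ?M" "F.reduces L n" for L n
  proof -
    have p: "pre (img L) = L" by (rule pre_img[OF L(1)])
    have "pre (ideal_pow A \<mm> (n + 1)) = pre (img L \<cdot> ideal_pow A \<mm> n)"
      unfolding pre_red[OF img_ideal] pre_pow[OF ideal_m] p
      using L(3) mult_right_mono[OF L(2), of "?M ^ n"]
      by (intro antisym) (auto simp: plus_le_iff F.reduces_def power_Suc intro: idl_le_addI2)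
    then have "ideal_pow A \<mm> (n + 1) = img L \<cdot> ideal_pow A \<mm> n"
      using pre_inj[OF pow ideal_prod_is_ideal[OF img_ideal pow]] by blast
    moreover have "img L \<subseteq> \<mm>" using L(2) pre_mono_iff[OF img_ideal ideal_m, of L] p by simp
    ultimately show ?thesis unfolding is_reduction_def using img_ideal by blast
  qed
  have "is_reduction A J \<mm>" using assms(5) by (simp add: is_minimal_reduction_def)
  then obtain N where N: "ideal_pow A \<mm> (N + 1) = J \<cdot> ideal_pow A \<mm> N" by (auto simp: is_reduction_def)
  have redJ: "F.reduces ?J N"
    using arg_cong[OF N, of pre] unfolding F.reduces_def pre_red[OF J(1)] pre_pow[OF ideal_m]
    by (metis Suc_eq_plus1 idl_le_add2)
  have minJ: "L = ?J" if "ker0 \<le> L" "L \<le> ?J" "F.reduces L n" for L n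
  proof -
    have p: "pre (img L) = L" by (rule pre_img[OF that(1)])
    have "is_reduction A (img L) \<mm>" using that JM by (intro red) auto
    moreover have "img L \<subseteq> J" using that(2) pre_mono_iff[OF img_ideal J(1), of L] p by simp
    ultimately have "img L = J" using assms(5) unfolding is_minimal_reduction_def by blast
    then show ?thesis using p by simp
  qed
  \<comment> \<open>Cohen-Macaulayness enters here: depth equals d, and being finite and positive it
    is attained by a regular sequence of length d.\<close>
  have "ideal_depth A \<mm> = enat d" using depth_eq_dim assms(2) by simp
  from Sup_enat_attained[OF this[unfolded ideal_depth_def] assms(3)]
  obtain xs where xs: "length xs = d" "set xs \<subseteq> \<mm>" "regular_sequence A xs" by auto
  obtain ys where ys: "map \<phi> ys = xs" using lift_list[of xs] xs(2) idealD(1)[OF ideal_m] by blast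
  have ysd: "length ys = d" using ys xs(1) by (metis length_map)
  have ysm: "set ys \<subseteq> elts ?M" using xs(2) unfolding elts_pre[OF ideal_m] ys[symmetric] by auto
  have regys: "reg ker0 ys" using xs(3) unfolding ys[symmetric] by (rule regular_sequence_reg)
  have "\<exists>c. ?M ^ c \<le> ker0 + lgen ys"
  proof (rule F.reg_primary[OF regys ysm], rule notI)
    assume "\<exists>Q. (\<forall>i\<le>Suc (length ys). F.prime_above (Q i)) \<and> (\<forall>i<Suc (length ys). Q i < Q (Suc i))"
    then obtain Q where Q: "\<And>i. i \<le> Suc d \<Longrightarrow> F.prime_above (Q i)" "\<And>i. i < Suc d \<Longrightarrow> Q i < Q (Suc i)"
      by (auto simp: ysd)
    have P: "primeideal (img (Q i)) A \<and> pre (img (Q i)) = Q i" if "i \<le> Suc d" for i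
      using prime_above_img[OF local_base_free Q(1)[OF that]] .
    have "img (Q i) \<subset> img (Q (Suc i))" if "i < Suc d" for i
      using Q(2)[OF that] P[of i] P[of "Suc i"] that pre_less_iff[OF img_ideal img_ideal, of "Q i" "Q (Suc i)"] by simp
    with P have "(\<forall>i\<le>Suc d. primeideal (img (Q i)) A) \<and> (\<forall>i<Suc d. img (Q i) \<subset> img (Q (Suc i)))"
      by blast
    then have "\<exists>P. (\<forall>i\<le>Suc d. primeideal (P i) A) \<and> (\<forall>i<Suc d. P i \<subset> P (Suc i))"
      by (rule exI[of _ "\<lambda>i. img (Q i)"])
    then have "enat (Suc d) \<le> krull_dim A"
      unfolding krull_dim_def by (intro Sup_upper) blast
    then show False using assms(2) by simp
  qed
  then obtain c where c: "?M ^ c \<le> ker0 + lgen ys" ..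
  have "ys \<noteq> []" using ysd assms(3) by auto
  have "\<exists>ws. length ws = length ys \<and> ?J = ker0 + lgen ws"
    by (rule F.minimal_reduction_generators[OF ker0_le_pre[OF J(1)] JM redJ _ ysm c \<open>ys \<noteq> []\<close>]) (rule minJ)
  then obtain ws where ws: "length ws = length ys" "?J = ker0 + lgen ws" by blast
  have "?M ^ Suc N \<le> ?J" by (rule F.reduces_primary[OF redJ ker0_le_pre[OF J(1)]])
  from F.exists_regular_generators[OF ws(2) this JM regys ysm] ws(1)
  obtain zs where zs: "length zs = d" "reg ker0 zs" "?J = ker0 + lgen zs" using ysd by auto
  interpret G: regular_reduction ker0 "pre \<mm>" T "pre J" N zs
    by unfold_locales (use JM redJ minJ zs in auto)
  obtain e where e: "len ?J 1 = enat e"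
    using F.len_finite_above_m_power[OF G.primary ker0_le_pre[OF J(1)], of 1] by auto
  have mult: "local_multiplicity A \<mm> = e"
  proof -
    have ml: "module_length A (quot_module (ideal_module A (carrier A)) (ideal_pow A \<mm> (n + 1)))
        = len (ker0 + ?M ^ (n + 1)) 1" for n
      using module_length_quot[OF oneideal pow idealD(1)[OF pow], of "n + 1"]
      by (simp only: pre_pow[OF ideal_m] pre_carrier)
    obtain p :: "real poly" where p: "0 < e" "Polynomial.degree p = d" "Polynomial.lead_coeff p = real e / fact d"
      "\<forall>\<^sub>F n in sequentially. \<exists>l. len (ker0 + ?M ^ (n + 1)) 1 = enat l \<and> real l = poly p (real n)"
      using G.hilbert_samuel[OF e zs(1)] by blast
    show ?thesis
      unfolding local_multiplicity_def ml
    proof (rule the_equality)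
      show "0 < e \<and> (\<exists>p :: real poly. enat (Polynomial.degree p) = krull_dim A \<and>
          Polynomial.lead_coeff p = real e / fact (Polynomial.degree p) \<and>
          (\<forall>\<^sub>F n in sequentially. \<exists>l. len (ker0 + ?M ^ (n + 1)) 1 = enat l \<and> real l = poly p (real n)))"
        using p assms(2) by (intro conjI exI[of _ p]) simp_all
      fix e' assume "0 < e' \<and> (\<exists>p :: real poly. enat (Polynomial.degree p) = krull_dim A \<and>
          Polynomial.lead_coeff p = real e' / fact (Polynomial.degree p) \<and>
          (\<forall>\<^sub>F n in sequentially. \<exists>l. len (ker0 + ?M ^ (n + 1)) 1 = enat l \<and> real l = poly p (real n)))"
      then obtain q :: "real poly" where q: "enat (Polynomial.degree q) = krull_dim A"
        "Polynomial.lead_coeff q = real e' / fact (Polynomial.degree q)"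
        "\<forall>\<^sub>F n in sequentially. \<exists>l. len (ker0 + ?M ^ (n + 1)) 1 = enat l \<and> real l = poly q (real n)"
        by blast
      have "\<forall>\<^sub>F n in sequentially. poly p (real n) = poly q (real n)"
        using p(4) q(3) by eventually_elim auto
      \<comment> \<open>Polynomials that agree at all large n coincide, which makes the multiplicity
        unique.\<close>
      then have "p = q" by (rule poly_eq_if_eventually_eq)
      then have "real e / fact d = real e' / fact d" using p q by metis
      then show "e' = e" by simp
    qed
  qed
  define \<mu> where "\<mu> = min_num_gens A (ideal_module A \<mm>)"
  define \<mu>2 where "\<mu>2 = min_num_gens A (ideal_module A (ideal_pow A \<mm> 2))"
  have \<mu>: "len (ker0 + ?M\<^sup>2) ?M = enat \<mu>"
    using min_num_gens_eq[OF local_base_free ideal_m] by (simp add: \<mu>_def power2_eq_square)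
  have p2: "pre (ideal_pow A \<mm> 2) = ker0 + ?M\<^sup>2" and p3: "pre (ideal_pow A \<mm> 3) = ker0 + ?M ^ 3"
    by (simp_all only: pre_pow[OF ideal_m])
  have "ker0 + ?M * (ker0 + ?M\<^sup>2) = ker0 + ?M ^ 3"
  proof -
    have "ker0 + ?M * ker0 = ker0" by (rule idl_add_absorb2) simp
    then show ?thesis by (simp add: distrib_left numeral_3_eq_3 power2_eq_square power_Suc flip: add.assoc)
  qed
  then have \<mu>2: "len (ker0 + ?M ^ 3) (ker0 + ?M\<^sup>2) = enat \<mu>2"
    using min_num_gens_eq[OF local_base_free pow[of 2]] by (simp add: \<mu>2_def p2)
  have prod: "ideal (J \<cdot> ideal_pow A \<mm> 2) A" by (rule ideal_prod_is_ideal[OF J(1) pow])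
  have "ker0 + ?J * ?M\<^sup>2 \<le> ker0 + ?M ^ 3"
    using mult_right_mono[OF JM, of "?M\<^sup>2"]
    by (simp add: plus_le_iff numeral_3_eq_3 power_Suc power2_eq_square idl_le_addI2)
  then have "J \<cdot> ideal_pow A \<mm> 2 \<subseteq> ideal_pow A \<mm> 3"
    using pre_mono_iff[OF prod pow[of 3]] by (simp add: pre_red[OF J(1)] p3)
  then have "module_length A (quot_module (ideal_module A (ideal_pow A \<mm> 3)) (J \<cdot> ideal_pow A \<mm> 2))
      = len (ker0 + ?J * ?M\<^sup>2) (ker0 + ?M ^ 3)"
    using module_length_quot[OF pow prod] by (simp add: pre_red[OF J(1)] p3)
  then show ?thesis
    using G.length_formula[OF e \<mu> \<mu>2 zs(1) assms(3)] unfolding mult \<mu>_def \<mu>2_def by simp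
qed

end
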